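(* Let $K$ be a commutative ring, let $\langle\cdot|:T\hookrightarrow V_0\oslash\cdots\oslash V_n$ be a tensor space over $K$ with frame consisting of finitely generated projective $K$-modules, and let $S\subseteq T$. Let $P=(p_1,\dots,p_r)$ be an ideal generated by linear homogeneous polynomials $p_1,\dots,p_r\in K[X_A]$, with support $\operatorname{supp}P=A\subseteq\{0,\dots,n\}$. If $S$ is full, or is nondegenerate in some axis, and there is $(\lambda,\rho)=((\lambda_a,\rho_a))_{a\in A}\in(K^2)^A$ such that $\mathbf{Z}^A(S,P)$ is closed under $\bullet_{(\lambda,\rho)}$, then the $a$-axis product is unital in at most $2r$ axes $a\in A$. If $K$ is a field, then in addition at least $|A|-2r$ of the axis products are Lie products.
   Context: $V_0\oslash\cdots\oslash V_n$ is the $K$-module of $K$-multilinear maps $V_1\times\cdots\times V_n\to V_0$. A tensor space is a $K$-module $T$ with a $K$-linear injection $t\mapsto\langle t|$ into it. $K[X_A]=K[x_a:a\in A]$. For a commutative $K$-algebra $L$, $\langle t_L|$ is the $L$-multilinear extension of $\langle t|$. For $A\subseteq\{0,\dots,n\}$ let $\Omega_A(L)=\prod_{a\in A}\operatorname{End}_L(L\otimes V_a)$. For $p=\sum_e\lambda_eX^e\in K[X_A]$ and $\omega\in\Omega_A(L)$, put $\langle t_L|p(\omega)|w\rangle=\sum_e\lambda_e\omega_0^{e(0)}\langle t_L|\omega_1^{e(1)}w_1,\dots,\omega_n^{e(n)}w_n\rangle$, where for $a\notin A$ the exponent $e(a)$ is $0$ and the $a$-axis is left unchanged. Then $\mathbf{Z}^A(S,P)(L)$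 is the set of $\omega\in\Omega_A(L)$ with $\langle t_L|p(\omega)|w\rangle=0$ for all $t\in S$, all $p\in P\cap K[X_A]$ and all $w$. The product $\bullet=\bullet_{(\lambda,\rho)}$ on $\Omega_A(L)$ is $\omega\bullet\tau=(\lambda_a\omega_a\tau_a+\rho_a\tau_a\omega_a)_{a\in A}$. "$\mathbf{Z}^A(S,P)$ is closed under $\bullet$" means $\mathbf{Z}^A(S,P)(L)$ is closed under it for every $L$. The $a$-axis product is the restriction of $\bullet$ to the $a$-th factor, $(x,y)\mapsto\lambda_axy+\rho_ayx$ on $\operatorname{End}(V_a)$; it is unital if it has a two-sided identity, and it is a Lie product if $\lambda_a+\rho_a=0$. A linear homogeneous polynomial is one of the form $\sum_a\lambda_ax_a$. For an ideal $P$ generated by such polynomials, $\operatorname{supp}P$ is the set of $a$ such that the coefficients of $x_a$ in the linear homogeneous elements of $P$ generate the unit ideal of $K$. $S$ is full if $V_0$ is spanned over $K$ by all $\langle t|v\rangle$, $t\in S$. For $a\ge1$, $S$ is nondegenerate in the $a$-axis if every nonzero $v_a\in V_a$ admits $v_b\in V_b$ ($b\in\{1,\dots,n\}\setminus\{a\}$) and $t\in S$ with $\langle t|v_1,\dots,v_n\rangle\neq0$. Nondegenerate in the $0$-axis means full.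
   Formalization: All frame modules V_a are assumed nonzero; without this the claim fails (K a field, V_0 = 0, other V_a nonzero, n ≥ 2, P = (x_0+…+x_n), λ = 1, ρ = 0: S is vacuously full, Z is everything, and all n+1 > 2 axis products are unital and none is Lie). *)

theory Defs
  imports "HOL-Algebra.Algebra"
begin

section \<open>Modules\<close>

text \<open>Records of type \<open>module\<close> built below only carry a module structure; their unused
  ring fields \<open>mult\<close> and \<open>one\<close> are left undefined.\<close>

definition submodule_span ::
    "('r, 'm) ring_scheme \<Rightarrow> ('r, 'v, 'n) module_scheme \<Rightarrow> 'v set \<Rightarrow> 'v set" where
  "submodule_span R M B = \<Inter>{H. submodule H R M \<and> B \<subseteq> H}"

definition linear_maps ::
    "('r, 'm) ring_scheme \<Rightarrow> ('r, 'v, 'n) module_scheme \<Rightarrow> ('r, 'w, 'o) module_scheme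
     \<Rightarrow> ('v \<Rightarrow> 'w) set" where
  "linear_maps R M N = {f \<in> carrier M \<rightarrow> carrier N.
     (\<forall>x\<in>carrier M. \<forall>y\<in>carrier M. f (x \<oplus>\<^bsub>M\<^esub> y) = f x \<oplus>\<^bsub>N\<^esub> f y) \<and>
     (\<forall>r\<in>carrier R. \<forall>x\<in>carrier M. f (r \<odot>\<^bsub>M\<^esub> x) = r \<odot>\<^bsub>N\<^esub> f x)}"

text \<open>Endomorphisms are extensional, so that equality of functions is equality of
  endomorphisms.\<close>

definition module_endos ::
    "('r, 'm) ring_scheme \<Rightarrow> ('r, 'v, 'n) module_scheme \<Rightarrow> ('v \<Rightarrow> 'v) set" where
  "module_endos R M = linear_maps R M M \<inter> extensional (carrier M)"

definition free_module :: "('r, 'm) ring_scheme \<Rightarrow> 'b set \<Rightarrow> ('r, 'b \<Rightarrow> 'r) module" where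
  "free_module R B =
     \<lparr>carrier = {f. (\<forall>b\<in>B. f b \<in> carrier R) \<and> (\<forall>b. b \<notin> B \<longrightarrow> f b = \<zero>\<^bsub>R\<^esub>)
                   \<and> finite {b. f b \<noteq> \<zero>\<^bsub>R\<^esub>}},
      monoid.mult = undefined, monoid.one = undefined,
      ring.zero = (\<lambda>_. \<zero>\<^bsub>R\<^esub>), ring.add = (\<lambda>f g b. f b \<oplus>\<^bsub>R\<^esub> g b),
      smult = (\<lambda>r f b. r \<otimes>\<^bsub>R\<^esub> f b)\<rparr>"

definition basis_vector :: "('r, 'm) ring_scheme \<Rightarrow> 'b \<Rightarrow> 'b \<Rightarrow> 'r" where
  "basis_vector R b = (\<lambda>c. if c = b then \<one>\<^bsub>R\<^esub> else \<zero>\<^bsub>R\<^esub>)"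

definition quotient_module ::
    "('r, 'v, 'n) module_scheme \<Rightarrow> 'v set \<Rightarrow> ('r, 'v set) module" where
  "quotient_module M N =
     \<lparr>carrier = a_rcosets\<^bsub>M\<^esub> N,
      monoid.mult = undefined, monoid.one = undefined,
      ring.zero = N, ring.add = set_add M,
      smult = (\<lambda>r C. \<Union>x\<in>C. N +>\<^bsub>M\<^esub> (r \<odot>\<^bsub>M\<^esub> x))\<rparr>"

definition finitely_generated_module ::
    "('r, 'm) ring_scheme \<Rightarrow> ('r, 'v, 'n) module_scheme \<Rightarrow> bool" where
  "finitely_generated_module R M \<longleftrightarrow>
     (\<exists>B. finite B \<and> B \<subseteq> carrier M \<and> submodule_span R M B = carrier M)"

text \<open>Projective means being a direct summand (retract) of a free module. Basis sets inside
  the type of the module are enough, since every module is a quotient of the free module on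
  its own carrier.\<close>

definition projective_module ::
    "('r, 'm) ring_scheme \<Rightarrow> ('r, 'v, 'n) module_scheme \<Rightarrow> bool" where
  "projective_module R M \<longleftrightarrow>
     (\<exists>B :: 'v set. \<exists>i \<in> linear_maps R M (free_module R B).
        \<exists>q \<in> linear_maps R (free_module R B) M. \<forall>x\<in>carrier M. q (i x) = x)"


section \<open>Extension of scalars\<close>

text \<open>\<open>L \<otimes>\<^sub>K V\<close>, presented as an \<open>L\<close>-module: generators \<open>1 \<otimes> v\<close> for \<open>v \<in> V\<close>, with relations
  saying that \<open>v \<mapsto> 1 \<otimes> v\<close> is \<open>K\<close>-linear. Here \<open>K\<close> acts on \<open>L\<close>-modules via
  \<open>k \<mapsto> k \<odot>\<^bsub>L\<^esub> \<one>\<^bsub>L\<^esub>\<close>.\<close>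

definition base_change_relations ::
    "('k, 'm) ring_scheme \<Rightarrow> ('k, 'l) module \<Rightarrow> ('k, 'v) module \<Rightarrow> ('v \<Rightarrow> 'l) set" where
  "base_change_relations K L V =
     (let F = free_module L (carrier V); e = basis_vector L in
        {e (x \<oplus>\<^bsub>V\<^esub> y) \<ominus>\<^bsub>F\<^esub> (e x \<oplus>\<^bsub>F\<^esub> e y) | x y. x \<in> carrier V \<and> y \<in> carrier V} \<union>
        {e (k \<odot>\<^bsub>V\<^esub> x) \<ominus>\<^bsub>F\<^esub> ((k \<odot>\<^bsub>L\<^esub> \<one>\<^bsub>L\<^esub>) \<odot>\<^bsub>F\<^esub> e x) | k x. k \<in> carrier K \<and> x \<in> carrier V})"

definition base_change_kernel ::
    "('k, 'm) ring_scheme \<Rightarrow> ('k, 'l) module \<Rightarrow> ('k, 'v) module \<Rightarrow> ('v \<Rightarrow> 'l) set" where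
  "base_change_kernel K L V =
     submodule_span L (free_module L (carrier V)) (base_change_relations K L V)"

definition base_change ::
    "('k, 'm) ring_scheme \<Rightarrow> ('k, 'l) module \<Rightarrow> ('k, 'v) module
     \<Rightarrow> ('l, ('v \<Rightarrow> 'l) set) module" where
  "base_change K L V =
     quotient_module (free_module L (carrier V)) (base_change_kernel K L V)"

definition one_tensor ::
    "('k, 'm) ring_scheme \<Rightarrow> ('k, 'l) module \<Rightarrow> ('k, 'v) module \<Rightarrow> 'v \<Rightarrow> ('v \<Rightarrow> 'l) set" where
  "one_tensor K L V v =
     base_change_kernel K L V +>\<^bsub>free_module L (carrier V)\<^esub> basis_vector L v"


section \<open>Tensor spaces\<close>

text \<open>Argument tuples \<open>(v\<^sub>1, \<dots>, v\<^sub>n)\<close> are extensional functions on \<open>{1..n}\<close>.\<close>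

definition arg_tuples :: "nat \<Rightarrow> (nat \<Rightarrow> ('r, 'v) module) \<Rightarrow> (nat \<Rightarrow> 'v) set" where
  "arg_tuples n V = (\<Pi>\<^sub>E a\<in>{1..n}. carrier (V a))"

definition multilinear_maps ::
    "('r, 'm) ring_scheme \<Rightarrow> nat \<Rightarrow> (nat \<Rightarrow> ('r, 'v) module) \<Rightarrow> ((nat \<Rightarrow> 'v) \<Rightarrow> 'v) set" where
  "multilinear_maps R n V = {f \<in> arg_tuples n V \<rightarrow>\<^sub>E carrier (V 0).
     \<forall>v\<in>arg_tuples n V. \<forall>a\<in>{1..n}.
       (\<forall>x\<in>carrier (V a). \<forall>y\<in>carrier (V a).
          f (v(a := x \<oplus>\<^bsub>V a\<^esub> y)) = f (v(a := x)) \<oplus>\<^bsub>V 0\<^esub> f (v(a := y))) \<and>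
       (\<forall>r\<in>carrier R. \<forall>x\<in>carrier (V a).
          f (v(a := r \<odot>\<^bsub>V a\<^esub> x)) = r \<odot>\<^bsub>V 0\<^esub> f (v(a := x)))}"

definition multilinear_module ::
    "('r, 'm) ring_scheme \<Rightarrow> nat \<Rightarrow> (nat \<Rightarrow> ('r, 'v) module)
     \<Rightarrow> ('r, (nat \<Rightarrow> 'v) \<Rightarrow> 'v) module" where
  "multilinear_module R n V =
     \<lparr>carrier = multilinear_maps R n V,
      monoid.mult = undefined, monoid.one = undefined,
      ring.zero = (\<lambda>v\<in>arg_tuples n V. \<zero>\<^bsub>V 0\<^esub>),
      ring.add = (\<lambda>f g. \<lambda>v\<in>arg_tuples n V. f v \<oplus>\<^bsub>V 0\<^esub> g v),
      smult = (\<lambda>r f. \<lambda>v\<in>arg_tuples n V. r \<odot>\<^bsub>V 0\<^esub> f v)\<rparr>"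

text \<open>The map \<open>br\<close> is \<open>t \<mapsto> \<langle>t|\<close>. That all modules of the frame live in one type \<open>'v\<close> is no
  restriction, as they may be embedded in a sum type.\<close>

definition tensor_space ::
    "('k, 'm) ring_scheme \<Rightarrow> nat \<Rightarrow> (nat \<Rightarrow> ('k, 'v) module) \<Rightarrow> ('k, 't) module
     \<Rightarrow> ('t \<Rightarrow> (nat \<Rightarrow> 'v) \<Rightarrow> 'v) \<Rightarrow> bool" where
  "tensor_space K n V T br \<longleftrightarrow>
     (\<forall>a\<in>{0..n}. module K (V a)) \<and> module K T \<and>
     br \<in> linear_maps K T (multilinear_module K n V) \<and> inj_on br (carrier T)"

definition full ::
    "('k, 'm) ring_scheme \<Rightarrow> nat \<Rightarrow> (nat \<Rightarrow> ('k, 'v) module)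
     \<Rightarrow> ('t \<Rightarrow> (nat \<Rightarrow> 'v) \<Rightarrow> 'v) \<Rightarrow> 't set \<Rightarrow> bool" where
  "full K n V br S \<longleftrightarrow>
     submodule_span K (V 0) {br t v | t v. t \<in> S \<and> v \<in> arg_tuples n V} = carrier (V 0)"

definition nondegenerate_in_axis ::
    "('k, 'm) ring_scheme \<Rightarrow> nat \<Rightarrow> (nat \<Rightarrow> ('k, 'v) module)
     \<Rightarrow> ('t \<Rightarrow> (nat \<Rightarrow> 'v) \<Rightarrow> 'v) \<Rightarrow> 't set \<Rightarrow> nat \<Rightarrow> bool" where
  "nondegenerate_in_axis K n V br S a \<longleftrightarrow>
     (if a = 0 then full K n V br S
      else \<forall>x\<in>carrier (V a) - {\<zero>\<^bsub>V a\<^esub>}.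
             \<exists>v\<in>arg_tuples n V. v a = x \<and> (\<exists>t\<in>S. br t v \<noteq> \<zero>\<^bsub>V 0\<^esub>))"

definition multilinear_extension ::
    "('k, 'm) ring_scheme \<Rightarrow> ('k, 'l) module \<Rightarrow> nat \<Rightarrow> (nat \<Rightarrow> ('k, 'v) module)
     \<Rightarrow> ((nat \<Rightarrow> 'v) \<Rightarrow> 'v) \<Rightarrow> (nat \<Rightarrow> ('v \<Rightarrow> 'l) set) \<Rightarrow> ('v \<Rightarrow> 'l) set" where
  "multilinear_extension K L n V f =
     (THE g. g \<in> multilinear_maps L n (\<lambda>a. base_change K L (V a)) \<and>
        (\<forall>v\<in>arg_tuples n V.
           g (\<lambda>a\<in>{1..n}. one_tensor K L (V a) (v a)) = one_tensor K L (V 0) (f v)))"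


section \<open>Polynomials\<close>

text \<open>The polynomial ring \<open>K[x\<^sub>a : a \<in> I]\<close> on the indexed polynomials of the library (which
  provides no multiplication): a monomial \<open>X\<^sup>e\<close> is the multiset in which \<open>a\<close> occurs \<open>e(a)\<close>
  times, and a polynomial maps monomials to coefficients.\<close>

definition indexed_poly_ring :: "('k, 'm) ring_scheme \<Rightarrow> nat set \<Rightarrow> (nat multiset \<Rightarrow> 'k) ring" where
  "indexed_poly_ring K I =
     \<lparr>carrier = ring.indexed_pset K I (carrier K),
      monoid.mult = (\<lambda>p q e. \<Oplus>\<^bsub>K\<^esub>d\<in>{d. d \<subseteq># e}. p d \<otimes>\<^bsub>K\<^esub> q (e - d)),
      monoid.one = ring.indexed_const K \<one>\<^bsub>K\<^esub>,
      ring.zero = ring.indexed_const K \<zero>\<^bsub>K\<^esub>,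
      ring.add = ring.indexed_padd K\<rparr>"

definition linear_homogeneous :: "('k, 'm) ring_scheme \<Rightarrow> (nat multiset \<Rightarrow> 'k) \<Rightarrow> bool" where
  "linear_homogeneous K p \<longleftrightarrow> (\<forall>e. p e \<noteq> \<zero>\<^bsub>K\<^esub> \<longrightarrow> (\<exists>a. e = {#a#}))"

definition poly_support ::
    "('k, 'm) ring_scheme \<Rightarrow> nat \<Rightarrow> (nat multiset \<Rightarrow> 'k) set \<Rightarrow> nat set" where
  "poly_support K n P =
     {a \<in> {0..n}. Idl\<^bsub>K\<^esub> {p {#a#} | p. p \<in> P \<and> linear_homogeneous K p} = carrier K}"


section \<open>Operator zero sets\<close>

definition operator_tuples ::
    "('k, 'm) ring_scheme \<Rightarrow> ('k, 'l) module \<Rightarrow> (nat \<Rightarrow> ('k, 'v) module) \<Rightarrow> nat set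
     \<Rightarrow> (nat \<Rightarrow> ('v \<Rightarrow> 'l) set \<Rightarrow> ('v \<Rightarrow> 'l) set) set" where
  "operator_tuples K L V A = (\<Pi>\<^sub>E a\<in>A. module_endos L (base_change K L (V a)))"

text \<open>\<open>\<langle>t\<^sub>L|p(\<omega>)|w\<rangle>\<close> for \<open>f = \<langle>t|\<close>. It is used only for \<open>p \<in> K[X\<^sub>A]\<close>, where exponents
  outside \<open>A\<close> are \<open>0\<close> and the zeroth power of \<open>\<omega> a\<close> is the identity, whatever \<open>\<omega> a\<close> is.\<close>

definition tensor_eval ::
    "('k, 'm) ring_scheme \<Rightarrow> ('k, 'l) module \<Rightarrow> nat \<Rightarrow> (nat \<Rightarrow> ('k, 'v) module)
     \<Rightarrow> ((nat \<Rightarrow> 'v) \<Rightarrow> 'v) \<Rightarrow> (nat multiset \<Rightarrow> 'k)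
     \<Rightarrow> (nat \<Rightarrow> ('v \<Rightarrow> 'l) set \<Rightarrow> ('v \<Rightarrow> 'l) set) \<Rightarrow> (nat \<Rightarrow> ('v \<Rightarrow> 'l) set)
     \<Rightarrow> ('v \<Rightarrow> 'l) set" where
  "tensor_eval K L n V f p \<omega> w =
     (\<Oplus>\<^bsub>base_change K L (V 0)\<^esub>e\<in>{e. p e \<noteq> \<zero>\<^bsub>K\<^esub>}.
        (p e \<odot>\<^bsub>L\<^esub> \<one>\<^bsub>L\<^esub>) \<odot>\<^bsub>base_change K L (V 0)\<^esub>
          (\<omega> 0 ^^ count e 0)
            (multilinear_extension K L n V f (\<lambda>a\<in>{1..n}. (\<omega> a ^^ count e a) (w a))))"

definition operator_zeros ::
    "('k, 'm) ring_scheme \<Rightarrow> ('k, 'l) module \<Rightarrow> nat \<Rightarrow> (nat \<Rightarrow> ('k, 'v) module)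
     \<Rightarrow> ('t \<Rightarrow> (nat \<Rightarrow> 'v) \<Rightarrow> 'v) \<Rightarrow> 't set \<Rightarrow> (nat multiset \<Rightarrow> 'k) set \<Rightarrow> nat set
     \<Rightarrow> (nat \<Rightarrow> ('v \<Rightarrow> 'l) set \<Rightarrow> ('v \<Rightarrow> 'l) set) set" where
  "operator_zeros K L n V br S P A =
     {\<omega> \<in> operator_tuples K L V A.
        \<forall>t\<in>S. \<forall>p\<in>P \<inter> carrier (indexed_poly_ring K A). \<forall>w\<in>arg_tuples n (\<lambda>a. base_change K L (V a)).
          tensor_eval K L n V (br t) p \<omega> w = \<zero>\<^bsub>base_change K L (V 0)\<^esub>}"


section \<open>Products\<close>

definition axis_product ::
    "('r, 'v, 'n) module_scheme \<Rightarrow> 'r \<Rightarrow> 'r \<Rightarrow> ('v \<Rightarrow> 'v) \<Rightarrow> ('v \<Rightarrow> 'v) \<Rightarrow> 'v \<Rightarrow> 'v" where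
  "axis_product M l r x y =
     (\<lambda>v\<in>carrier M. l \<odot>\<^bsub>M\<^esub> x (y v) \<oplus>\<^bsub>M\<^esub> r \<odot>\<^bsub>M\<^esub> y (x v))"

definition bullet ::
    "('k, 'm) ring_scheme \<Rightarrow> ('k, 'l) module \<Rightarrow> (nat \<Rightarrow> ('k, 'v) module) \<Rightarrow> nat set
     \<Rightarrow> (nat \<Rightarrow> 'k) \<Rightarrow> (nat \<Rightarrow> 'k)
     \<Rightarrow> (nat \<Rightarrow> ('v \<Rightarrow> 'l) set \<Rightarrow> ('v \<Rightarrow> 'l) set)
     \<Rightarrow> (nat \<Rightarrow> ('v \<Rightarrow> 'l) set \<Rightarrow> ('v \<Rightarrow> 'l) set)
     \<Rightarrow> (nat \<Rightarrow> ('v \<Rightarrow> 'l) set \<Rightarrow> ('v \<Rightarrow> 'l) set)" where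
  "bullet K L V A lam rho \<omega> \<tau> =
     (\<lambda>a\<in>A. axis_product (base_change K L (V a))
              (lam a \<odot>\<^bsub>L\<^esub> \<one>\<^bsub>L\<^esub>) (rho a \<odot>\<^bsub>L\<^esub> \<one>\<^bsub>L\<^esub>) (\<omega> a) (\<tau> a))"

text \<open>HOL cannot quantify over all types inside a formula, so \<open>L\<close> ranges over the commutative
  \<open>K\<close>-algebras carried by subsets of a given type \<open>'l\<close>.\<close>

definition closed_under_bullet ::
    "'l itself \<Rightarrow> ('k, 'm) ring_scheme \<Rightarrow> nat \<Rightarrow> (nat \<Rightarrow> ('k, 'v) module)
     \<Rightarrow> ('t \<Rightarrow> (nat \<Rightarrow> 'v) \<Rightarrow> 'v) \<Rightarrow> 't set \<Rightarrow> (nat multiset \<Rightarrow> 'k) set \<Rightarrow> nat set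
     \<Rightarrow> (nat \<Rightarrow> 'k) \<Rightarrow> (nat \<Rightarrow> 'k) \<Rightarrow> bool" where
  "closed_under_bullet TYPE('l) K n V br S P A lam rho \<longleftrightarrow>
     (\<forall>L :: ('k, 'l) module. algebra K L \<longrightarrow>
        (\<forall>\<omega>\<in>operator_zeros K L n V br S P A. \<forall>\<tau>\<in>operator_zeros K L n V br S P A.
           bullet K L V A lam rho \<omega> \<tau> \<in> operator_zeros K L n V br S P A))"

text \<open>The type \<open>'l\<close> is large enough if it has at least \<open>max |K| \<aleph>\<^sub>0\<close> elements, the number of
  lists over \<open>K\<close>: every finitely generated commutative \<open>K\<close>-algebra then has an isomorphic copy
  in \<open>'l\<close>. For finitely generated projective modules, closure over these algebras implies
  closure over all commutative \<open>K\<close>-algebras, because two given operator tuples over \<open>L\<close> are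
  defined over a finitely generated subalgebra \<open>L'\<close>, and \<open>L' \<otimes> V \<rightarrow> L \<otimes> V\<close> is injective.\<close>

definition large_type :: "'l itself \<Rightarrow> ('k, 'm) ring_scheme \<Rightarrow> bool" where
  "large_type TYPE('l) K \<longleftrightarrow> (\<exists>f :: 'k list \<Rightarrow> 'l. inj_on f (lists (carrier K)))"

definition unital_axis ::
    "('k, 'm) ring_scheme \<Rightarrow> ('k, 'v) module \<Rightarrow> 'k \<Rightarrow> 'k \<Rightarrow> bool" where
  "unital_axis K M l r \<longleftrightarrow>
     (\<exists>u\<in>module_endos K M. \<forall>x\<in>module_endos K M.
        axis_product M l r u x = x \<and> axis_product M l r x u = x)"

definition lie_axis :: "('k, 'm) ring_scheme \<Rightarrow> 'k \<Rightarrow> 'k \<Rightarrow> bool" where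
  "lie_axis K l r \<longleftrightarrow> l \<oplus>\<^bsub>K\<^esub> r = \<zero>\<^bsub>K\<^esub>"

end

theory Submission
  imports Defs
begin

text \<open>Only scalar operators and quotient algebras \<open>L = K / I\<close> are needed. Let \<open>F\<close> be the set of all
  coordinates of the values \<open>\<langle>t|v\<rangle>\<close> with respect to an embedding of \<open>V\<^sub>0\<close> into a free module, \<open>C\<close>
  the matrix of the coefficients of \<open>p\<^sub>1, \<dots>, p\<^sub>r\<close>, and \<open>d\<^sub>a = \<lambda>\<^sub>a + \<rho>\<^sub>a\<close>. A scalar tuple \<open>u\<close> lies in
  the zero set over \<open>K / I\<close> iff \<open>(C u) F \<subseteq> I\<close>, so closure under the product says that
  \<open>(C u) F \<subseteq> I\<close> and \<open>(C v) F \<subseteq> I\<close> imply \<open>(C (d u v)) F \<subseteq> I\<close>, with the entrywise product \<open>d u v\<close>.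
  If the \<open>a\<close>-axis product is unital, or if \<open>K\<close> is a field and the product is not Lie, then \<open>d\<^sub>a F\<close>
  generates an ideal containing \<open>F\<close>.

  As \<open>F\<close> contains a nonzero element (the only use of fullness or nondegeneracy), Zorn's lemma yields
  an ideal \<open>q\<close> maximal among those that contain no finite set \<open>W\<close> with \<open>F \<subseteq> (W F)\<close>. It is prime, it
  contains none of the \<open>d\<^sub>a\<close> just described, and closure now says that modulo \<open>q\<close> the kernel of
  \<open>C\<close> is mapped into itself by \<open>(u, v) \<mapsto> d u v\<close>. Over the domain \<open>K / q\<close> choose a maximal set \<open>J\<close> of
  independent columns of \<open>C\<close>, so that \<open>|J| \<le> r\<close>. For each \<open>j \<notin> J\<close> there is a kernel vector \<open>u\<^sub>j\<close>
  supported on \<open>J \<union> {j}\<close>; applying closure to pairs of these vectors shows that the \<open>j \<notin> J\<close> with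
  \<open>d\<^sub>j \<noteq> 0\<close> inject into \<open>J\<close>. Hence at most \<open>2 r\<close> of the \<open>d\<^sub>a\<close> are nonzero modulo \<open>q\<close>.\<close>

section \<open>Independent columns over a domain\<close>

text \<open>The prime \<open>q\<close> is not itself used as the ideal \<open>I\<close>: if
  \<open>F \<subseteq> q\<close>, every scalar tuple is a zero over \<open>K / q\<close>, and
  closure over that algebra says nothing. Instead, for \<open>u\<close> and \<open>v\<close> with
  the entries of \<open>C u\<close> and \<open>C v\<close> in \<open>q\<close>, closure is applied
  over \<open>K / (N F)\<close>, where \<open>N\<close> is a finite subset of \<open>q\<close> that
  contains these entries. It gives \<open>g F \<subseteq> (N F)\<close> for every entry
  \<open>g\<close> of \<open>C (d u v)\<close>. If \<open>g\<close> lay outside \<open>q\<close>,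
  maximality would supply a finite \<open>W \<subseteq> q\<close> with
  \<open>F \<subseteq> ((W, g) F)\<close>; once \<open>N\<close> also contains \<open>W\<close>,
  this becomes \<open>F \<subseteq> (N F)\<close>, which \<open>q\<close> excludes. So the condition
  that defines \<open>q\<close> is designed for hypotheses that see a residual \<open>C u\<close>
  only through its products with \<open>F\<close>.\<close>

lemma (in ring) finsum_zeroI:
  "(\<And>a. a \<in> A \<Longrightarrow> f a = \<zero>) \<Longrightarrow> finsum R f A = \<zero>"
  by (rule add.finprod_one_eqI)

text \<open>Gaussian elimination without division, by induction on the rows: a pivot in a domain
  need not be invertible, so rows are cross-multiplied with it. This bounds the size of an
  independent set of columns.\<close>

lemma (in domain) more_columns_than_rows_dependent:
  assumes "finite Rs" "finite I" "card Rs < card I"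
    and "\<And>i a. i \<in> Rs \<Longrightarrow> a \<in> I \<Longrightarrow> C i a \<in> carrier R"
  shows "\<exists>x. x \<in> I \<rightarrow> carrier R \<and> (\<exists>a\<in>I. x a \<noteq> \<zero>) \<and> (\<forall>i\<in>Rs. (\<Oplus>a\<in>I. C i a \<otimes> x a) = \<zero>)"
  using assms
proof (induction Rs arbitrary: I C rule: finite_induct)
  case empty
  then obtain a where "a \<in> I" by fastforce
  then show ?case
    by (intro exI[of _ "\<lambda>_. \<one>"]) auto
next
  case (insert k Rs)
  have kC: "C k a \<in> carrier R" if "a \<in> I" for a using insert.prems(3) that by auto
  show ?case
  proof (cases "\<forall>a\<in>I. C k a = \<zero>")
    case True
    have "card Rs < card I" using insert by simp
    from insert.IH[OF insert.prems(1) this, of C] insert.prems(3)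
    obtain x where x: "x \<in> I \<rightarrow> carrier R" "\<exists>a\<in>I. x a \<noteq> \<zero>"
      "\<forall>i\<in>Rs. (\<Oplus>a\<in>I. C i a \<otimes> x a) = \<zero>" by auto
    have "(\<Oplus>a\<in>I. C k a \<otimes> x a) = \<zero>"
      by (rule finsum_zeroI) (use True x(1) in \<open>auto simp: Pi_def\<close>)
    with x show ?thesis by blast
  next
    case False
    then obtain b where b: "b \<in> I" "C k b \<noteq> \<zero>" by blast
    define J where "J = I - {b}"
    have J: "I = insert b J" "finite J" "b \<notin> J" "J \<subseteq> I" using b insert.prems(1) by (auto simp: J_def)
    have "card Rs < card J" using insert J by simp
    \<comment> \<open>The 2-by-2 minors through the pivot \<open>C k b\<close>. They make row
      \<open>k\<close> and column \<open>b\<close> vanish, so the reduced system has one row and one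
      column less.\<close>
    define C' where "C' = (\<lambda>i a. C k b \<otimes> C i a \<ominus> C k a \<otimes> C i b)"
    have car: "C i a \<in> carrier R" if "i \<in> insert k Rs" "a \<in> I" for i a using insert.prems(3) that by auto
    from insert.IH[OF J(2) \<open>card Rs < card J\<close>, of C'] car b J
    obtain x where x: "x \<in> J \<rightarrow> carrier R" "\<exists>a\<in>J. x a \<noteq> \<zero>"
      "\<forall>i\<in>Rs. (\<Oplus>a\<in>J. C' i a \<otimes> x a) = \<zero>" unfolding C'_def by auto
    define t where "t = (\<Oplus>a\<in>J. C k a \<otimes> x a)"
    \<comment> \<open>Row \<open>k\<close> would force the entry \<open>- t / C k b\<close> at
      \<open>b\<close>. Scaling the whole vector by the pivot clears the denominator, and in a
      domain it keeps nonzero entries nonzero.\<close>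
    define x' where "x' = (\<lambda>a. if a = b then \<ominus> t else C k b \<otimes> x a)"
    have xc: "x a \<in> carrier R" if "a \<in> J" for a using x(1) that by auto
    have tc: "t \<in> carrier R" unfolding t_def using xc kC J by (intro finsum_closed) auto
    have x'c: "x' \<in> I \<rightarrow> carrier R"
      unfolding x'_def J(1) using tc xc kC b J(1) by auto
    have nz: "\<exists>a\<in>I. x' a \<noteq> \<zero>"
    proof -
      obtain a where a: "a \<in> J" "x a \<noteq> \<zero>" using x(2) by blast
      then have "C k b \<otimes> x a \<noteq> \<zero>" using b kC xc by (simp add: integral_iff)
      moreover have "a \<noteq> b" using a J by auto
      ultimately show ?thesis using a J by (intro bexI[of _ a]) (auto simp: x'_def)
    qed
    have sum: "(\<Oplus>a\<in>I. C i a \<otimes> x' a) = (\<Oplus>a\<in>J. C' i a \<otimes> x a)" if i: "i \<in> insert k Rs" for i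
    proof -
      have c: "C i a \<in> carrier R" if "a \<in> I" for a using car i that by blast
      have "(\<Oplus>a\<in>I. C i a \<otimes> x' a) = C i b \<otimes> x' b \<oplus> (\<Oplus>a\<in>J. C i a \<otimes> x' a)"
        unfolding J(1) by (rule finsum_insert) (use J x'c c in auto)
      also have "(\<Oplus>a\<in>J. C i a \<otimes> x' a) = (\<Oplus>a\<in>J. C i a \<otimes> (C k b \<otimes> x a))"
        by (rule finsum_cong') (use J c kC xc in \<open>auto simp: x'_def b\<close>)
      also have "C i b \<otimes> x' b = (\<Oplus>a\<in>J. \<ominus> (C i b \<otimes> (C k a \<otimes> x a)))"
      proof -
        have "C i b \<otimes> x' b = (\<ominus> C i b) \<otimes> t"
          using c tc b by (simp add: x'_def l_minus r_minus)
        also have "\<dots> = (\<Oplus>a\<in>J. (\<ominus> C i b) \<otimes> (C k a \<otimes> x a))"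
          unfolding t_def using c b J kC xc by (intro finsum_rdistr) auto
        also have "\<dots> = (\<Oplus>a\<in>J. \<ominus> (C i b \<otimes> (C k a \<otimes> x a)))"
          using c b J kC xc by (intro finsum_cong') (auto simp: l_minus)
        finally show ?thesis .
      qed
      also have "(\<Oplus>a\<in>J. \<ominus> (C i b \<otimes> (C k a \<otimes> x a))) \<oplus> (\<Oplus>a\<in>J. C i a \<otimes> (C k b \<otimes> x a))
          = (\<Oplus>a\<in>J. \<ominus> (C i b \<otimes> (C k a \<otimes> x a)) \<oplus> C i a \<otimes> (C k b \<otimes> x a))"
        by (rule finsum_addf[symmetric]) (use J c kC xc b in auto)
      also have "\<dots> = (\<Oplus>a\<in>J. C' i a \<otimes> x a)"
      proof (rule finsum_cong')
        fix a assume a: "a \<in> J"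
        then have "a \<in> I" using J by auto
        show "\<ominus> (C i b \<otimes> (C k a \<otimes> x a)) \<oplus> C i a \<otimes> (C k b \<otimes> x a) = C' i a \<otimes> x a"
          unfolding C'_def using c[OF b(1)] c[OF \<open>a \<in> I\<close>] kC[OF b(1)] kC[OF \<open>a \<in> I\<close>] xc[OF a]
          by algebra
      qed (use J c kC xc b in \<open>auto simp: C'_def\<close>)
      finally show ?thesis .
    qed
    have "(\<Oplus>a\<in>J. C' k a \<otimes> x a) = \<zero>"
    proof (rule finsum_zeroI)
      fix a assume a: "a \<in> J"
      then have "a \<in> I" using J by auto
      then show "C' k a \<otimes> x a = \<zero>"
        unfolding C'_def using b kC[of a] kC[of b] xc[OF a] by algebra
    qed
    with sum x(3) have "\<forall>i\<in>insert k Rs. (\<Oplus>a\<in>I. C i a \<otimes> x' a) = \<zero>" by auto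
    with x'c nz show ?thesis by blast
  qed
qed

text \<open>The set \<open>I\<close> in the proof is the \<open>J\<close> of the overview.
  Everything rests on one observation: a combination of kernel vectors and of their weighted
  products is again a kernel vector, so it is zero as soon as it is supported on
  \<open>I\<close>.\<close>

lemma (in domain) weighted_square_columns_bound:
  assumes fin: "finite Rs" "finite A"
    and C: "\<And>i a. i \<in> Rs \<Longrightarrow> a \<in> A \<Longrightarrow> C i a \<in> carrier R"
    and d: "\<And>a. a \<in> A \<Longrightarrow> d a \<in> carrier R"
    and col: "\<And>a. a \<in> A \<Longrightarrow> \<exists>i\<in>Rs. C i a \<noteq> \<zero>"
    and closed: "\<And>u v i. \<lbrakk>u \<in> A \<rightarrow> carrier R; v \<in> A \<rightarrow> carrier R;
      \<forall>i\<in>Rs. (\<Oplus>a\<in>A. C i a \<otimes> u a) = \<zero>; \<forall>i\<in>Rs. (\<Oplus>a\<in>A. C i a \<otimes> v a) = \<zero>; i \<in> Rs\<rbrakk>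
      \<Longrightarrow> (\<Oplus>a\<in>A. C i a \<otimes> (d a \<otimes> u a \<otimes> v a)) = \<zero>"
  shows "card {a \<in> A. d a \<noteq> \<zero>} \<le> 2 * card Rs"
proof -
  define sol where "sol = (\<lambda>u. u \<in> A \<rightarrow> carrier R \<and> (\<forall>i\<in>Rs. (\<Oplus>a\<in>A. C i a \<otimes> u a) = \<zero>))"
  \<comment> \<open>Linear independence of the columns in \<open>I\<close>, phrased through kernel
    vectors on all of \<open>A\<close>, so that it applies directly to weighted products of such
    vectors.\<close>
  define indep where "indep = (\<lambda>I. I \<subseteq> A \<and>
    (\<forall>u. sol u \<longrightarrow> (\<forall>a\<in>A - I. u a = \<zero>) \<longrightarrow> (\<forall>a\<in>A. u a = \<zero>)))"
  have "indep {}" by (auto simp: indep_def)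
  have "finite {I. indep I}"
    by (rule finite_subset[of _ "Pow A"]) (use fin in \<open>auto simp: indep_def\<close>)
  then obtain I where I: "indep I" and max: "\<And>J. indep J \<Longrightarrow> I \<subseteq> J \<Longrightarrow> I = J"
    using finite_has_maximal[of "{I. indep I}"] \<open>indep {}\<close> by (metis empty_iff mem_Collect_eq)
  have IA: "I \<subseteq> A" and finI: "finite I" using I fin by (auto simp: indep_def intro: finite_subset)
  have extend: "(\<Oplus>a\<in>A. C i a \<otimes> u a) = (\<Oplus>a\<in>J. C i a \<otimes> u a)"
    if "i \<in> Rs" "J \<subseteq> A" "u \<in> A \<rightarrow> carrier R" "\<And>a. a \<in> A - J \<Longrightarrow> u a = \<zero>" for i J u
    by (rule add.finprod_mono_neutral_cong_right) (use that fin C in auto)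
  have "card I \<le> card Rs"
  proof (rule ccontr)
    assume "\<not> card I \<le> card Rs"
    then have "card Rs < card I" by simp
    moreover have "C i a \<in> carrier R" if "i \<in> Rs" "a \<in> I" for i a using C IA that by blast
    ultimately obtain x where x: "x \<in> I \<rightarrow> carrier R" "\<exists>a\<in>I. x a \<noteq> \<zero>"
      "\<forall>i\<in>Rs. (\<Oplus>a\<in>I. C i a \<otimes> x a) = \<zero>"
      using more_columns_than_rows_dependent[OF fin(1) finI, of C] by blast
    define u where "u = (\<lambda>a. if a \<in> I then x a else \<zero>)"
    have "u \<in> A \<rightarrow> carrier R" using x by (auto simp: u_def)
    moreover have "(\<Oplus>a\<in>I. C i a \<otimes> u a) = (\<Oplus>a\<in>I. C i a \<otimes> x a)" if "i \<in> Rs" for i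
      by (rule finsum_cong') (use that x(1) C IA in \<open>auto simp: u_def Pi_iff subset_iff\<close>)
    ultimately have "sol u"
      unfolding sol_def using x extend[OF _ IA, of _ u] by (auto simp: u_def)
    with I x(2) IA show False unfolding indep_def u_def by fastforce
  qed
  \<comment> \<open>By maximality, adding column \<open>j\<close> creates a relation; it must
    involve \<open>j\<close>, since the columns in \<open>I\<close> admit none.\<close>
  have ex: "\<exists>u. sol u \<and> (\<forall>a\<in>A - insert j I. u a = \<zero>) \<and> u j \<noteq> \<zero>" if j: "j \<in> A - I" for j
  proof -
    have "\<not> indep (insert j I)" using max[of "insert j I"] j by auto
    then obtain u where u: "sol u" "\<forall>a\<in>A - insert j I. u a = \<zero>" "\<exists>a\<in>A. u a \<noteq> \<zero>"
      using j IA by (auto simp: indep_def)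
    have "u j \<noteq> \<zero>"
    proof
      assume "u j = \<zero>"
      with u have "\<forall>a\<in>A - I. u a = \<zero>" by auto
      with I u show False by (auto simp: indep_def)
    qed
    with u show ?thesis by blast
  qed
  define U where "U = (\<lambda>j. SOME u. sol u \<and> (\<forall>a\<in>A - insert j I. u a = \<zero>) \<and> u j \<noteq> \<zero>)"
  have U: "sol (U j)" "\<And>a. a \<in> A \<Longrightarrow> a \<notin> insert j I \<Longrightarrow> U j a = \<zero>" "U j j \<noteq> \<zero>"
    if "j \<in> A - I" for j
    using someI_ex[OF ex[OF that]] unfolding U_def by auto
  have Uc: "U j a \<in> carrier R" if "j \<in> A - I" "a \<in> A" for j a
    using U(1)[OF that(1)] that(2) by (auto simp: sol_def)
  have prod: "(\<Oplus>a\<in>A. C i a \<otimes> (d a \<otimes> U j a \<otimes> U l a)) = \<zero>"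
    if "j \<in> A - I" "l \<in> A - I" "i \<in> Rs" for i j l
    using closed[of "U j" "U l" i] U(1)[OF that(1)] U(1)[OF that(2)] that(3) by (auto simp: sol_def)
  \<comment> \<open>Outside \<open>I\<close> the vector \<open>U j\<close> is nonzero only at
    \<open>j\<close> and \<open>U l\<close> only at \<open>l\<close>, so their product is supported
    on \<open>I\<close>.\<close>
  have distinct: "d a \<otimes> U j a \<otimes> U l a = \<zero>" if jl: "j \<in> A - I" "l \<in> A - I" "j \<noteq> l" and a: "a \<in> A" for j l a
  proof -
    let ?x = "\<lambda>a. d a \<otimes> U j a \<otimes> U l a"
    have "sol ?x" unfolding sol_def using prod[OF jl(1,2)] Uc[OF jl(1)] Uc[OF jl(2)] d by auto
    moreover have "?x b = \<zero>" if "b \<in> A - I" for b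
    proof (cases "b = j")
      case True
      then show ?thesis using U(2)[OF jl(2), of b] jl that d Uc by auto
    next
      case False
      then show ?thesis using U(2)[OF jl(1), of b] jl that d Uc by auto
    qed
    ultimately show ?thesis using I a by (auto simp: indep_def)
  qed
  \<comment> \<open>The kernel vector \<open>d (U j)^2 - (d j U j j) U j\<close>, where the constant
    is chosen to cancel the entry at \<open>j\<close>. Its vanishing says that
    \<open>d a \<otimes> U j a\<close> has the same value \<open>d j \<otimes> U j j\<close>
    wherever \<open>U j\<close> is nonzero.\<close>
  have same: "U j a \<otimes> (d a \<otimes> U j a \<ominus> d j \<otimes> U j j) = \<zero>" if j: "j \<in> A - I" and a: "a \<in> A" for j a
  proof -
    let ?x = "\<lambda>a. U j a \<otimes> (d a \<otimes> U j a \<ominus> d j \<otimes> U j j)"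
    let ?k = "\<ominus> (d j \<otimes> U j j)"
    have kc: "?k \<in> carrier R" using d j Uc[OF j] by auto
    have "(\<Oplus>a\<in>A. C i a \<otimes> ?x a) = \<zero>" if i: "i \<in> Rs" for i
    proof -
      have "(\<Oplus>a\<in>A. C i a \<otimes> ?x a) =
          (\<Oplus>a\<in>A. C i a \<otimes> (d a \<otimes> U j a \<otimes> U j a) \<oplus> ?k \<otimes> (C i a \<otimes> U j a))"
      proof (rule finsum_cong')
        fix b assume b: "b \<in> A"
        have "d j \<in> carrier R" "U j j \<in> carrier R" using j d Uc by auto
        then show "C i b \<otimes> ?x b = C i b \<otimes> (d b \<otimes> U j b \<otimes> U j b) \<oplus> ?k \<otimes> (C i b \<otimes> U j b)"
          using C[OF i b] d[OF b] Uc[OF j b] by algebra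
      qed (use C i d Uc[OF j] kc in auto)
      also have "\<dots> = (\<Oplus>a\<in>A. C i a \<otimes> (d a \<otimes> U j a \<otimes> U j a)) \<oplus> (\<Oplus>a\<in>A. ?k \<otimes> (C i a \<otimes> U j a))"
        by (rule finsum_addf) (use C i d Uc[OF j] kc in auto)
      also have "(\<Oplus>a\<in>A. ?k \<otimes> (C i a \<otimes> U j a)) = ?k \<otimes> (\<Oplus>a\<in>A. C i a \<otimes> U j a)"
        by (rule finsum_rdistr[symmetric]) (use fin C i Uc[OF j] kc in auto)
      also have "(\<Oplus>a\<in>A. C i a \<otimes> U j a) = \<zero>" using U(1)[OF j] i by (auto simp: sol_def)
      finally show ?thesis using prod[OF j j i] kc by auto
    qed
    then have "sol ?x" unfolding sol_def using d Uc[OF j] j by auto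
    moreover have "?x b = \<zero>" if "b \<in> A - I" for b
    proof (cases "b = j")
      case True
      then show ?thesis using j d Uc[OF j, of j] by (simp add: r_neg a_minus_def)
    next
      case False
      then show ?thesis using U(2)[OF j, of b] that d j Uc[OF j, of j] by auto
    qed
    ultimately show ?thesis using I a by (auto simp: indep_def)
  qed
  define B where "B = {a \<in> A. d a \<noteq> \<zero>}"
  \<comment> \<open>Column \<open>j\<close> is nonzero, so the relation \<open>U j\<close> involves
    some further column \<open>i \<in> I\<close>. There
    \<open>d i \<otimes> U j i = d j \<otimes> U j j\<close> is nonzero, which forces
    \<open>d i\<close> to be nonzero.\<close>
  have exi: "\<exists>i. i \<in> I \<and> U j i \<noteq> \<zero> \<and> d i \<noteq> \<zero>" if "j \<in> B - I" for j
  proof -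
    have j: "j \<in> A - I" "d j \<noteq> \<zero>" using that by (auto simp: B_def)
    have "\<exists>i\<in>I. U j i \<noteq> \<zero>"
    proof (rule ccontr)
      assume non: "\<not> (\<exists>i\<in>I. U j i \<noteq> \<zero>)"
      obtain k where k: "k \<in> Rs" "C k j \<noteq> \<zero>" using col j by blast
      have "(\<Oplus>a\<in>A. C k a \<otimes> U j a) = (\<Oplus>a\<in>{j}. C k a \<otimes> U j a)"
        by (rule extend) (use k j Uc U(2)[OF j(1)] non in auto)
      also have "\<dots> = C k j \<otimes> U j j" using C k j Uc by simp
      finally have "C k j \<otimes> U j j = \<zero>" using U(1)[OF j(1)] k by (simp add: sol_def)
      then show False using k j U(3)[OF j(1)] C Uc by (simp add: integral_iff)
    qed
    then obtain i where i: "i \<in> I" "U j i \<noteq> \<zero>" by blast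
    have c: "d i \<in> carrier R" "U j i \<in> carrier R" "d j \<in> carrier R" "U j j \<in> carrier R"
      using i IA j d Uc by auto
    have "d i \<otimes> U j i \<ominus> d j \<otimes> U j j = \<zero>"
      using same[OF j(1), of i] i IA c by (auto simp: integral_iff)
    then have "d i \<otimes> U j i = d j \<otimes> U j j" using c by (simp add: r_right_minus_eq)
    also have "\<dots> \<noteq> \<zero>" using c j U(3)[OF j(1)] by (simp add: integral_iff)
    finally have "d i \<noteq> \<zero>" using c by auto
    with i show ?thesis by blast
  qed
  define \<phi> where "\<phi> = (\<lambda>j. SOME i. i \<in> I \<and> U j i \<noteq> \<zero> \<and> d i \<noteq> \<zero>)"
  have \<phi>: "\<phi> j \<in> I" "U j (\<phi> j) \<noteq> \<zero>" "d (\<phi> j) \<noteq> \<zero>" if "j \<in> B - I" for j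
    using someI_ex[OF exi[OF that]] unfolding \<phi>_def by auto
  \<comment> \<open>At a common value of \<open>\<phi>\<close> all three factors of the vanishing
    product \<open>d \<otimes> U j \<otimes> U l\<close> would be nonzero.\<close>
  have "inj_on \<phi> (B - I)"
  proof (rule inj_onI, rule ccontr)
    fix j l assume jl: "j \<in> B - I" "l \<in> B - I" "\<phi> j = \<phi> l" "j \<noteq> l"
    have jl': "j \<in> A - I" "l \<in> A - I" "\<phi> j \<in> A" using jl \<phi>(1)[OF jl(1)] IA by (auto simp: B_def)
    have "d (\<phi> j) \<otimes> U j (\<phi> j) \<otimes> U l (\<phi> j) = \<zero>" by (rule distinct) (use jl jl' in auto)
    then show False
      using \<phi>[OF jl(1)] \<phi>[OF jl(2)] jl(3) d Uc jl' by (simp add: integral_iff)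
  qed
  \<comment> \<open>At most \<open>card I\<close> elements of \<open>B\<close> lie outside
    \<open>I\<close> and at most \<open>card I\<close> lie inside: this is the factor 2.\<close>
  then have "card (B - I) \<le> card I" using \<phi>(1) finI by (intro card_inj_on_le[of \<phi>]) auto
  moreover have "card B \<le> card (B - I) + card I"
    using finI fin by (metis Un_Diff_cancel2 card_Un_le card_mono finite_Diff finite_UnI finite_subset Un_upper1 B_def mem_Collect_eq subsetI le_trans)
  ultimately show ?thesis using \<open>card I \<le> card Rs\<close> unfolding B_def by simp
qed

section \<open>A prime ideal avoiding absorbing elements\<close>

text \<open>The ideal \<open>(W F)\<close> of the overview. The inclusion
  \<open>F \<subseteq> product_ideal W F\<close> says that multiplication by the ideal of
  \<open>W\<close> does not shrink the ideal of \<open>F\<close>, the situation of Nakayama's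
  lemma.\<close>

definition (in cring) product_ideal :: "'a set \<Rightarrow> 'a set \<Rightarrow> 'a set" where
  "product_ideal W F = Idl {x \<otimes> f | x f. x \<in> W \<and> f \<in> F}"

lemma (in ideal) rcos_eq_zero_iff:
  assumes "x \<in> carrier R"
  shows "I +> x = \<zero>\<^bsub>R Quot I\<^esub> \<longleftrightarrow> x \<in> I"
  using a_rcos_const[of x] rcos_const_imp_mem[OF assms] by (auto simp: FactRing_def)

lemma (in ideal) rcoset_representative:
  "c \<in> carrier (R Quot I) \<Longrightarrow> \<exists>x. x \<in> carrier R \<and> I +> x = c"
  by (auto simp: FactRing_def A_RCOSETS_def')

context cring
begin

text \<open>With this colon ideal, a membership that is verified on generators passes to the ideal
  that they generate.\<close>

lemma ideal_colon:
  assumes "ideal J R" and x: "x \<in> carrier R"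
  shows "ideal {g \<in> carrier R. x \<otimes> g \<in> J} R" (is "ideal ?I R")
proof -
  interpret J: ideal J R by fact
  show ?thesis
  proof (rule idealI[OF ring_axioms])
    show "subgroup ?I (add_monoid R)"
    proof (rule subgroup.intro)
      show "y \<otimes>\<^bsub>add_monoid R\<^esub> z \<in> ?I" if "y \<in> ?I" "z \<in> ?I" for y z
        using that x by (auto simp: r_distr)
      show "inv\<^bsub>add_monoid R\<^esub> y \<in> ?I" if "y \<in> ?I" for y
        using that x by (auto simp: a_inv_def[symmetric] r_minus)
    qed (use x in auto)
    show "c \<otimes> y \<in> ?I" if "y \<in> ?I" "c \<in> carrier R" for y c
      using that x J.I_l_closed[of "x \<otimes> y" c] by (auto simp: m_lcomm)
    show "y \<otimes> c \<in> ?I" if "y \<in> ?I" "c \<in> carrier R" for y c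
      using that x J.I_r_closed[of "x \<otimes> y" c] by (auto simp: m_assoc)
  qed
qed

lemma product_ideal_is_ideal:
  "W \<subseteq> carrier R \<Longrightarrow> F \<subseteq> carrier R \<Longrightarrow> ideal (product_ideal W F) R"
  unfolding product_ideal_def by (rule genideal_ideal) auto

lemma product_idealI:
  assumes "W \<subseteq> carrier R" "F \<subseteq> carrier R" "x \<in> W" "f \<in> F"
  shows "x \<otimes> f \<in> product_ideal W F"
proof -
  have "{x \<otimes> f | x f. x \<in> W \<and> f \<in> F} \<subseteq> carrier R" using assms by auto
  then show ?thesis unfolding product_ideal_def using genideal_self assms by blast
qed

lemma product_ideal_subset:
  assumes "ideal I R" "\<And>x f. x \<in> W \<Longrightarrow> f \<in> F \<Longrightarrow> x \<otimes> f \<in> I"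
  shows "product_ideal W F \<subseteq> I"
  unfolding product_ideal_def by (rule genideal_minimal) (use assms in auto)

text \<open>Since \<open>F\<close> need not be finitely generated, a prime ideal \<open>q\<close> with \<open>F\<^sub>q \<noteq> \<zero>\<close> does not
  suffice here: Nakayama's lemma fails for \<open>F\<^sub>q\<close>, and the finiteness of \<open>W\<close> makes up for it.\<close>

lemma exists_prime_without_finite_absorbing_subset:
  assumes F: "F \<subseteq> carrier R" and nz: "f\<^sub>0 \<in> F" "f\<^sub>0 \<noteq> \<zero>"
  obtains q where "primeideal q R"
    and "\<And>W. finite W \<Longrightarrow> W \<subseteq> q \<Longrightarrow> \<not> F \<subseteq> product_ideal W F"
    and "\<And>y. y \<in> carrier R - q \<Longrightarrow> \<exists>W. finite W \<and> W \<subseteq> q \<and> F \<subseteq> product_ideal (insert y W) F"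
proof -
  \<comment> \<open>Finiteness of \<open>W\<close> is what lets the condition pass to the union of a
    chain: a finite subset of the union lies in one member.\<close>
  define small where "small = {I. ideal I R \<and> (\<forall>W. finite W \<longrightarrow> W \<subseteq> I \<longrightarrow> \<not> F \<subseteq> product_ideal W F)}"
  have "{\<zero>} \<in> small"
  proof -
    have "product_ideal W F \<subseteq> {\<zero>}" if "W \<subseteq> {\<zero>}" for W
      
    proof (rule product_ideal_subset[OF zeroideal])
      fix x f assume "x \<in> W" "f \<in> F"
      then have "x = \<zero>" "f \<in> carrier R" using that F by auto
      then show "x \<otimes> f \<in> {\<zero>}" by simp
    qed
    with nz show ?thesis unfolding small_def by (auto intro: zeroideal)
  qed
  have upper: "\<exists>U\<in>small. \<forall>I\<in>\<C>. I \<subseteq> U" if chain: "subset.chain small \<C>" for \<C>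
  proof (cases "\<C> = {}")
    case True
    then show ?thesis using \<open>{\<zero>} \<in> small\<close> by blast
  next
    case False
    have sub: "\<C> \<subseteq> small" using chain by (simp add: subset.chain_def)
    have "subset.chain {I. ideal I R} \<C>" using chain by (auto simp: subset.chain_def small_def)
    then have "ideal (\<Union>\<C>) R" using chain_Union_is_ideal[of \<C>] False by simp
    moreover have "\<not> F \<subseteq> product_ideal W F" if W: "finite W" "W \<subseteq> \<Union>\<C>" for W
    proof -
      obtain I where "I \<in> \<C>" "W \<subseteq> I"
        using finite_subset_Union_chain[OF W False] chain by blast
      with sub W show ?thesis by (auto simp: small_def)
    qed
    ultimately show ?thesis by (intro bexI[of _ "\<Union>\<C>"]) (auto simp: small_def)
  qed
  have "\<exists>q\<in>small. \<forall>I\<in>small. q \<subseteq> I \<longrightarrow> I = q" by (rule subset_Zorn) (rule upper)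
  then obtain q where q: "q \<in> small" and max: "\<And>I. I \<in> small \<Longrightarrow> q \<subseteq> I \<Longrightarrow> I = q" by blast
  have idq: "ideal q R" and nabs: "\<And>W. finite W \<Longrightarrow> W \<subseteq> q \<Longrightarrow> \<not> F \<subseteq> product_ideal W F"
    using q by (auto simp: small_def)
  interpret q: ideal q R by (rule idq)
  have qc: "q \<subseteq> carrier R" using q.a_subset by auto
  have abs: "\<exists>W. finite W \<and> W \<subseteq> q \<and> F \<subseteq> product_ideal (insert y W) F" if y: "y \<in> carrier R - q" for y
  proof -
    define J where "J = Idl (insert y q)"
    have yq: "insert y q \<subseteq> carrier R" using y qc by auto
    have idJ: "ideal J R" unfolding J_def by (rule genideal_ideal[OF yq])
    have "insert y q \<subseteq> J" unfolding J_def by (rule genideal_self[OF yq])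
    then have "J \<notin> small" using max[of J] y by auto
    then obtain W where W: "finite W" "W \<subseteq> J" "F \<subseteq> product_ideal W F" using idJ by (auto simp: small_def)
    have "ideal (q <+> (PIdl y)) R" using add_ideals[OF idq cgenideal_ideal] y by auto
    moreover have "insert y q \<subseteq> q <+> (PIdl y)"
    proof
      fix z assume "z \<in> insert y q"
      then consider "z = y" | "z \<in> q" by auto
      then show "z \<in> q <+> (PIdl y)"
      proof cases
        case 1
        have "y = \<zero> \<oplus> \<one> \<otimes> y" using y by auto
        then show ?thesis unfolding set_add_def' cgenideal_def using 1 q.zero_closed by blast
      next
        case 2
        have "z = z \<oplus> \<zero> \<otimes> y" using 2 y qc by auto
        then show ?thesis unfolding set_add_def' cgenideal_def using 2 by blast
      qed
    qed
    ultimately have "J \<subseteq> q <+> (PIdl y)" unfolding J_def by (rule genideal_minimal)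
    then have "\<forall>x\<in>W. \<exists>z\<in>q. \<exists>k\<in>carrier R. x = z \<oplus> k \<otimes> y"
      using W(2) unfolding set_add_def' cgenideal_def by blast
    \<comment> \<open>Modulo \<open>q\<close>, each element of the absorbing set is a multiple of
      \<open>y\<close>. Its part in \<open>q\<close> replaces it, and the single generator
      \<open>y\<close> accounts for all the multiples.\<close>
    then obtain \<phi> where \<phi>: "\<And>x. x \<in> W \<Longrightarrow> \<phi> x \<in> q \<and> (\<exists>k\<in>carrier R. x = \<phi> x \<oplus> k \<otimes> y)" by metis
    let ?W = "\<phi> ` W"
    have sub: "insert y ?W \<subseteq> carrier R" using y \<phi> qc by auto
    then interpret I: ideal "product_ideal (insert y ?W) F" R by (rule product_ideal_is_ideal) (rule F)
    have "product_ideal W F \<subseteq> product_ideal (insert y ?W) F"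
    proof (rule product_ideal_subset)
      show "ideal (product_ideal (insert y ?W) F) R" by unfold_locales
      fix x f assume x: "x \<in> W" and f: "f \<in> F"
      obtain k where k: "k \<in> carrier R" "x = \<phi> x \<oplus> k \<otimes> y" using \<phi>[OF x] by blast
      have "\<phi> x \<in> carrier R" "f \<in> carrier R" using \<phi>[OF x] qc f F by auto
      then have "(\<phi> x \<oplus> k \<otimes> y) \<otimes> f = \<phi> x \<otimes> f \<oplus> k \<otimes> (y \<otimes> f)"
        using k(1) y by (simp add: l_distr m_assoc)
      then have "x \<otimes> f = \<phi> x \<otimes> f \<oplus> k \<otimes> (y \<otimes> f)" using k(2) by metis
      moreover have "\<phi> x \<otimes> f \<in> product_ideal (insert y ?W) F" "y \<otimes> f \<in> product_ideal (insert y ?W) F"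
        using product_idealI[OF sub F _ f] x by auto
      ultimately show "x \<otimes> f \<in> product_ideal (insert y ?W) F"
        using k by (simp add: I.I_l_closed)
    qed
    with W \<phi> show ?thesis by (intro exI[of _ ?W]) auto
  qed
  have "primeideal q R"
  proof (rule primeidealI[OF idq is_cring])
    show "carrier R \<noteq> q"
    proof
      assume "carrier R = q"
      then have one: "{\<one>} \<subseteq> q" by auto
      have "F \<subseteq> product_ideal {\<one>} F"
      proof
        fix f assume f: "f \<in> F"
        then have "\<one> \<otimes> f \<in> product_ideal {\<one>} F" using product_idealI[of "{\<one>}" F \<one> f] F by auto
        then show "f \<in> product_ideal {\<one>} F" using f F by (simp add: subset_iff)
      qed
      with nabs[OF _ one] show False by simp
    qed
  next
    \<comment> \<open>With \<open>a\<close> and \<open>b\<close> both outside \<open>q\<close>,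
      absorbing twice gives \<open>F \<subseteq> ((a, W)(b, Y) F)\<close>. Since
      \<open>a \<otimes> b\<close>, \<open>W\<close> and \<open>Y\<close> lie in \<open>q\<close>,
      so do all products of the generators, and they form a forbidden finite set.\<close>
    fix a b assume ab: "a \<in> carrier R" "b \<in> carrier R" "a \<otimes> b \<in> q"
    show "a \<in> q \<or> b \<in> q"
    proof (rule ccontr)
      assume "\<not> (a \<in> q \<or> b \<in> q)"
      then obtain W Y where W: "finite W" "W \<subseteq> q" "F \<subseteq> product_ideal (insert a W) F"
        and Y: "finite Y" "Y \<subseteq> q" "F \<subseteq> product_ideal (insert b Y) F"
        using abs[of a] abs[of b] ab by auto
      let ?Z = "(\<lambda>(x, y). x \<otimes> y) ` (insert a W \<times> insert b Y)"
      have sX: "insert a W \<subseteq> carrier R" and sY: "insert b Y \<subseteq> carrier R" using W Y qc ab by auto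
      have Zq: "?Z \<subseteq> q" using W Y ab qc by (auto simp: q.I_l_closed q.I_r_closed subset_iff)
      then have sZ: "?Z \<subseteq> carrier R" using qc by auto
      have idZ: "ideal (product_ideal ?Z F) R" by (rule product_ideal_is_ideal[OF sZ F])
      have "x \<otimes> f \<in> product_ideal ?Z F" if x: "x \<in> insert a W" and f: "f \<in> F" for x f
      proof -
        have xc: "x \<in> carrier R" using x sX by auto
        \<comment> \<open>The second absorption has to be carried out behind the fixed factor
          \<open>x\<close>: the generators of \<open>((b, Y) F)\<close> lie in the colon ideal by
          \<open>x\<close>, hence so does every \<open>f \<in> F\<close>.\<close>
        let ?I = "{g \<in> carrier R. x \<otimes> g \<in> product_ideal ?Z F}"
        have "ideal ?I R" by (rule ideal_colon[OF idZ xc])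
        moreover have "y \<otimes> g \<in> ?I" if "y \<in> insert b Y" "g \<in> F" for y g
        proof -
          have "x \<otimes> y \<in> ?Z" using x that by blast
          then have "(x \<otimes> y) \<otimes> g \<in> product_ideal ?Z F" using product_idealI[OF sZ F] that by blast
          moreover have "y \<in> carrier R" "g \<in> carrier R" using that sY F by auto
          ultimately show ?thesis using xc by (simp add: m_assoc)
        qed
        ultimately have "product_ideal (insert b Y) F \<subseteq> ?I" by (rule product_ideal_subset)
        with Y(3) f show ?thesis by blast
      qed
      then have "product_ideal (insert a W) F \<subseteq> product_ideal ?Z F"
        using product_ideal_subset[OF idZ] by blast
      with W have "F \<subseteq> product_ideal ?Z F" by blast
      with nabs[OF _ Zq] W Y show False by auto
    qed
  qed
  with nabs abs that show thesis by blast
qed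

text \<open>Closure is here a statement about all ideals \<open>I\<close>, in which a residual of
  \<open>u\<close> or \<open>v\<close> appears only multiplied by elements of \<open>F\<close>. The
  proof removes this factor at the prime \<open>q\<close> and then counts over the domain
  \<open>R Quot q\<close>.\<close>

lemma columns_absorbing_bound:
  assumes fin: "finite Rs" "finite A"
    and C: "\<And>i a. i \<in> Rs \<Longrightarrow> a \<in> A \<Longrightarrow> C i a \<in> carrier R"
    and d: "\<And>a. a \<in> A \<Longrightarrow> d a \<in> carrier R"
    and col: "\<And>a. a \<in> A \<Longrightarrow> Idl ((\<lambda>i. C i a) ` Rs) = carrier R"
    and F: "F \<subseteq> carrier R" and nz: "f\<^sub>0 \<in> F" "f\<^sub>0 \<noteq> \<zero>"
    and closed: "\<And>I u v i f. \<lbrakk>ideal I R; u \<in> A \<rightarrow> carrier R; v \<in> A \<rightarrow> carrier R;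
      \<forall>i\<in>Rs. \<forall>f\<in>F. (\<Oplus>a\<in>A. C i a \<otimes> u a) \<otimes> f \<in> I;
      \<forall>i\<in>Rs. \<forall>f\<in>F. (\<Oplus>a\<in>A. C i a \<otimes> v a) \<otimes> f \<in> I; i \<in> Rs; f \<in> F\<rbrakk>
      \<Longrightarrow> (\<Oplus>a\<in>A. C i a \<otimes> (d a \<otimes> u a \<otimes> v a)) \<otimes> f \<in> I"
  shows "card {a \<in> A. F \<subseteq> product_ideal {d a} F} \<le> 2 * card Rs"
proof -
  obtain q where q: "primeideal q R"
    and nabs: "\<And>W. finite W \<Longrightarrow> W \<subseteq> q \<Longrightarrow> \<not> F \<subseteq> product_ideal W F"
    and abs: "\<And>y. y \<in> carrier R - q \<Longrightarrow> \<exists>W. finite W \<and> W \<subseteq> q \<and> F \<subseteq> product_ideal (insert y W) F"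
    using exists_prime_without_finite_absorbing_subset[OF F nz] by blast
  interpret q: primeideal q R by (rule q)
  interpret D: domain "R Quot q" by (rule q.quotient_is_domain)
  interpret h: ring_hom_cring R "R Quot q" "(+>) q" by (rule q.rcos_ring_hom_cring)
  have qc: "q \<subseteq> carrier R" using q.a_subset by auto
  have h0: "q +> x = \<zero>\<^bsub>R Quot q\<^esub> \<longleftrightarrow> x \<in> q" if "x \<in> carrier R" for x
    by (rule q.rcos_eq_zero_iff[OF that])
  have sumc: "(\<Oplus>a\<in>A. C i a \<otimes> u a) \<in> carrier R" if "i \<in> Rs" "u \<in> A \<rightarrow> carrier R" for i u
    by (rule finsum_closed) (use that C in auto)
  have qclosed: "(\<Oplus>a\<in>A. C i a \<otimes> (d a \<otimes> u a \<otimes> v a)) \<in> q"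
    if u: "u \<in> A \<rightarrow> carrier R" and v: "v \<in> A \<rightarrow> carrier R"
      and uq: "\<forall>i\<in>Rs. (\<Oplus>a\<in>A. C i a \<otimes> u a) \<in> q" and vq: "\<forall>i\<in>Rs. (\<Oplus>a\<in>A. C i a \<otimes> v a) \<in> q"
      and i: "i \<in> Rs" for u v i
  proof (rule ccontr)
    let ?g = "\<Oplus>a\<in>A. C i a \<otimes> (d a \<otimes> u a \<otimes> v a)"
    assume "?g \<notin> q"
    have gc: "?g \<in> carrier R" by (rule sumc) (use i u v d in \<open>auto simp: Pi_iff\<close>)
    then obtain W where W: "finite W" "W \<subseteq> q" "F \<subseteq> product_ideal (insert ?g W) F"
      using abs[of ?g] \<open>?g \<notin> q\<close> by auto
    \<comment> \<open>The residuals of \<open>u\<close> and \<open>v\<close> and the witness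
      \<open>W\<close> together form a finite subset of \<open>q\<close>. Closure modulo
      \<open>(?N F)\<close> makes \<open>?g\<close> redundant in the absorbing set, so
      \<open>?N\<close> absorbs \<open>F\<close>, against the choice of \<open>q\<close>.\<close>
    let ?N = "(\<lambda>i. \<Oplus>a\<in>A. C i a \<otimes> u a) ` Rs \<union> (\<lambda>i. \<Oplus>a\<in>A. C i a \<otimes> v a) ` Rs \<union> W"
    have N: "finite ?N" "?N \<subseteq> q" using fin W uq vq by auto
    then have Nc: "?N \<subseteq> carrier R" using qc by auto
    have idN: "ideal (product_ideal ?N F) R" by (rule product_ideal_is_ideal[OF Nc F])
    have mem: "x \<otimes> f \<in> product_ideal ?N F" if "x \<in> ?N" "f \<in> F" for x f
      by (rule product_idealI[OF Nc F that])
    have gF: "?g \<otimes> f \<in> product_ideal ?N F" if "f \<in> F" for f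
    proof (rule closed[OF idN u v _ _ i that])
      show "\<forall>i\<in>Rs. \<forall>f\<in>F. (\<Oplus>a\<in>A. C i a \<otimes> u a) \<otimes> f \<in> product_ideal ?N F"
        by (intro ballI mem) blast+
      show "\<forall>i\<in>Rs. \<forall>f\<in>F. (\<Oplus>a\<in>A. C i a \<otimes> v a) \<otimes> f \<in> product_ideal ?N F"
        by (intro ballI mem) blast+
    qed
    have "product_ideal (insert ?g W) F \<subseteq> product_ideal ?N F"
    proof (rule product_ideal_subset[OF idN])
      fix x f assume "x \<in> insert ?g W" "f \<in> F"
      then show "x \<otimes> f \<in> product_ideal ?N F" using gF mem[of x f] by blast
    qed
    with W(3) nabs[OF N] show False by blast
  qed
  \<comment> \<open>Closure concerns vectors over \<open>R\<close>, the counting lemma vectors over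
    \<open>R Quot q\<close>; representatives are chosen entry by entry.\<close>
  have lift: "\<exists>u'. u' \<in> A \<rightarrow> carrier R \<and> (\<forall>a\<in>A. q +> u' a = u a)"
    if "u \<in> A \<rightarrow> carrier (R Quot q)" for u
  proof -
    have "\<forall>a\<in>A. \<exists>x. x \<in> carrier R \<and> q +> x = u a"
      using that by (intro ballI q.rcoset_representative) (rule funcset_mem)
    then obtain u' where "\<forall>a\<in>A. u' a \<in> carrier R \<and> q +> u' a = u a" by (rule bchoice[THEN exE])
    then show ?thesis by (intro exI[of _ u'] conjI) (simp_all only: Pi_iff, simp_all)
  qed
  have hsum: "q +> (\<Oplus>a\<in>A. C i a \<otimes> u a) = (\<Oplus>\<^bsub>R Quot q\<^esub>a\<in>A. (q +> C i a) \<otimes>\<^bsub>R Quot q\<^esub> (q +> u a))"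
    if "i \<in> Rs" "u \<in> A \<rightarrow> carrier R" for i u
  proof -
    have "q +> (\<Oplus>a\<in>A. C i a \<otimes> u a) = (\<Oplus>\<^bsub>R Quot q\<^esub>a\<in>A. q +> (C i a \<otimes> u a))"
      using h.hom_finsum[of "\<lambda>a. C i a \<otimes> u a" A] that C by (auto simp: o_def Pi_iff)
    also have "\<dots> = (\<Oplus>\<^bsub>R Quot q\<^esub>a\<in>A. (q +> C i a) \<otimes>\<^bsub>R Quot q\<^esub> (q +> u a))"
      by (rule D.finsum_cong') (use that C in \<open>auto simp: Pi_iff\<close>)
    finally show ?thesis .
  qed
  have bound: "card {a \<in> A. q +> d a \<noteq> \<zero>\<^bsub>R Quot q\<^esub>} \<le> 2 * card Rs"
  proof (rule D.weighted_square_columns_bound[OF fin, of "\<lambda>i a. q +> C i a"])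
    \<comment> \<open>A column whose entries generate the unit ideal cannot lie in the proper ideal
      \<open>q\<close>.\<close>
    show "\<exists>i\<in>Rs. q +> C i a \<noteq> \<zero>\<^bsub>R Quot q\<^esub>" if a: "a \<in> A" for a
    proof (rule ccontr)
      assume "\<not> ?thesis"
      then have "(\<lambda>i. C i a) ` Rs \<subseteq> q" using h0 C a by auto
      then have "carrier R \<subseteq> q" using genideal_minimal[OF q.is_ideal] col[OF a] by metis
      with q.I_notcarr qc show False by auto
    qed
  next
    fix u v i assume u: "u \<in> A \<rightarrow> carrier (R Quot q)" and v: "v \<in> A \<rightarrow> carrier (R Quot q)"
      and us: "\<forall>i\<in>Rs. (\<Oplus>\<^bsub>R Quot q\<^esub>a\<in>A. (q +> C i a) \<otimes>\<^bsub>R Quot q\<^esub> u a) = \<zero>\<^bsub>R Quot q\<^esub>"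
      and vs: "\<forall>i\<in>Rs. (\<Oplus>\<^bsub>R Quot q\<^esub>a\<in>A. (q +> C i a) \<otimes>\<^bsub>R Quot q\<^esub> v a) = \<zero>\<^bsub>R Quot q\<^esub>"
      and i: "i \<in> Rs"
    obtain u' where u': "u' \<in> A \<rightarrow> carrier R" "\<forall>a\<in>A. q +> u' a = u a" using lift[OF u] by blast
    obtain v' where v': "v' \<in> A \<rightarrow> carrier R" "\<forall>a\<in>A. q +> v' a = v a" using lift[OF v] by blast
    have eq: "(\<Oplus>\<^bsub>R Quot q\<^esub>a\<in>A. (q +> C j a) \<otimes>\<^bsub>R Quot q\<^esub> w a) = q +> (\<Oplus>a\<in>A. C j a \<otimes> w' a)"
      if "j \<in> Rs" "w' \<in> A \<rightarrow> carrier R" "\<forall>a\<in>A. q +> w' a = w a" for j w w'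
      unfolding hsum[OF that(1,2)]
    proof (rule D.finsum_cong')
      show "(\<lambda>a. (q +> C j a) \<otimes>\<^bsub>R Quot q\<^esub> (q +> w' a)) \<in> A \<rightarrow> carrier (R Quot q)"
        using that(1,2) C by (simp add: Pi_iff)
    qed (use that(3) in simp_all)
    have "(\<Oplus>a\<in>A. C j a \<otimes> u' a) \<in> q" "(\<Oplus>a\<in>A. C j a \<otimes> v' a) \<in> q" if "j \<in> Rs" for j
      using us vs eq[OF that u'] eq[OF that v'] h0[OF sumc[OF that u'(1)]] h0[OF sumc[OF that v'(1)]] that
      by metis+
    then have *: "(\<Oplus>a\<in>A. C i a \<otimes> (d a \<otimes> u' a \<otimes> v' a)) \<in> q"
      by (intro qclosed[OF u'(1) v'(1) _ _ i] ballI)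
    have duv: "(\<lambda>a. d a \<otimes> u' a \<otimes> v' a) \<in> A \<rightarrow> carrier R"
      using d u'(1) v'(1) by (simp add: Pi_iff)
    show "(\<Oplus>\<^bsub>R Quot q\<^esub>a\<in>A. (q +> C i a) \<otimes>\<^bsub>R Quot q\<^esub>
        ((q +> d a) \<otimes>\<^bsub>R Quot q\<^esub> u a \<otimes>\<^bsub>R Quot q\<^esub> v a)) = \<zero>\<^bsub>R Quot q\<^esub>"
    proof -
      have "\<forall>a\<in>A. q +> (d a \<otimes> u' a \<otimes> v' a) = (q +> d a) \<otimes>\<^bsub>R Quot q\<^esub> u a \<otimes>\<^bsub>R Quot q\<^esub> v a"
        using u' v' d by (simp add: Pi_iff)
      from eq[OF i duv this] * h0[OF sumc[OF i duv]] show ?thesis by metis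
    qed
  qed (use C d in auto)
  \<comment> \<open>If \<open>d a\<close> were in \<open>q\<close>, the singleton
    \<open>{d a}\<close> would be a finite absorbing subset of \<open>q\<close>.\<close>
  have sub: "{a \<in> A. F \<subseteq> product_ideal {d a} F} \<subseteq> {a \<in> A. q +> d a \<noteq> \<zero>\<^bsub>R Quot q\<^esub>}"
    using nabs[of "{d _}"] h0 d by auto
  have "card {a \<in> A. F \<subseteq> product_ideal {d a} F} \<le> card {a \<in> A. q +> d a \<noteq> \<zero>\<^bsub>R Quot q\<^esub>}"
    by (rule card_mono[OF _ sub]) (rule finite_Collect_conjI, simp add: fin(2))
  also note bound
  finally show ?thesis .
qed

end

section \<open>Indexed polynomials\<close>

lemma finite_submultisets: "finite {d. d \<subseteq># e}"
proof (induction e)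
  case empty
  then show ?case by simp
next
  case (add x e)
  have "{d. d \<subseteq># add_mset x e} \<subseteq> {d. d \<subseteq># e} \<union> add_mset x ` {d. d \<subseteq># e}"
  proof
    fix d assume "d \<in> {d. d \<subseteq># add_mset x e}"
    then have d: "d \<subseteq># add_mset x e" by simp
    show "d \<in> {d. d \<subseteq># e} \<union> add_mset x ` {d. d \<subseteq># e}"
    proof (cases "x \<in># d")
      case True
      then obtain d' where "d = add_mset x d'" by (metis insert_DiffM)
      then show ?thesis using d by auto
    next
      case False
      then have "count d a \<le> count e a" for a
        using mset_subset_eq_count[OF d, of a] by (cases "a = x") (auto simp: not_in_iff)
      then have "d \<subseteq># e" by (simp add: subseteq_mset_def)
      then show ?thesis by simp
    qed
  qed
  then show ?case using add by (meson finite_UnI finite_imageI finite_subset)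
qed

section \<open>Multiplication of indexed polynomials and ideals of the polynomial ring\<close>

context cring
begin

text \<open>A monomial has finitely many divisors, so this Cauchy product makes sense for arbitrary
  coefficient families, as in a power series ring.\<close>

definition indexed_conv :: "('c multiset \<Rightarrow> 'a) \<Rightarrow> ('c multiset \<Rightarrow> 'a) \<Rightarrow> 'c multiset \<Rightarrow> 'a" where
  "indexed_conv p q = (\<lambda>e. \<Oplus>d\<in>{d. d \<subseteq># e}. p d \<otimes> q (e - d))"

lemma carrier_coeff_conv:
  "carrier_coeff p \<Longrightarrow> carrier_coeff q \<Longrightarrow> carrier_coeff (indexed_conv p q)"
  unfolding carrier_coeff_def indexed_conv_def by (auto intro!: finsum_closed)

lemma indexed_conv_commute:
  fixes p q :: "'c multiset \<Rightarrow> 'a"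
  assumes "carrier_coeff p" "carrier_coeff q"
  shows "indexed_conv p q = indexed_conv q p"
proof
  fix e :: "'c multiset"
  let ?D = "{d. d \<subseteq># e}"
  have inj: "inj_on (\<lambda>d. e - d) ?D"
    by (rule inj_onI) (metis mem_Collect_eq subset_mset.diff_diff_right subset_mset.add_diff_inverse add_left_cancel subset_mset.diff_add)
  have img: "(\<lambda>d. e - d) ` ?D = ?D"
  proof
    show "?D \<subseteq> (\<lambda>d. e - d) ` ?D"
    proof
      fix d assume "d \<in> ?D"
      then have "d = e - (e - d)" "e - d \<in> ?D"
        by (auto simp: multiset_eq_iff subseteq_mset_def)
      then show "d \<in> (\<lambda>d. e - d) ` ?D" by blast
    qed
  qed auto
  have "indexed_conv q p e = (\<Oplus>d\<in>(\<lambda>d. e - d) ` ?D. q d \<otimes> p (e - d))"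
    by (simp add: indexed_conv_def img)
  also have "\<dots> = (\<Oplus>d\<in>?D. q (e - d) \<otimes> p (e - (e - d)))"
    by (rule finsum_reindex[OF _ inj]) (use assms in \<open>auto simp: carrier_coeff_def\<close>)
  also have "\<dots> = (\<Oplus>d\<in>?D. p d \<otimes> q (e - d))"
  proof (rule finsum_cong')
    fix d assume "d \<in> ?D"
    then have "e - (e - d) = d" by (auto simp: multiset_eq_iff subseteq_mset_def)
    then show "q (e - d) \<otimes> p (e - (e - d)) = p d \<otimes> q (e - d)"
      using assms by (simp add: carrier_coeff_def m_comm)
  qed (use assms in \<open>auto simp: carrier_coeff_def\<close>)
  finally show "indexed_conv p q e = indexed_conv q p e" by (simp add: indexed_conv_def)
qed

lemma indexed_conv_padd_left:
  assumes "carrier_coeff p" "carrier_coeff q" "carrier_coeff t"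
  shows "indexed_conv (indexed_padd p q) t = indexed_padd (indexed_conv p t) (indexed_conv q t)"
proof
  fix e
  have c: "p d \<in> carrier R" "q d \<in> carrier R" "t d \<in> carrier R" for d using assms by (auto simp: carrier_coeff_def)
  have "indexed_conv (indexed_padd p q) t e = (\<Oplus>d\<in>{d. d \<subseteq># e}. p d \<otimes> t (e - d) \<oplus> q d \<otimes> t (e - d))"
    unfolding indexed_conv_def indexed_padd_def
    by (rule finsum_cong') (use c in \<open>auto simp: l_distr\<close>)
  also have "\<dots> = indexed_padd (indexed_conv p t) (indexed_conv q t) e"
    unfolding indexed_conv_def indexed_padd_def by (rule finsum_addf) (use c in auto)
  finally show "indexed_conv (indexed_padd p q) t e = indexed_padd (indexed_conv p t) (indexed_conv q t) e" .
qed

lemma indexed_conv_const: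
  assumes "k \<in> carrier R" "carrier_coeff t"
  shows "indexed_conv (indexed_const k) t = (\<lambda>e. k \<otimes> t e)"
proof
  fix e
  have c: "t d \<in> carrier R" for d using assms by (auto simp: carrier_coeff_def)
  have "indexed_conv (indexed_const k) t e = (\<Oplus>d\<in>{{#}}. indexed_const k d \<otimes> t (e - d))"
    unfolding indexed_conv_def
    by (rule add.finprod_mono_neutral_cong_right)
      (use assms c finite_submultisets in \<open>auto simp: indexed_const_def\<close>)
  also have "\<dots> = k \<otimes> t e" using assms c by (simp add: indexed_const_def)
  finally show "indexed_conv (indexed_const k) t e = k \<otimes> t e" .
qed

lemma indexed_conv_pmult:
  assumes "carrier_coeff p" "carrier_coeff t"
  shows "indexed_conv (indexed_pmult p i) t = indexed_pmult (indexed_conv p t) i"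
proof
  fix e
  have c: "p d \<in> carrier R" "t d \<in> carrier R" for d using assms by (auto simp: carrier_coeff_def)
  show "indexed_conv (indexed_pmult p i) t e = indexed_pmult (indexed_conv p t) i e"
  proof (cases "i \<in># e")
    case False
    then have "i \<notin># d" if "d \<subseteq># e" for d using that by (meson mset_subset_eqD)
    then show ?thesis using False c
      unfolding indexed_conv_def indexed_pmult_def by (auto intro!: finsum_zeroI)
  next
    case True
    let ?D = "{d. d \<subseteq># e - {#i#}}"
    \<comment> \<open>The divisors of \<open>X^e\<close> that contribute are those divisible by
      \<open>x_i\<close>, that is, \<open>x_i\<close> times the divisors of
      \<open>X^e / x_i\<close>.\<close>
    have img: "{d. d \<subseteq># e \<and> i \<in># d} = add_mset i ` ?D"
    proof
      show "{d. d \<subseteq># e \<and> i \<in># d} \<subseteq> add_mset i ` ?D"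
      proof
        fix d assume "d \<in> {d. d \<subseteq># e \<and> i \<in># d}"
        then have "d = add_mset i (d - {#i#})" "d - {#i#} \<subseteq># e - {#i#}"
          using True by (auto simp: subset_eq_diff_conv)
        then show "d \<in> add_mset i ` ?D" by blast
      qed
      show "add_mset i ` ?D \<subseteq> {d. d \<subseteq># e \<and> i \<in># d}"
        using True by (auto simp: insert_subset_eq_iff)
    qed
    have "indexed_conv (indexed_pmult p i) t e =
        (\<Oplus>d\<in>{d. d \<subseteq># e \<and> i \<in># d}. p (d - {#i#}) \<otimes> t (e - d))"
      unfolding indexed_conv_def
      by (rule add.finprod_mono_neutral_cong_right)
        (use c finite_submultisets in \<open>auto simp: indexed_pmult_def\<close>)
    also have "\<dots> = (\<Oplus>d\<in>?D. p (add_mset i d - {#i#}) \<otimes> t (e - add_mset i d))"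
      unfolding img by (rule finsum_reindex) (use c in \<open>auto simp: inj_on_def\<close>)
    also have "\<dots> = indexed_pmult (indexed_conv p t) i e"
      unfolding indexed_conv_def indexed_pmult_def using True by simp
    finally show ?thesis .
  qed
qed

lemma carrier_coeff_pset: "p \<in> indexed_pset I (carrier R) \<Longrightarrow> carrier_coeff p"
  by (rule indexed_pset_in_carrier) auto

lemma indexed_pset_zero: "indexed_const \<zero> \<in> indexed_pset I (carrier R)"
  by (rule indexed_pset.indexed_const) simp

lemma indexed_pset_smult:
  assumes "k \<in> carrier R" "p \<in> indexed_pset I (carrier R)"
  shows "(\<lambda>e. k \<otimes> p e) \<in> indexed_pset I (carrier R)"
  using assms(2)
proof induction
  case (indexed_const c)
  have "(\<lambda>e. k \<otimes> local.indexed_const c e) = local.indexed_const (k \<otimes> c)"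
    using assms(1) by (auto simp: indexed_const_def)
  then show ?case using assms(1) indexed_const by (metis indexed_pset.indexed_const m_closed)
next
  case (indexed_padd p q)
  have "(\<lambda>e. k \<otimes> local.indexed_padd p q e) = local.indexed_padd (\<lambda>e. k \<otimes> p e) (\<lambda>e. k \<otimes> q e)"
    using assms(1) indexed_padd.hyps[THEN carrier_coeff_pset]
    by (auto simp: local.indexed_padd_def carrier_coeff_def r_distr)
  then show ?case using indexed_padd by (auto intro: indexed_pset.indexed_padd)
next
  case (indexed_pmult p i)
  have "(\<lambda>e. k \<otimes> local.indexed_pmult p i e) = local.indexed_pmult (\<lambda>e. k \<otimes> p e) i"
    using assms(1) by (auto simp: indexed_pmult_def)
  then show ?case using indexed_pmult by (auto intro: indexed_pset.indexed_pmult)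
qed

lemma indexed_pset_conv:
  assumes p: "p \<in> indexed_pset I (carrier R)" and q: "q \<in> indexed_pset I (carrier R)"
  shows "indexed_conv p q \<in> indexed_pset I (carrier R)"
  using p
proof induction
  case (indexed_const k)
  then show ?case
    using indexed_conv_const[OF _ carrier_coeff_pset[OF q]] indexed_pset_smult[OF _ q] by simp
next
  case (indexed_padd p p')
  then show ?case
    using indexed_conv_padd_left[OF carrier_coeff_pset carrier_coeff_pset carrier_coeff_pset[OF q]]
    by (auto intro: indexed_pset.indexed_padd)
next
  case (indexed_pmult p i)
  then show ?case
    using indexed_conv_pmult[OF carrier_coeff_pset carrier_coeff_pset[OF q]]
    by (auto intro: indexed_pset.indexed_pmult)
qed

text \<open>Induction on how \<open>p\<close> is built from constants, sums and multiplication by a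
  variable replaces the rearrangement of a double sum: convolution is compatible with each of the
  three.\<close>

lemma indexed_conv_assoc:
  assumes p: "p \<in> indexed_pset I (carrier R)" and q: "carrier_coeff q" and t: "carrier_coeff t"
  shows "indexed_conv (indexed_conv p q) t = indexed_conv p (indexed_conv q t)"
  using p
proof induction
  case (indexed_const k)
  have c: "q d \<in> carrier R" "t d \<in> carrier R" for d using q t by (auto simp: carrier_coeff_def)
  have "indexed_conv (\<lambda>e. k \<otimes> q e) t = (\<lambda>e. k \<otimes> indexed_conv q t e)"
  proof
    fix e
    have "indexed_conv (\<lambda>e. k \<otimes> q e) t e = (\<Oplus>d\<in>{d. d \<subseteq># e}. k \<otimes> (q d \<otimes> t (e - d)))"
      unfolding indexed_conv_def by (rule finsum_cong') (use indexed_const c in \<open>auto simp: m_assoc\<close>)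
    also have "\<dots> = k \<otimes> indexed_conv q t e"
      unfolding indexed_conv_def
      by (rule finsum_rdistr[symmetric]) (use indexed_const c finite_submultisets in auto)
    finally show "indexed_conv (\<lambda>e. k \<otimes> q e) t e = k \<otimes> indexed_conv q t e" .
  qed
  then show ?case
    using indexed_conv_const[OF indexed_const q] indexed_conv_const[OF indexed_const carrier_coeff_conv[OF q t]]
    by simp
next
  case (indexed_padd p p')
  note c = carrier_coeff_pset[OF indexed_padd.hyps(1)] carrier_coeff_pset[OF indexed_padd.hyps(2)]
  show ?case
    using indexed_conv_padd_left[OF c q] indexed_conv_padd_left[OF c carrier_coeff_conv[OF q t]]
      indexed_conv_padd_left[OF carrier_coeff_conv[OF c(1) q] carrier_coeff_conv[OF c(2) q] t]
      indexed_padd.IH by simp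
next
  case (indexed_pmult p i)
  note c = carrier_coeff_pset[OF indexed_pmult.hyps(1)]
  show ?case
    using indexed_conv_pmult[OF c q] indexed_conv_pmult[OF c carrier_coeff_conv[OF q t]]
      indexed_conv_pmult[OF carrier_coeff_conv[OF c q] t] indexed_pmult.IH by simp
qed

lemma indexed_poly_ring_simps:
  "carrier (indexed_poly_ring R I) = indexed_pset I (carrier R)"
  "p \<otimes>\<^bsub>indexed_poly_ring R I\<^esub> q = indexed_conv p q"
  "p \<oplus>\<^bsub>indexed_poly_ring R I\<^esub> q = indexed_padd p q"
  "\<one>\<^bsub>indexed_poly_ring R I\<^esub> = indexed_const \<one>"
  "\<zero>\<^bsub>indexed_poly_ring R I\<^esub> = indexed_const \<zero>"
  by (simp_all add: indexed_poly_ring_def indexed_conv_def)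

lemma indexed_padd_neg:
  assumes "p \<in> indexed_pset I (carrier R)"
  shows "(\<lambda>e. (\<ominus> \<one>) \<otimes> p e) \<in> indexed_pset I (carrier R)"
    and "indexed_padd (\<lambda>e. (\<ominus> \<one>) \<otimes> p e) p = indexed_const \<zero>"
  using indexed_pset_smult[OF _ assms, of "\<ominus> \<one>"] carrier_coeff_pset[OF assms]
  by (auto simp: indexed_padd_def indexed_const_def carrier_coeff_def l_minus l_neg)

lemma indexed_poly_ring_is_cring: "cring (indexed_poly_ring R I)"
proof (rule cringI)
  show "abelian_group (indexed_poly_ring R I)"
  proof (rule abelian_groupI; unfold indexed_poly_ring_simps)
    show "indexed_padd (indexed_padd p q) t = indexed_padd p (indexed_padd q t)"
      if "p \<in> indexed_pset I (carrier R)" "q \<in> indexed_pset I (carrier R)" "t \<in> indexed_pset I (carrier R)" for p q t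
      using that[THEN carrier_coeff_pset] by (auto simp: indexed_padd_def carrier_coeff_def a_assoc)
    show "indexed_padd p q = indexed_padd q p"
      if "p \<in> indexed_pset I (carrier R)" "q \<in> indexed_pset I (carrier R)" for p q
      using that[THEN carrier_coeff_pset] by (auto simp: indexed_padd_def carrier_coeff_def a_comm)
    show "indexed_padd (indexed_const \<zero>) p = p" if "p \<in> indexed_pset I (carrier R)" for p
      using that[THEN carrier_coeff_pset] by (rule indexed_padd_zero(2))
    show "\<exists>q\<in>indexed_pset I (carrier R). indexed_padd q p = indexed_const \<zero>"
      if "p \<in> indexed_pset I (carrier R)" for p
      using indexed_padd_neg[OF that] by blast
  qed (auto intro: indexed_pset.intros)
  show "Group.comm_monoid (indexed_poly_ring R I)"
  proof (rule comm_monoidI; unfold indexed_poly_ring_simps)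
    show "indexed_conv p q \<in> indexed_pset I (carrier R)"
      if "p \<in> indexed_pset I (carrier R)" "q \<in> indexed_pset I (carrier R)" for p q
      using that by (rule indexed_pset_conv)
    show "indexed_conv (indexed_conv p q) t = indexed_conv p (indexed_conv q t)"
      if "p \<in> indexed_pset I (carrier R)" "q \<in> indexed_pset I (carrier R)" "t \<in> indexed_pset I (carrier R)" for p q t
      using that by (intro indexed_conv_assoc carrier_coeff_pset)
    show "indexed_conv (indexed_const \<one>) p = p" if "p \<in> indexed_pset I (carrier R)" for p
      using that[THEN carrier_coeff_pset] by (simp add: indexed_conv_const carrier_coeff_def)
    show "indexed_conv p q = indexed_conv q p"
      if "p \<in> indexed_pset I (carrier R)" "q \<in> indexed_pset I (carrier R)" for p q
      using that by (intro indexed_conv_commute carrier_coeff_pset)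
  qed (auto intro: indexed_pset.intros)
  show "(p \<oplus>\<^bsub>indexed_poly_ring R I\<^esub> q) \<otimes>\<^bsub>indexed_poly_ring R I\<^esub> t =
      p \<otimes>\<^bsub>indexed_poly_ring R I\<^esub> t \<oplus>\<^bsub>indexed_poly_ring R I\<^esub> q \<otimes>\<^bsub>indexed_poly_ring R I\<^esub> t"
    if "p \<in> carrier (indexed_poly_ring R I)" "q \<in> carrier (indexed_poly_ring R I)"
      "t \<in> carrier (indexed_poly_ring R I)" for p q t
    using that unfolding indexed_poly_ring_simps
    by (intro indexed_conv_padd_left carrier_coeff_pset)
qed

lemma indexed_poly_idealI:
  assumes "J \<subseteq> indexed_pset I (carrier R)" "indexed_const \<zero> \<in> J"
    and add: "\<And>p q. p \<in> J \<Longrightarrow> q \<in> J \<Longrightarrow> indexed_padd p q \<in> J"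
    and mult: "\<And>p q. p \<in> indexed_pset I (carrier R) \<Longrightarrow> q \<in> J \<Longrightarrow> indexed_conv p q \<in> J"
  shows "ideal J (indexed_poly_ring R I)"
proof -
  interpret Q: cring "indexed_poly_ring R I" by (rule indexed_poly_ring_is_cring)
  show ?thesis
  proof (rule idealI[OF Q.ring_axioms])
    show "subgroup J (add_monoid (indexed_poly_ring R I))"
    proof (rule subgroup.intro)
      fix p assume p: "p \<in> J"
      then have pI: "p \<in> indexed_pset I (carrier R)" using assms(1) by blast
      have "(\<lambda>e. (\<ominus> \<one>) \<otimes> p e) = indexed_conv (indexed_const (\<ominus> \<one>)) p"
        using carrier_coeff_pset[OF pI] by (simp add: indexed_conv_const)
      moreover have "\<ominus>\<^bsub>indexed_poly_ring R I\<^esub> p = (\<lambda>e. (\<ominus> \<one>) \<otimes> p e)"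
        using Q.minus_equality[of "\<lambda>e. (\<ominus> \<one>) \<otimes> p e" p] indexed_padd_neg[OF pI] pI
        by (simp add: indexed_poly_ring_simps)
      moreover have "indexed_conv (indexed_const (\<ominus> \<one>)) p \<in> J"
        by (rule mult[OF _ p]) (auto intro: indexed_pset.intros)
      ultimately show "inv\<^bsub>add_monoid (indexed_poly_ring R I)\<^esub> p \<in> J" by (simp add: a_inv_def)
    qed (use assms in \<open>auto simp: indexed_poly_ring_simps\<close>)
    fix p q assume pq: "p \<in> J" "q \<in> carrier (indexed_poly_ring R I)"
    then show "q \<otimes>\<^bsub>indexed_poly_ring R I\<^esub> p \<in> J" using mult by (auto simp: indexed_poly_ring_simps)
    then show "p \<otimes>\<^bsub>indexed_poly_ring R I\<^esub> q \<in> J" using Q.m_comm[of p q] pq assms(1)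
      by (auto simp: indexed_poly_ring_simps)
  qed
qed

text \<open>The support of \<open>P\<close> refers to all linear homogeneous elements of
  \<open>P\<close>. This lemma brings it down to the generators: for \<open>a\<close> in the
  support, their coefficients at \<open>x_a\<close> already generate the unit ideal.\<close>

lemma linear_coefficients_of_generated_ideal:
  assumes G: "G \<subseteq> indexed_pset I (carrier R)" and lin: "\<And>g. g \<in> G \<Longrightarrow> linear_homogeneous R g"
    and p: "p \<in> Idl\<^bsub>indexed_poly_ring R I\<^esub> G"
  shows "p {#a#} \<in> Idl ((\<lambda>g. g {#a#}) ` G)"
proof -
  interpret Q: cring "indexed_poly_ring R I" by (rule indexed_poly_ring_is_cring)
  let ?M = "Idl ((\<lambda>g. g {#a#}) ` G)"
  have gc: "(\<lambda>g. g {#a#}) ` G \<subseteq> carrier R" using G carrier_coeff_pset by (auto simp: carrier_coeff_def)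
  interpret M: ideal ?M R by (rule genideal_ideal[OF gc])
  \<comment> \<open>The condition on the constant term is what makes this set an ideal, because
    multiplication by \<open>x_a\<close> moves the constant term to the coefficient at
    \<open>a\<close>.\<close>
  let ?J = "{p \<in> indexed_pset I (carrier R). p {#} = \<zero> \<and> p {#a#} \<in> ?M}"
  have "ideal ?J (indexed_poly_ring R I)"
  proof (rule indexed_poly_idealI)
    show "indexed_const \<zero> \<in> ?J"
      using indexed_pset_zero[of I] by (simp add: indexed_const_def)
    show "indexed_padd p q \<in> ?J" if "p \<in> ?J" "q \<in> ?J" for p q
      using that indexed_pset.indexed_padd[of p I "carrier R" q] by (simp add: indexed_padd_def)
    show "indexed_conv p q \<in> ?J" if p: "p \<in> indexed_pset I (carrier R)" and q: "q \<in> ?J" for p q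
    proof -
      have q': "q \<in> indexed_pset I (carrier R)" using q by simp
      have "indexed_conv p q {#} = \<zero> \<and> indexed_conv p q {#a#} \<in> ?M"
        using p
      proof induction
        case (indexed_const k)
        then show ?case using q carrier_coeff_pset[OF q'] by (simp add: indexed_conv_const M.I_l_closed)
      next
        case (indexed_padd p p')
        then show ?case
          using indexed_conv_padd_left[OF carrier_coeff_pset carrier_coeff_pset carrier_coeff_pset[OF q']]
          by (simp add: local.indexed_padd_def)
      next
        case (indexed_pmult p i)
        then show ?case
          using indexed_conv_pmult[OF carrier_coeff_pset carrier_coeff_pset[OF q']]
          by (simp add: local.indexed_pmult_def)
      qed
      then show ?thesis using indexed_pset_conv[OF p q'] by simp
    qed
  qed auto
  moreover have "G \<subseteq> ?J"
  proof
    fix g assume g: "g \<in> G"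
    have "g {#} = \<zero>" using lin[OF g] by (auto simp: linear_homogeneous_def)
    then show "g \<in> ?J" using g G genideal_self[OF gc] by auto
  qed
  ultimately have "Idl\<^bsub>indexed_poly_ring R I\<^esub> G \<subseteq> ?J" by (rule Q.genideal_minimal)
  then show ?thesis using p by auto
qed

section \<open>Values of polynomials at scalars\<close>

definition monomial_value :: "'c set \<Rightarrow> ('c \<Rightarrow> 'a) \<Rightarrow> 'c multiset \<Rightarrow> 'a" where
  "monomial_value I s e = (\<Otimes>a\<in>I. s a [^] count e a)"

definition poly_value :: "'c set \<Rightarrow> ('c \<Rightarrow> 'a) \<Rightarrow> ('c multiset \<Rightarrow> 'a) \<Rightarrow> 'a" where
  "poly_value I s p = (\<Oplus>e\<in>{e. p e \<noteq> \<zero>}. p e \<otimes> monomial_value I s e)"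

lemma indexed_pset_support:
  assumes "p \<in> indexed_pset I (carrier R)"
  shows "finite {e. p e \<noteq> \<zero>}" and "p e \<noteq> \<zero> \<Longrightarrow> set_mset e \<subseteq> I"
proof -
  have "finite {e. p e \<noteq> \<zero>} \<and> (\<forall>e. p e \<noteq> \<zero> \<longrightarrow> set_mset e \<subseteq> I)"
    using assms
  proof induction
    case (indexed_const k)
    have "{e. local.indexed_const k e \<noteq> \<zero>} \<subseteq> {{#}}" by (auto simp: local.indexed_const_def)
    then show ?case by (auto simp: local.indexed_const_def intro: finite_subset)
  next
    case (indexed_padd p q)
    have sub: "{e. local.indexed_padd p q e \<noteq> \<zero>} \<subseteq> {e. p e \<noteq> \<zero>} \<union> {e. q e \<noteq> \<zero>}"
      by (auto simp: local.indexed_padd_def)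
    then have "finite {e. local.indexed_padd p q e \<noteq> \<zero>}"
      by (rule finite_subset) (use indexed_padd.IH in simp)
    then show ?case using sub indexed_padd.IH by blast
  next
    case (indexed_pmult p i)
    have sub: "{e. local.indexed_pmult p i e \<noteq> \<zero>} \<subseteq> add_mset i ` {e. p e \<noteq> \<zero>}"
    proof
      fix e assume "e \<in> {e. local.indexed_pmult p i e \<noteq> \<zero>}"
      then have "i \<in># e" "p (e - {#i#}) \<noteq> \<zero>" by (auto simp: local.indexed_pmult_def split: if_splits)
      then show "e \<in> add_mset i ` {e. p e \<noteq> \<zero>}" by (intro image_eqI[of _ _ "e - {#i#}"]) auto
    qed
    then have "finite {e. local.indexed_pmult p i e \<noteq> \<zero>}"
      by (rule finite_subset) (use indexed_pmult.IH in simp)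
    moreover have "set_mset e \<subseteq> I" if e: "local.indexed_pmult p i e \<noteq> \<zero>" for e
    proof -
      obtain d where "e = add_mset i d" "p d \<noteq> \<zero>" using sub e by blast
      then show ?thesis using indexed_pmult by auto
    qed
    ultimately show ?case by blast
  qed
  then show "finite {e. p e \<noteq> \<zero>}" and "p e \<noteq> \<zero> \<Longrightarrow> set_mset e \<subseteq> I" by auto
qed

lemma monomial_value_closed:
  "s \<in> I \<rightarrow> carrier R \<Longrightarrow> monomial_value I s e \<in> carrier R"
  unfolding monomial_value_def by (rule finprod_closed) auto

lemma monomial_value_add_mset:
  assumes "finite I" "s \<in> I \<rightarrow> carrier R" "i \<in> I"
  shows "monomial_value I s (add_mset i e) = s i \<otimes> monomial_value I s e"
proof -
  have sc: "s a \<in> carrier R" if "a \<in> I" for a using assms that by auto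
  have "monomial_value I s (add_mset i e) =
      (\<Otimes>a\<in>I. (if i = a then s a else \<one>) \<otimes> s a [^] count e a)"
    unfolding monomial_value_def
    by (rule finprod_cong') (use sc in \<open>auto simp: m_comm\<close>)
  also have "\<dots> = (\<Otimes>a\<in>I. if i = a then s a else \<one>) \<otimes> monomial_value I s e"
    unfolding monomial_value_def by (rule finprod_multf) (use sc in auto)
  also have "(\<Otimes>a\<in>I. if i = a then s a else \<one>) = s i"
    by (rule finprod_singleton) (use assms in auto)
  finally show ?thesis .
qed

text \<open>Polynomials with different supports can thus be evaluated over one common finite set of
  monomials.\<close>

lemma poly_value_superset:
  assumes "carrier_coeff p" "s \<in> I \<rightarrow> carrier R" "finite E" "{e. p e \<noteq> \<zero>} \<subseteq> E"
  shows "poly_value I s p = (\<Oplus>e\<in>E. p e \<otimes> monomial_value I s e)"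
  unfolding poly_value_def
  by (rule add.finprod_mono_neutral_cong_left)
    (use assms monomial_value_closed[OF assms(2)] in \<open>auto simp: carrier_coeff_def\<close>)

text \<open>The absorption property of the set of polynomials with value in \<open>J\<close>.
  Induction on how the first factor is built takes the place of multiplicativity of
  evaluation.\<close>

lemma poly_value_conv_in_ideal:
  assumes "finite I" "s \<in> I \<rightarrow> carrier R" and J: "ideal J R"
    and p: "p \<in> indexed_pset I (carrier R)" and q: "q \<in> indexed_pset I (carrier R)" "poly_value I s q \<in> J"
  shows "poly_value I s (indexed_conv p q) \<in> J"
  using p
proof induction
  interpret J: ideal J R by (rule J)
  note mc = monomial_value_closed[OF assms(2)]
  note cq = carrier_coeff_pset[OF q(1)]
  {
    case (indexed_const k)
    have c: "q e \<in> carrier R" for e using cq by (simp add: carrier_coeff_def)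
    have "poly_value I s (\<lambda>e. k \<otimes> q e) = (\<Oplus>e\<in>{e. q e \<noteq> \<zero>}. k \<otimes> q e \<otimes> monomial_value I s e)"
      by (rule poly_value_superset)
        (use indexed_const c assms indexed_pset_support(1)[OF q(1)] in \<open>auto simp: carrier_coeff_def\<close>)
    also have "\<dots> = (\<Oplus>e\<in>{e. q e \<noteq> \<zero>}. k \<otimes> (q e \<otimes> monomial_value I s e))"
      by (rule finsum_cong') (use indexed_const c mc in \<open>auto simp: m_assoc\<close>)
    also have "\<dots> = k \<otimes> poly_value I s q"
      unfolding poly_value_def
      by (rule finsum_rdistr[symmetric]) (use indexed_const c mc indexed_pset_support(1)[OF q(1)] in auto)
    finally show ?case
      using q(2) indexed_const by (simp add: indexed_conv_const[OF indexed_const cq] J.I_l_closed)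
  next
    case (indexed_padd p p')
    let ?f = "indexed_conv p q" and ?g = "indexed_conv p' q"
    have f: "?f \<in> indexed_pset I (carrier R)" "?g \<in> indexed_pset I (carrier R)"
      using indexed_padd indexed_pset_conv q by auto
    let ?E = "{e. ?f e \<noteq> \<zero>} \<union> {e. ?g e \<noteq> \<zero>}"
    have E: "finite ?E" using f indexed_pset_support(1) by auto
    have c: "?f e \<in> carrier R" "?g e \<in> carrier R" for e
      using f[THEN carrier_coeff_pset] by (auto simp: carrier_coeff_def)
    have "poly_value I s (local.indexed_padd ?f ?g) = (\<Oplus>e\<in>?E. local.indexed_padd ?f ?g e \<otimes> monomial_value I s e)"
      by (rule poly_value_superset) (use E assms c in \<open>auto simp: carrier_coeff_def local.indexed_padd_def\<close>)
    also have "\<dots> = (\<Oplus>e\<in>?E. ?f e \<otimes> monomial_value I s e \<oplus> ?g e \<otimes> monomial_value I s e)"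
      by (rule finsum_cong') (use c mc in \<open>auto simp: local.indexed_padd_def l_distr\<close>)
    also have "\<dots> = (\<Oplus>e\<in>?E. ?f e \<otimes> monomial_value I s e) \<oplus> (\<Oplus>e\<in>?E. ?g e \<otimes> monomial_value I s e)"
      by (rule finsum_addf) (use c mc in auto)
    also have "\<dots> = poly_value I s ?f \<oplus> poly_value I s ?g"
      using poly_value_superset[OF carrier_coeff_pset[OF f(1)] assms(2) E]
        poly_value_superset[OF carrier_coeff_pset[OF f(2)] assms(2) E] by auto
    finally show ?case
      using indexed_padd.IH
        indexed_conv_padd_left[OF carrier_coeff_pset[OF indexed_padd.hyps(1)] carrier_coeff_pset[OF indexed_padd.hyps(2)] cq]
      by simp
  next
    case (indexed_pmult p i)
    let ?f = "indexed_conv p q"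
    have f: "?f \<in> indexed_pset I (carrier R)" using indexed_pmult indexed_pset_conv q by auto
    have c: "?f e \<in> carrier R" for e using carrier_coeff_pset[OF f] by (auto simp: carrier_coeff_def)
    have i: "s i \<in> carrier R" using assms indexed_pmult by auto
    let ?E = "{e. ?f e \<noteq> \<zero>}"
    have E: "finite ?E" using f indexed_pset_support(1) by auto
    have "poly_value I s (local.indexed_pmult ?f i) =
        (\<Oplus>e\<in>add_mset i ` ?E. local.indexed_pmult ?f i e \<otimes> monomial_value I s e)"
    proof (rule poly_value_superset)
      show "{e. local.indexed_pmult ?f i e \<noteq> \<zero>} \<subseteq> add_mset i ` ?E"
      proof
        fix e assume "e \<in> {e. local.indexed_pmult ?f i e \<noteq> \<zero>}"
        then have "i \<in># e" "?f (e - {#i#}) \<noteq> \<zero>" by (auto simp: local.indexed_pmult_def split: if_splits)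
        then show "e \<in> add_mset i ` ?E" by (intro image_eqI[of _ _ "e - {#i#}"]) auto
      qed
    qed (use E assms c in \<open>auto simp: carrier_coeff_def local.indexed_pmult_def\<close>)
    also have "\<dots> = (\<Oplus>e\<in>?E. local.indexed_pmult ?f i (add_mset i e) \<otimes> monomial_value I s (add_mset i e))"
      by (rule finsum_reindex) (use c mc in \<open>auto simp: local.indexed_pmult_def inj_on_def\<close>)
    also have "\<dots> = (\<Oplus>e\<in>?E. s i \<otimes> (?f e \<otimes> monomial_value I s e))"
      by (rule finsum_cong')
        (use c mc i monomial_value_add_mset[OF assms(1,2) indexed_pmult.hyps(2)] in
          \<open>auto simp: local.indexed_pmult_def m_lcomm\<close>)
    also have "\<dots> = s i \<otimes> poly_value I s ?f"
      unfolding poly_value_def by (rule finsum_rdistr[symmetric]) (use i c mc E in auto)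
    finally show ?case
      using indexed_pmult.IH i
      by (simp add: indexed_conv_pmult[OF carrier_coeff_pset[OF indexed_pmult.hyps(1)] cq] J.I_l_closed)
  }
qed

text \<open>Polynomials with value in \<open>J\<close> form an ideal, so a condition on the
  generators extends to all of \<open>P\<close>. In the application \<open>J\<close> consists of the
  scalars that multiply \<open>F\<close> into \<open>I\<close>.\<close>

lemma poly_value_of_generated_ideal:
  assumes fin: "finite I" and s: "s \<in> I \<rightarrow> carrier R" and J: "ideal J R"
    and G: "G \<subseteq> indexed_pset I (carrier R)" and GJ: "\<And>g. g \<in> G \<Longrightarrow> poly_value I s g \<in> J"
    and p: "p \<in> Idl\<^bsub>indexed_poly_ring R I\<^esub> G"
  shows "p \<in> indexed_pset I (carrier R) \<and> poly_value I s p \<in> J"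
proof -
  interpret Q: cring "indexed_poly_ring R I" by (rule indexed_poly_ring_is_cring)
  interpret J: ideal J R by (rule J)
  let ?J = "{p \<in> indexed_pset I (carrier R). poly_value I s p \<in> J}"
  have "ideal ?J (indexed_poly_ring R I)"
  proof (rule indexed_poly_idealI)
    show "indexed_const \<zero> \<in> ?J"
      using indexed_pset_zero[of I] by (simp add: indexed_const_def poly_value_def)
    show "indexed_conv p q \<in> ?J" if "p \<in> indexed_pset I (carrier R)" "q \<in> ?J" for p q
      using that poly_value_conv_in_ideal[OF fin s J] indexed_pset_conv by auto
    show "indexed_padd p q \<in> ?J" if "p \<in> ?J" "q \<in> ?J" for p q
    proof -
      have pq: "p \<in> indexed_pset I (carrier R)" "q \<in> indexed_pset I (carrier R)" using that by auto
      let ?E = "{e. p e \<noteq> \<zero>} \<union> {e. q e \<noteq> \<zero>}"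
      have E: "finite ?E" using pq indexed_pset_support(1) by auto
      have c: "p e \<in> carrier R" "q e \<in> carrier R" for e
        using pq[THEN carrier_coeff_pset] by (auto simp: carrier_coeff_def)
      note mc = monomial_value_closed[OF s]
      have "poly_value I s (indexed_padd p q) = (\<Oplus>e\<in>?E. indexed_padd p q e \<otimes> monomial_value I s e)"
        by (rule poly_value_superset) (use E s c in \<open>auto simp: carrier_coeff_def indexed_padd_def\<close>)
      also have "\<dots> = (\<Oplus>e\<in>?E. p e \<otimes> monomial_value I s e \<oplus> q e \<otimes> monomial_value I s e)"
        by (rule finsum_cong') (use c mc in \<open>auto simp: indexed_padd_def l_distr\<close>)
      also have "\<dots> = (\<Oplus>e\<in>?E. p e \<otimes> monomial_value I s e) \<oplus> (\<Oplus>e\<in>?E. q e \<otimes> monomial_value I s e)"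
        by (rule finsum_addf) (use c mc in auto)
      also have "\<dots> = poly_value I s p \<oplus> poly_value I s q"
        using poly_value_superset[OF carrier_coeff_pset[OF pq(1)] s E]
          poly_value_superset[OF carrier_coeff_pset[OF pq(2)] s E] by auto
      finally show ?thesis using that indexed_pset.indexed_padd[OF pq] by simp
    qed
  qed auto
  moreover have "G \<subseteq> ?J" using G GJ by auto
  ultimately have "Idl\<^bsub>indexed_poly_ring R I\<^esub> G \<subseteq> ?J" by (rule Q.genideal_minimal)
  then show ?thesis using p by auto
qed

end

section \<open>Free modules and quotients\<close>

context cring
begin

lemma free_module_simps:
  "carrier (free_module R B) = {f. (\<forall>b\<in>B. f b \<in> carrier R) \<and> (\<forall>b. b \<notin> B \<longrightarrow> f b = \<zero>)
     \<and> finite {b. f b \<noteq> \<zero>}}"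
  "\<zero>\<^bsub>free_module R B\<^esub> = (\<lambda>_. \<zero>)"
  "f \<oplus>\<^bsub>free_module R B\<^esub> g = (\<lambda>b. f b \<oplus> g b)"
  "r \<odot>\<^bsub>free_module R B\<^esub> f = (\<lambda>b. r \<otimes> f b)"
  by (simp_all add: free_module_def)

lemma free_module_coeff: "f \<in> carrier (free_module R B) \<Longrightarrow> f b \<in> carrier R"
  by (cases "b \<in> B") (auto simp: free_module_simps)

lemma free_module_add_closed:
  assumes "f \<in> carrier (free_module R B)" "g \<in> carrier (free_module R B)"
  shows "(\<lambda>b. f b \<oplus> g b) \<in> carrier (free_module R B)"
proof -
  have "{b. f b \<oplus> g b \<noteq> \<zero>} \<subseteq> {b. f b \<noteq> \<zero>} \<union> {b. g b \<noteq> \<zero>}" by auto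
  then show ?thesis using assms unfolding free_module_simps by (auto intro: finite_subset)
qed

lemma free_module_smult_closed:
  assumes "r \<in> carrier R" "f \<in> carrier (free_module R B)"
  shows "(\<lambda>b. r \<otimes> f b) \<in> carrier (free_module R B)"
proof -
  have "{b. r \<otimes> f b \<noteq> \<zero>} \<subseteq> {b. f b \<noteq> \<zero>}" using assms by auto
  then show ?thesis using assms unfolding free_module_simps by (auto intro: finite_subset)
qed

lemma free_module_is_module: "module R (free_module R B)"
proof (rule moduleI)
  show "abelian_group (free_module R B)"
  proof (rule abelian_groupI)
    fix f assume f: "f \<in> carrier (free_module R B)"
    show "\<exists>g\<in>carrier (free_module R B). g \<oplus>\<^bsub>free_module R B\<^esub> f = \<zero>\<^bsub>free_module R B\<^esub>"
    proof (rule bexI)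
      show "(\<lambda>b. \<ominus> \<one> \<otimes> f b) \<oplus>\<^bsub>free_module R B\<^esub> f = \<zero>\<^bsub>free_module R B\<^esub>"
        using free_module_coeff[OF f] by (simp add: free_module_simps(2-) l_minus l_neg)
    qed (rule free_module_smult_closed[OF _ f], simp)
  qed (auto simp: free_module_simps(2-) free_module_add_closed free_module_coeff a_ac
       fun_eq_iff, simp add: free_module_simps)
qed (auto simp: free_module_simps(2-) free_module_smult_closed free_module_coeff l_distr r_distr m_assoc
    intro: is_cring)

lemma basis_vector_closed: "b \<in> B \<Longrightarrow> basis_vector R b \<in> carrier (free_module R B)"
  by (auto simp: basis_vector_def free_module_simps)

text \<open>The condition \<open>y b = \<zero>\<close> keeps the coordinates of the new vector
  readable: \<open>r\<close> at \<open>b\<close> and those of \<open>y\<close> elsewhere. If all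
  coordinates of the sum lie in a set that contains zero, then so do \<open>r\<close> and all
  coordinates of \<open>y\<close>.\<close>

lemma free_module_induct [consumes 1, case_names zero add]:
  assumes "y \<in> carrier (free_module R B)"
    and zero: "P (\<lambda>_. \<zero>)"
    and add: "\<And>y b r. \<lbrakk>y \<in> carrier (free_module R B); P y; b \<in> B; r \<in> carrier R; y b = \<zero>\<rbrakk>
      \<Longrightarrow> P (\<lambda>c. r \<otimes> basis_vector R b c \<oplus> y c)"
  shows "P y"
proof -
  have "finite S \<Longrightarrow> \<forall>y\<in>carrier (free_module R B). {b. y b \<noteq> \<zero>} = S \<longrightarrow> P y" for S
  proof (induction S rule: finite_induct)
    case empty
    have "P y" if "y \<in> carrier (free_module R B)" "{b. y b \<noteq> \<zero>} = {}" for y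
    proof -
      have "y = (\<lambda>_. \<zero>)" using that by auto
      with zero show ?thesis by simp
    qed
    then show ?case by blast
  next
    case (insert b S)
    show ?case
    proof (intro ballI impI)
      fix y assume y: "y \<in> carrier (free_module R B)" "{b. y b \<noteq> \<zero>} = insert b S"
      let ?z = "\<lambda>c. if c = b then \<zero> else y c"
      have supp: "{c. ?z c \<noteq> \<zero>} = S" using y(2) insert.hyps by auto
      have z: "?z \<in> carrier (free_module R B)"
        using y(1) insert.hyps(1) supp by (auto simp: free_module_simps)
      have yc: "y c \<in> carrier R" for c using y(1) by (rule free_module_coeff)
      have "b \<in> B" using y by (auto simp: free_module_simps)
      from add[OF z _ this yc[of b]] insert.IH z supp
      have "P (\<lambda>c. y b \<otimes> basis_vector R b c \<oplus> ?z c)" by simp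
      moreover have "(\<lambda>c. y b \<otimes> basis_vector R b c \<oplus> ?z c) = y"
        using yc by (auto simp: basis_vector_def)
      ultimately show "P y" by simp
    qed
  qed
  with assms(1) show ?thesis by (auto simp: free_module_simps)
qed

end

context module
begin

lemma submodule_span_is_submodule:
  assumes "B \<subseteq> carrier M"
  shows "submodule (submodule_span R M B) R M"
proof (rule submoduleI)
  have sub: "H \<subseteq> carrier M" "\<zero>\<^bsub>M\<^esub> \<in> H" if "submodule H R M" for H
    using submoduleE[OF that] subgroup.one_closed[OF submodule.axioms(1)[OF that]] by auto
  show "submodule_span R M B \<subseteq> carrier M"
    unfolding submodule_span_def using carrier_is_submodule assms by blast
  show "\<zero>\<^bsub>M\<^esub> \<in> submodule_span R M B"
    unfolding submodule_span_def using sub(2) by blast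
  show "\<ominus>\<^bsub>M\<^esub> x \<in> submodule_span R M B" if "x \<in> submodule_span R M B" for x
    using that unfolding submodule_span_def using submoduleE(3) by blast
  show "x \<oplus>\<^bsub>M\<^esub> y \<in> submodule_span R M B" if "x \<in> submodule_span R M B" "y \<in> submodule_span R M B" for x y
    using that unfolding submodule_span_def using submoduleE(5) by blast
  show "r \<odot>\<^bsub>M\<^esub> x \<in> submodule_span R M B" if "r \<in> carrier R" "x \<in> submodule_span R M B" for r x
    using that unfolding submodule_span_def using submoduleE(4) by blast
qed

lemma submodule_span_incl: "B \<subseteq> submodule_span R M B"
  unfolding submodule_span_def by blast

lemma submodule_span_minimal: "submodule H R M \<Longrightarrow> B \<subseteq> H \<Longrightarrow> submodule_span R M B \<subseteq> H"
  unfolding submodule_span_def by blast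

context
  fixes N
  assumes N: "submodule N R M"
begin

lemma quotient_abelian_subgroup: "abelian_subgroup N M"
  by (rule abelian_subgroupI3[OF _ M.abelian_group_axioms])
    (rule additive_subgroup.intro, rule submodule.axioms(1)[OF N])

lemma quotient_rcos_eq_iff:
  assumes "x \<in> carrier M" "y \<in> carrier M"
  shows "N +>\<^bsub>M\<^esub> x = N +>\<^bsub>M\<^esub> y \<longleftrightarrow> x \<ominus>\<^bsub>M\<^esub> y \<in> N"
proof -
  interpret N: abelian_subgroup N M by (rule quotient_abelian_subgroup)
  show ?thesis
    using N.a_rcos_module[OF assms(2,1)] N.a_repr_independence'[OF _ assms(2), of x] N.a_rcos_self[OF assms(1)]
    by (auto simp: a_minus_def)
qed

lemma quotient_carrier: "carrier (quotient_module M N) = {N +>\<^bsub>M\<^esub> x | x. x \<in> carrier M}"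
  by (auto simp: quotient_module_def A_RCOSETS_def')

lemma quotient_zero: "\<zero>\<^bsub>quotient_module M N\<^esub> = N +>\<^bsub>M\<^esub> \<zero>\<^bsub>M\<^esub>"
proof -
  interpret N: abelian_subgroup N M by (rule quotient_abelian_subgroup)
  show ?thesis using M.a_coset_add_zero[OF N.a_subset] by (simp add: quotient_module_def)
qed

lemma quotient_add:
  "x \<in> carrier M \<Longrightarrow> y \<in> carrier M \<Longrightarrow>
    (N +>\<^bsub>M\<^esub> x) \<oplus>\<^bsub>quotient_module M N\<^esub> (N +>\<^bsub>M\<^esub> y) = N +>\<^bsub>M\<^esub> (x \<oplus>\<^bsub>M\<^esub> y)"
  using abelian_subgroup.a_rcos_sum[OF quotient_abelian_subgroup] by (simp add: quotient_module_def)

text \<open>The action on the quotient is defined as a union over all representatives; it is a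
  single coset because all members of the union coincide.\<close>

lemma quotient_smult:
  assumes r: "r \<in> carrier R" and x: "x \<in> carrier M"
  shows "r \<odot>\<^bsub>quotient_module M N\<^esub> (N +>\<^bsub>M\<^esub> x) = N +>\<^bsub>M\<^esub> (r \<odot>\<^bsub>M\<^esub> x)"
proof -
  interpret N: abelian_subgroup N M by (rule quotient_abelian_subgroup)
  have "N +>\<^bsub>M\<^esub> (r \<odot>\<^bsub>M\<^esub> y) = N +>\<^bsub>M\<^esub> (r \<odot>\<^bsub>M\<^esub> x)" if y: "y \<in> N +>\<^bsub>M\<^esub> x" for y
  proof -
    have yc: "y \<in> carrier M" using N.a_elemrcos_carrier[OF x y] .
    have "y \<ominus>\<^bsub>M\<^esub> x \<in> N" using N.a_rcos_module[OF x yc] y by (simp add: a_minus_def)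
    then have "r \<odot>\<^bsub>M\<^esub> (y \<ominus>\<^bsub>M\<^esub> x) \<in> N" using submoduleE(4)[OF N] r by blast
    moreover have "r \<odot>\<^bsub>M\<^esub> (y \<ominus>\<^bsub>M\<^esub> x) = r \<odot>\<^bsub>M\<^esub> y \<ominus>\<^bsub>M\<^esub> r \<odot>\<^bsub>M\<^esub> x"
      using r x yc by (simp add: a_minus_def smult_r_distr smult_r_minus)
    ultimately show ?thesis using quotient_rcos_eq_iff r x yc by simp
  qed
  then have "(\<Union>y\<in>N +>\<^bsub>M\<^esub> x. N +>\<^bsub>M\<^esub> (r \<odot>\<^bsub>M\<^esub> y)) = N +>\<^bsub>M\<^esub> (r \<odot>\<^bsub>M\<^esub> x)"
    by (intro UN_constant_eq[OF N.a_rcos_self[OF x]] ballI)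
  then show ?thesis by (simp add: quotient_module_def)
qed

lemmas quotient_simps = quotient_carrier quotient_zero quotient_add quotient_smult

lemma quotient_is_module: "module R (quotient_module M N)"
proof (rule moduleI)
  have rep: "\<exists>x\<in>carrier M. c = N +>\<^bsub>M\<^esub> x" if "c \<in> carrier (quotient_module M N)" for c
    using that by (auto simp: quotient_carrier)
  have cl: "N +>\<^bsub>M\<^esub> x \<in> carrier (quotient_module M N)" if "x \<in> carrier M" for x
    using that by (auto simp: quotient_carrier)
  show "abelian_group (quotient_module M N)"
  proof (rule abelian_groupI)
    fix c d assume c: "c \<in> carrier (quotient_module M N)" and d: "d \<in> carrier (quotient_module M N)"
    then obtain x y where xy: "x \<in> carrier M" "c = N +>\<^bsub>M\<^esub> x" "y \<in> carrier M" "d = N +>\<^bsub>M\<^esub> y"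
      using rep by blast
    show "c \<oplus>\<^bsub>quotient_module M N\<^esub> d \<in> carrier (quotient_module M N)"
      using xy cl by (simp add: quotient_add)
    show "c \<oplus>\<^bsub>quotient_module M N\<^esub> d = d \<oplus>\<^bsub>quotient_module M N\<^esub> c"
      using xy by (simp add: quotient_add M.a_comm)
    show "\<zero>\<^bsub>quotient_module M N\<^esub> \<oplus>\<^bsub>quotient_module M N\<^esub> c = c"
      using xy by (simp add: quotient_zero quotient_add)
    show "\<exists>e\<in>carrier (quotient_module M N). e \<oplus>\<^bsub>quotient_module M N\<^esub> c = \<zero>\<^bsub>quotient_module M N\<^esub>"
      using xy by (intro bexI[of _ "N +>\<^bsub>M\<^esub> (\<ominus>\<^bsub>M\<^esub> x)"]) (auto simp: quotient_zero quotient_add M.l_neg intro: cl)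
    fix e assume "e \<in> carrier (quotient_module M N)"
    then obtain z where "z \<in> carrier M" "e = N +>\<^bsub>M\<^esub> z" using rep by blast
    then show "c \<oplus>\<^bsub>quotient_module M N\<^esub> d \<oplus>\<^bsub>quotient_module M N\<^esub> e =
        c \<oplus>\<^bsub>quotient_module M N\<^esub> (d \<oplus>\<^bsub>quotient_module M N\<^esub> e)"
      using xy by (simp add: quotient_add M.a_assoc)
  qed (simp add: quotient_zero cl)
  fix r c assume r: "r \<in> carrier R" and c: "c \<in> carrier (quotient_module M N)"
  obtain x where x: "x \<in> carrier M" "c = N +>\<^bsub>M\<^esub> x" using c rep by blast
  show "r \<odot>\<^bsub>quotient_module M N\<^esub> c \<in> carrier (quotient_module M N)"
    using x r cl by (simp add: quotient_smult)
  fix d assume "d \<in> carrier (quotient_module M N)"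
  then obtain y where y: "y \<in> carrier M" "d = N +>\<^bsub>M\<^esub> y" using rep by blast
  show "r \<odot>\<^bsub>quotient_module M N\<^esub> (c \<oplus>\<^bsub>quotient_module M N\<^esub> d) =
      r \<odot>\<^bsub>quotient_module M N\<^esub> c \<oplus>\<^bsub>quotient_module M N\<^esub> r \<odot>\<^bsub>quotient_module M N\<^esub> d"
    using x y r by (simp add: quotient_smult quotient_add smult_r_distr)
next
  fix r s c assume r: "r \<in> carrier R" "s \<in> carrier R" and c: "c \<in> carrier (quotient_module M N)"
  obtain x where x: "x \<in> carrier M" "c = N +>\<^bsub>M\<^esub> x" using c by (auto simp: quotient_carrier)
  show "(r \<oplus> s) \<odot>\<^bsub>quotient_module M N\<^esub> c =
      r \<odot>\<^bsub>quotient_module M N\<^esub> c \<oplus>\<^bsub>quotient_module M N\<^esub> s \<odot>\<^bsub>quotient_module M N\<^esub> c"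
    using x r by (simp add: quotient_smult quotient_add smult_l_distr)
  show "(r \<otimes> s) \<odot>\<^bsub>quotient_module M N\<^esub> c = r \<odot>\<^bsub>quotient_module M N\<^esub> (s \<odot>\<^bsub>quotient_module M N\<^esub> c)"
    using x r by (simp add: quotient_smult smult_assoc1)
next
  fix c assume c: "c \<in> carrier (quotient_module M N)"
  then show "\<one> \<odot>\<^bsub>quotient_module M N\<^esub> c = c" by (auto simp: quotient_carrier quotient_smult)
qed (rule R.is_cring)

end

text \<open>The map out of a free module with prescribed values on the basis. Summation over the
  support of \<open>f\<close> makes the sum finite and keeps the basis set out of the
  parameters.\<close>

definition linear_extension :: "('v \<Rightarrow> 'c) \<Rightarrow> ('v \<Rightarrow> 'a) \<Rightarrow> 'c" where
  "linear_extension \<psi> f = (\<Oplus>\<^bsub>M\<^esub>v\<in>{v. f v \<noteq> \<zero>}. f v \<odot>\<^bsub>M\<^esub> \<psi> v)"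

lemma linear_extension_superset:
  assumes "\<psi> \<in> B \<rightarrow> carrier M" "f \<in> carrier (free_module R B)" "finite E" "E \<subseteq> B" "{v. f v \<noteq> \<zero>} \<subseteq> E"
  shows "linear_extension \<psi> f = (\<Oplus>\<^bsub>M\<^esub>v\<in>E. f v \<odot>\<^bsub>M\<^esub> \<psi> v)"
  unfolding linear_extension_def
proof (rule M.add.finprod_mono_neutral_cong_left)
  show "(\<lambda>v. f v \<odot>\<^bsub>M\<^esub> \<psi> v) \<in> E \<rightarrow> carrier M"
    using R.free_module_coeff[OF assms(2)] funcset_mem[OF assms(1)] assms(4) by blast
  show "f v \<odot>\<^bsub>M\<^esub> \<psi> v = \<zero>\<^bsub>M\<^esub>" if "v \<in> E - {v. f v \<noteq> \<zero>}" for v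
    using that assms funcset_mem[OF assms(1), of v] by auto
qed (use assms in auto)

lemma linear_extension_linear_map:
  assumes "\<psi> \<in> B \<rightarrow> carrier M"
  shows "linear_extension \<psi> \<in> linear_maps R (free_module R B) M"
proof -
  have supp: "finite {v. f v \<noteq> \<zero>}" "{v. f v \<noteq> \<zero>} \<subseteq> B" if "f \<in> carrier (free_module R B)" for f
    using that by (auto simp: R.free_module_simps)
  have p: "\<psi> v \<in> carrier M" if "v \<in> B" for v using assms that by auto
  have "linear_extension \<psi> f \<in> carrier M" if "f \<in> carrier (free_module R B)" for f
    unfolding linear_extension_def
    by (rule M.finsum_closed) (use p supp[OF that] R.free_module_coeff[OF that] in auto)
  moreover have "linear_extension \<psi> (\<lambda>b. f b \<oplus> g b) = linear_extension \<psi> f \<oplus>\<^bsub>M\<^esub> linear_extension \<psi> g"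
    if f: "f \<in> carrier (free_module R B)" and g: "g \<in> carrier (free_module R B)" for f g
  proof -
    let ?E = "{v. f v \<noteq> \<zero>} \<union> {v. g v \<noteq> \<zero>}"
    have E: "finite ?E" "?E \<subseteq> B" using supp[OF f] supp[OF g] by auto
    have c: "f v \<in> carrier R" "g v \<in> carrier R" for v
      using R.free_module_coeff[OF f] R.free_module_coeff[OF g] by auto
    have pE: "\<psi> v \<in> carrier M" if "v \<in> ?E" for v using p E that by blast
    have "linear_extension \<psi> (\<lambda>b. f b \<oplus> g b) = (\<Oplus>\<^bsub>M\<^esub>v\<in>?E. (f v \<oplus> g v) \<odot>\<^bsub>M\<^esub> \<psi> v)"
      by (rule linear_extension_superset[OF assms R.free_module_add_closed[OF f g] E]) auto
    also have "\<dots> = (\<Oplus>\<^bsub>M\<^esub>v\<in>?E. f v \<odot>\<^bsub>M\<^esub> \<psi> v \<oplus>\<^bsub>M\<^esub> g v \<odot>\<^bsub>M\<^esub> \<psi> v)"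
      by (rule M.finsum_cong') (use c pE in \<open>auto simp: smult_l_distr\<close>)
    also have "\<dots> = (\<Oplus>\<^bsub>M\<^esub>v\<in>?E. f v \<odot>\<^bsub>M\<^esub> \<psi> v) \<oplus>\<^bsub>M\<^esub> (\<Oplus>\<^bsub>M\<^esub>v\<in>?E. g v \<odot>\<^bsub>M\<^esub> \<psi> v)"
      by (rule M.finsum_addf) (use c pE in auto)
    also have "\<dots> = linear_extension \<psi> f \<oplus>\<^bsub>M\<^esub> linear_extension \<psi> g"
      using linear_extension_superset[OF assms f E] linear_extension_superset[OF assms g E] by auto
    finally show ?thesis .
  qed
  moreover have "linear_extension \<psi> (\<lambda>b. r \<otimes> f b) = r \<odot>\<^bsub>M\<^esub> linear_extension \<psi> f"
    if r: "r \<in> carrier R" and f: "f \<in> carrier (free_module R B)" for r f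
  proof -
    let ?E = "{v. f v \<noteq> \<zero>}"
    have c: "f v \<in> carrier R" for v using R.free_module_coeff[OF f] .
    have pE: "\<psi> v \<in> carrier M" if "v \<in> ?E" for v using p supp[OF f] that by blast
    have "linear_extension \<psi> (\<lambda>b. r \<otimes> f b) = (\<Oplus>\<^bsub>M\<^esub>v\<in>?E. (r \<otimes> f v) \<odot>\<^bsub>M\<^esub> \<psi> v)"
      by (rule linear_extension_superset[OF assms R.free_module_smult_closed[OF r f] supp[OF f]]) (use r in auto)
    also have "\<dots> = (\<Oplus>\<^bsub>M\<^esub>v\<in>?E. r \<odot>\<^bsub>M\<^esub> (f v \<odot>\<^bsub>M\<^esub> \<psi> v))"
      by (rule M.finsum_cong') (use r c pE in \<open>auto simp: smult_assoc1\<close>)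
    also have "\<dots> = r \<odot>\<^bsub>M\<^esub> linear_extension \<psi> f"
      unfolding linear_extension_def by (rule finsum_smult_ldistr[symmetric]) (use supp[OF f] r c pE in auto)
    finally show ?thesis .
  qed
  ultimately show ?thesis unfolding linear_maps_def by (auto simp: R.free_module_simps(3,4))
qed

lemma linear_extension_basis_vector:
  assumes "\<psi> \<in> B \<rightarrow> carrier M" "v \<in> B"
  shows "linear_extension \<psi> (basis_vector R v) = \<psi> v"
proof -
  have "linear_extension \<psi> (basis_vector R v) = (\<Oplus>\<^bsub>M\<^esub>x\<in>{v}. basis_vector R v x \<odot>\<^bsub>M\<^esub> \<psi> x)"
    by (rule linear_extension_superset[OF assms(1) R.basis_vector_closed[OF assms(2)]])
      (use assms in \<open>auto simp: basis_vector_def\<close>)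
  also have "\<dots> = (\<Oplus>\<^bsub>M\<^esub>x\<in>{v}. \<psi> x)"
    by (rule M.finsum_cong') (use assms funcset_mem[OF assms] in \<open>auto simp: basis_vector_def\<close>)
  also have "\<dots> = \<psi> v" using assms by (simp add: Pi_iff)
  finally show ?thesis .
qed

end

lemma linear_map_zero:
  assumes "module R M" "module R N" "f \<in> linear_maps R M N"
  shows "f \<zero>\<^bsub>M\<^esub> = \<zero>\<^bsub>N\<^esub>"
proof -
  interpret M: module R M by fact
  interpret N: module R N by fact
  have "f (\<zero>\<^bsub>R\<^esub> \<odot>\<^bsub>M\<^esub> \<zero>\<^bsub>M\<^esub>) = \<zero>\<^bsub>R\<^esub> \<odot>\<^bsub>N\<^esub> f \<zero>\<^bsub>M\<^esub>"
    using assms(3) M.R.zero_closed M.M.zero_closed unfolding linear_maps_def by blast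
  moreover have "f \<zero>\<^bsub>M\<^esub> \<in> carrier N" using assms(3) by (auto simp: linear_maps_def)
  ultimately show ?thesis by simp
qed

lemma linear_map_diff:
  assumes "module R M" "module R N" "f \<in> linear_maps R M N" "x \<in> carrier M" "y \<in> carrier M"
  shows "f (x \<ominus>\<^bsub>M\<^esub> y) = f x \<ominus>\<^bsub>N\<^esub> f y"
proof -
  interpret M: module R M by fact
  interpret N: module R N by fact
  have fc: "f x \<in> carrier N" "f y \<in> carrier N" using assms by (auto simp: linear_maps_def)
  have "x \<ominus>\<^bsub>M\<^esub> y = x \<oplus>\<^bsub>M\<^esub> (\<ominus>\<^bsub>R\<^esub> \<one>\<^bsub>R\<^esub>) \<odot>\<^bsub>M\<^esub> y" using assms by (simp add: a_minus_def M.smult_l_minus)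
  then have "f (x \<ominus>\<^bsub>M\<^esub> y) = f x \<oplus>\<^bsub>N\<^esub> (\<ominus>\<^bsub>R\<^esub> \<one>\<^bsub>R\<^esub>) \<odot>\<^bsub>N\<^esub> f y"
    using assms by (simp add: linear_maps_def)
  then show ?thesis using fc by (simp add: a_minus_def N.smult_l_minus)
qed

lemma linear_map_kernel:
  assumes "module R M" "module R N" "f \<in> linear_maps R M N"
  shows "submodule {x \<in> carrier M. f x = \<zero>\<^bsub>N\<^esub>} R M"
proof -
  interpret M: module R M by fact
  interpret N: module R N by fact
  have "f (\<ominus>\<^bsub>M\<^esub> x) = \<zero>\<^bsub>N\<^esub>" if "x \<in> carrier M" "f x = \<zero>\<^bsub>N\<^esub>" for x
    using linear_map_diff[OF assms, of "\<zero>\<^bsub>M\<^esub>" x] linear_map_zero[OF assms] that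
    by (simp add: a_minus_def)
  then show ?thesis
    using linear_map_zero[OF assms] assms(3)
    by (intro M.submoduleI) (auto simp: linear_maps_def)
qed

section \<open>Base change along a surjection\<close>

text \<open>Up to isomorphism these are the algebras \<open>K / I\<close>. Surjectivity makes every
  element of \<open>L \<otimes> V\<close> of the form \<open>1 \<otimes> v\<close>, so maps on base
  changes can be defined and compared on representatives in \<open>V\<close>.\<close>

locale surjective_algebra =
  fixes K :: "('k, 'm) ring_scheme" (structure) and L :: "('k, 'l) module"
  assumes alg: "algebra K L"
    and surj: "l \<in> carrier L \<Longrightarrow> \<exists>k\<in>carrier K. l = k \<odot>\<^bsub>L\<^esub> \<one>\<^bsub>L\<^esub>"
begin

sublocale K: cring K by (rule algebra.R_cring[OF alg])
sublocale L: cring L by (rule algebra.M_cring[OF alg])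
sublocale A: algebra K L by (rule alg)

definition sc :: "'k \<Rightarrow> 'l" where "sc k = k \<odot>\<^bsub>L\<^esub> \<one>\<^bsub>L\<^esub>"

lemma sc_closed [simp]: "k \<in> carrier K \<Longrightarrow> sc k \<in> carrier L"
  by (simp add: sc_def)

lemma sc_hom: "ring_hom_cring K L sc"
proof -
  have "sc (x \<otimes> y) = sc x \<otimes>\<^bsub>L\<^esub> sc y" if "x \<in> carrier K" "y \<in> carrier K" for x y
    using that A.smult_assoc2[of x "\<one>\<^bsub>L\<^esub>" "y \<odot>\<^bsub>L\<^esub> \<one>\<^bsub>L\<^esub>"] by (simp add: sc_def A.smult_assoc1)
  then have "sc \<in> ring_hom K L"
    by (intro ring_hom_memI) (auto simp: sc_def A.smult_l_distr)
  then show ?thesis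
    by (intro ring_hom_cring.intro ring_hom_cring_axioms.intro K.is_cring L.is_cring)
qed

context
  fixes V :: "('k, 'v) module"
  assumes V: "module K V"
begin

lemma relations_closed: "base_change_relations K L V \<subseteq> carrier (free_module L (carrier V))"
proof -
  interpret V: module K V by (rule V)
  interpret F: module L "free_module L (carrier V)" by (rule L.free_module_is_module)
  show ?thesis
    using L.basis_vector_closed[of _ "carrier V"]
    by (auto simp: base_change_relations_def Let_def sc_def[symmetric] intro!: F.M.minus_closed)
qed

lemma kernel_submodule: "submodule (base_change_kernel K L V) L (free_module L (carrier V))"
  unfolding base_change_kernel_def
  by (rule module.submodule_span_is_submodule[OF L.free_module_is_module relations_closed])

lemma base_change_is_module: "module L (base_change K L V)"
  unfolding base_change_def
  by (rule module.quotient_is_module[OF L.free_module_is_module kernel_submodule])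

lemma one_tensor_closed:
  assumes "v \<in> carrier V"
  shows "one_tensor K L V v \<in> carrier (base_change K L V)"
  unfolding one_tensor_def base_change_def
    module.quotient_carrier[OF L.free_module_is_module kernel_submodule]
  using L.basis_vector_closed[OF assms] by blast

lemma one_tensor_eqI:
  assumes "f \<in> carrier (free_module L (carrier V))" "g \<in> carrier (free_module L (carrier V))"
    and "f \<ominus>\<^bsub>free_module L (carrier V)\<^esub> g \<in> base_change_relations K L V"
  shows "base_change_kernel K L V +>\<^bsub>free_module L (carrier V)\<^esub> f
    = base_change_kernel K L V +>\<^bsub>free_module L (carrier V)\<^esub> g"
proof -
  interpret F: module L "free_module L (carrier V)" by (rule L.free_module_is_module)
  have "base_change_relations K L V \<subseteq> base_change_kernel K L V"
    unfolding base_change_kernel_def by (rule F.submodule_span_incl)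
  then show ?thesis using F.quotient_rcos_eq_iff[OF kernel_submodule assms(1,2)] assms(3) by blast
qed

lemma one_tensor_add:
  assumes "x \<in> carrier V" "y \<in> carrier V"
  shows "one_tensor K L V (x \<oplus>\<^bsub>V\<^esub> y) = one_tensor K L V x \<oplus>\<^bsub>base_change K L V\<^esub> one_tensor K L V y"
proof -
  interpret V: module K V by (rule V)
  interpret F: module L "free_module L (carrier V)" by (rule L.free_module_is_module)
  have c: "basis_vector L z \<in> carrier (free_module L (carrier V))" if "z \<in> carrier V" for z
    using that by (rule L.basis_vector_closed)
  have "one_tensor K L V (x \<oplus>\<^bsub>V\<^esub> y) = base_change_kernel K L V +>\<^bsub>free_module L (carrier V)\<^esub>
      (basis_vector L x \<oplus>\<^bsub>free_module L (carrier V)\<^esub> basis_vector L y)"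
    unfolding one_tensor_def
    by (rule one_tensor_eqI) (use assms c in \<open>auto simp: base_change_relations_def Let_def\<close>)
  then show ?thesis
    using F.quotient_add[OF kernel_submodule c[OF assms(1)] c[OF assms(2)]]
    by (simp add: one_tensor_def base_change_def)
qed

lemma one_tensor_smult:
  assumes "k \<in> carrier K" "x \<in> carrier V"
  shows "one_tensor K L V (k \<odot>\<^bsub>V\<^esub> x) = sc k \<odot>\<^bsub>base_change K L V\<^esub> one_tensor K L V x"
proof -
  interpret V: module K V by (rule V)
  interpret F: module L "free_module L (carrier V)" by (rule L.free_module_is_module)
  have c: "basis_vector L z \<in> carrier (free_module L (carrier V))" if "z \<in> carrier V" for z
    using that by (rule L.basis_vector_closed)
  have "one_tensor K L V (k \<odot>\<^bsub>V\<^esub> x) = base_change_kernel K L V +>\<^bsub>free_module L (carrier V)\<^esub>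
      (sc k \<odot>\<^bsub>free_module L (carrier V)\<^esub> basis_vector L x)"
    unfolding one_tensor_def
  proof (rule one_tensor_eqI)
    show "basis_vector L (k \<odot>\<^bsub>V\<^esub> x) \<ominus>\<^bsub>free_module L (carrier V)\<^esub>
      sc k \<odot>\<^bsub>free_module L (carrier V)\<^esub> basis_vector L x \<in> base_change_relations K L V"
      unfolding base_change_relations_def Let_def sc_def using assms by blast
  qed (use assms c in auto)
  then show ?thesis
    using F.quotient_smult[OF kernel_submodule sc_closed[OF assms(1)] c[OF assms(2)]]
    by (simp add: one_tensor_def base_change_def)
qed

text \<open>If \<open>l\<close> is the image of \<open>k\<close>, then \<open>l \<otimes> b\<close>
  equals \<open>1 \<otimes> k b\<close>, and a sum of elements \<open>1 \<otimes> v\<close> is again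
  of this form.\<close>

lemma one_tensor_surj:
  assumes "c \<in> carrier (base_change K L V)"
  obtains v where "v \<in> carrier V" "c = one_tensor K L V v"
proof -
  interpret V: module K V by (rule V)
  interpret F: module L "free_module L (carrier V)" by (rule L.free_module_is_module)
  let ?F = "free_module L (carrier V)" and ?N = "base_change_kernel K L V"
  interpret B: module L "base_change K L V" by (rule base_change_is_module)
  note q = F.quotient_simps[OF kernel_submodule, folded base_change_def]
  have ex: "\<exists>v\<in>carrier V. ?N +>\<^bsub>?F\<^esub> f = one_tensor K L V v" if "f \<in> carrier ?F" for f
    using that
  proof (induction rule: L.free_module_induct)
    case zero
    have "one_tensor K L V (\<zero> \<odot>\<^bsub>V\<^esub> \<zero>\<^bsub>V\<^esub>) = sc \<zero> \<odot>\<^bsub>base_change K L V\<^esub> one_tensor K L V \<zero>\<^bsub>V\<^esub>"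
      by (rule one_tensor_smult) auto
    also have "\<dots> = \<zero>\<^bsub>base_change K L V\<^esub>" using one_tensor_closed by (simp add: sc_def)
    finally have "?N +>\<^bsub>?F\<^esub> (\<lambda>_. \<zero>\<^bsub>L\<^esub>) = one_tensor K L V (\<zero> \<odot>\<^bsub>V\<^esub> \<zero>\<^bsub>V\<^esub>)"
      using q(2) by (simp add: L.free_module_simps(2))
    then show ?case by (intro bexI) auto
  next
    case (add y b l)
    obtain v where v: "v \<in> carrier V" "?N +>\<^bsub>?F\<^esub> y = one_tensor K L V v" using add by blast
    obtain k where k: "k \<in> carrier K" "l = sc k" using surj[OF add.hyps(3)] by (auto simp: sc_def)
    have bc: "basis_vector L b \<in> carrier ?F" by (rule L.basis_vector_closed[OF add.hyps(2)])
    have "?N +>\<^bsub>?F\<^esub> (l \<odot>\<^bsub>?F\<^esub> basis_vector L b \<oplus>\<^bsub>?F\<^esub> y) =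
        (?N +>\<^bsub>?F\<^esub> (l \<odot>\<^bsub>?F\<^esub> basis_vector L b)) \<oplus>\<^bsub>base_change K L V\<^esub> one_tensor K L V v"
      using q(3)[OF F.smult_closed[OF add.hyps(3) bc] add.hyps(1)] v(2) by simp
    also have "?N +>\<^bsub>?F\<^esub> (l \<odot>\<^bsub>?F\<^esub> basis_vector L b) = one_tensor K L V (k \<odot>\<^bsub>V\<^esub> b)"
      using q(4)[OF add.hyps(3) bc] one_tensor_smult[OF k(1) add.hyps(2)] k by (simp add: one_tensor_def)
    also have "one_tensor K L V (k \<odot>\<^bsub>V\<^esub> b) \<oplus>\<^bsub>base_change K L V\<^esub> one_tensor K L V v
        = one_tensor K L V (k \<odot>\<^bsub>V\<^esub> b \<oplus>\<^bsub>V\<^esub> v)"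
      by (rule one_tensor_add[symmetric, OF V.smult_closed[OF k(1) add.hyps(2)] v(1)])
    finally show ?case
      using V.add.m_closed[OF V.smult_closed[OF k(1) add.hyps(2)] v(1)]
      by (intro bexI) (simp_all add: L.free_module_simps(3,4))
  qed
  from assms obtain f where f: "f \<in> carrier ?F" "c = ?N +>\<^bsub>?F\<^esub> f" unfolding q(1) mem_Collect_eq by (elim exE conjE)
  from ex[OF f(1)] show thesis by (elim bexE) (rule that, simp_all add: f(2))
qed

text \<open>The universal property of base change in the form of a congruence: the linear extension
  of \<open>\<psi>\<close> to the free module kills the defining relations. It shows that functions
  given on representatives are well defined.\<close>

lemma one_tensor_universal:
  assumes N: "module L N" and \<psi>: "\<psi> \<in> carrier V \<rightarrow> carrier N"
    and add: "\<And>x y. x \<in> carrier V \<Longrightarrow> y \<in> carrier V \<Longrightarrow> \<psi> (x \<oplus>\<^bsub>V\<^esub> y) = \<psi> x \<oplus>\<^bsub>N\<^esub> \<psi> y"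
    and smult: "\<And>k x. k \<in> carrier K \<Longrightarrow> x \<in> carrier V \<Longrightarrow> \<psi> (k \<odot>\<^bsub>V\<^esub> x) = sc k \<odot>\<^bsub>N\<^esub> \<psi> x"
    and v: "v \<in> carrier V" "w \<in> carrier V" "one_tensor K L V v = one_tensor K L V w"
  shows "\<psi> v = \<psi> w"
proof -
  interpret V: module K V by (rule V)
  let ?F = "free_module L (carrier V)"
  interpret F: module L ?F by (rule L.free_module_is_module)
  interpret N: module L N by (rule N)
  have c: "basis_vector L z \<in> carrier ?F" if "z \<in> carrier V" for z
    using that by (rule L.basis_vector_closed)
  let ?\<Psi> = "N.linear_extension \<psi>"
  have lin: "?\<Psi> \<in> linear_maps L ?F N" by (rule N.linear_extension_linear_map[OF \<psi>])
  then have lin': "?\<Psi> (f \<oplus>\<^bsub>?F\<^esub> g) = ?\<Psi> f \<oplus>\<^bsub>N\<^esub> ?\<Psi> g" "?\<Psi> (l \<odot>\<^bsub>?F\<^esub> f) = l \<odot>\<^bsub>N\<^esub> ?\<Psi> f"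
    if "f \<in> carrier ?F" "g \<in> carrier ?F" "l \<in> carrier L" for f g l
    using that by (auto simp: linear_maps_def)
  have pc: "\<psi> x \<in> carrier N" if "x \<in> carrier V" for x using \<psi> that by blast
  have e: "?\<Psi> (basis_vector L x) = \<psi> x" if "x \<in> carrier V" for x
    by (rule N.linear_extension_basis_vector[OF \<psi> that])
  have diff: "?\<Psi> (f \<ominus>\<^bsub>?F\<^esub> g) = ?\<Psi> f \<ominus>\<^bsub>N\<^esub> ?\<Psi> g" if "f \<in> carrier ?F" "g \<in> carrier ?F" for f g
    by (rule linear_map_diff[OF F.module_axioms N lin that])
  let ?H = "{f \<in> carrier ?F. ?\<Psi> f = \<zero>\<^bsub>N\<^esub>}"
  have "base_change_relations K L V \<subseteq> ?H"
  proof
    fix g assume g: "g \<in> base_change_relations K L V"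
    then consider x y where "x \<in> carrier V" "y \<in> carrier V"
        "g = basis_vector L (x \<oplus>\<^bsub>V\<^esub> y) \<ominus>\<^bsub>?F\<^esub> (basis_vector L x \<oplus>\<^bsub>?F\<^esub> basis_vector L y)"
      | k x where "k \<in> carrier K" "x \<in> carrier V"
        "g = basis_vector L (k \<odot>\<^bsub>V\<^esub> x) \<ominus>\<^bsub>?F\<^esub> (sc k \<odot>\<^bsub>?F\<^esub> basis_vector L x)"
      unfolding base_change_relations_def Let_def sc_def by blast
    then have "?\<Psi> g = \<zero>\<^bsub>N\<^esub>"
    proof cases
      case (1 x y)
      then have "?\<Psi> g = \<psi> (x \<oplus>\<^bsub>V\<^esub> y) \<ominus>\<^bsub>N\<^esub> (\<psi> x \<oplus>\<^bsub>N\<^esub> \<psi> y)"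
        using c[OF 1(1)] c[OF 1(2)] c[OF V.add.m_closed[OF 1(1,2)]]
        by (simp add: diff lin'(1)[OF _ _ L.zero_closed] e)
      then show ?thesis using 1 pc by (simp add: add a_minus_def N.M.r_neg)
    next
      case (2 k x)
      then have "?\<Psi> g = \<psi> (k \<odot>\<^bsub>V\<^esub> x) \<ominus>\<^bsub>N\<^esub> (sc k \<odot>\<^bsub>N\<^esub> \<psi> x)"
        using c[OF 2(2)] c[OF V.smult_closed[OF 2(1,2)]]
        by (simp add: diff lin'(2) e)
      then show ?thesis using 2 pc by (simp add: smult a_minus_def N.M.r_neg)
    qed
    then show "g \<in> ?H" using subsetD[OF relations_closed g] by simp
  qed
  then have "base_change_kernel K L V \<subseteq> ?H"
    unfolding base_change_kernel_def
    by (rule F.submodule_span_minimal[OF linear_map_kernel[OF F.module_axioms N lin]])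
  moreover have "basis_vector L v \<ominus>\<^bsub>?F\<^esub> basis_vector L w \<in> base_change_kernel K L V"
    using F.quotient_rcos_eq_iff[OF kernel_submodule c[OF v(1)] c[OF v(2)]] v(3) by (simp add: one_tensor_def)
  ultimately have "basis_vector L v \<ominus>\<^bsub>?F\<^esub> basis_vector L w \<in> ?H" by (rule subsetD)
  then have "\<psi> v \<ominus>\<^bsub>N\<^esub> \<psi> w = \<zero>\<^bsub>N\<^esub>"
    using diff[OF c[OF v(1)] c[OF v(2)]] e[OF v(1)] e[OF v(2)] by simp
  then have eq: "\<psi> v \<oplus>\<^bsub>N\<^esub> (\<ominus>\<^bsub>N\<^esub> \<psi> w) = \<zero>\<^bsub>N\<^esub>" by (simp add: a_minus_def)
  have "\<psi> v = \<psi> v \<oplus>\<^bsub>N\<^esub> (\<ominus>\<^bsub>N\<^esub> \<psi> w \<oplus>\<^bsub>N\<^esub> \<psi> w)"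
    using pc[OF v(1)] pc[OF v(2)] by (simp add: N.M.l_neg)
  also have "\<dots> = (\<psi> v \<oplus>\<^bsub>N\<^esub> (\<ominus>\<^bsub>N\<^esub> \<psi> w)) \<oplus>\<^bsub>N\<^esub> \<psi> w"
    using pc[OF v(1)] pc[OF v(2)] by (simp add: N.M.a_assoc)
  also have "\<dots> = \<psi> w" using pc[OF v(2)] by (simp add: eq)
  finally show ?thesis .
qed

end

end

section \<open>Multilinear maps and their extension to \<open>L\<close>\<close>

lemma arg_tuples_update:
  "v \<in> arg_tuples n V \<Longrightarrow> a \<in> {1..n} \<Longrightarrow> x \<in> carrier (V a) \<Longrightarrow> v(a := x) \<in> arg_tuples n V"
  unfolding arg_tuples_def by (auto simp: PiE_iff extensional_def)

lemma arg_tuples_component: "v \<in> arg_tuples n V \<Longrightarrow> a \<in> {1..n} \<Longrightarrow> v a \<in> carrier (V a)"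
  unfolding arg_tuples_def by (rule PiE_mem)

lemma arg_tuples_restrict:
  "(\<And>a. a \<in> {1..n} \<Longrightarrow> x a \<in> carrier (V a)) \<Longrightarrow> (\<lambda>a\<in>{1..n}. x a) \<in> arg_tuples n V"
  unfolding arg_tuples_def by (auto simp: PiE_iff)

lemma multilinear_closed:
  "f \<in> multilinear_maps R n V \<Longrightarrow> v \<in> arg_tuples n V \<Longrightarrow> f v \<in> carrier (V 0)"
  unfolding multilinear_maps_def by (blast dest: PiE_mem)

lemma multilinear_add:
  "f \<in> multilinear_maps R n V \<Longrightarrow> v \<in> arg_tuples n V \<Longrightarrow> a \<in> {1..n} \<Longrightarrow> x \<in> carrier (V a) \<Longrightarrow>
    y \<in> carrier (V a) \<Longrightarrow> f (v(a := x \<oplus>\<^bsub>V a\<^esub> y)) = f (v(a := x)) \<oplus>\<^bsub>V 0\<^esub> f (v(a := y))"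
  unfolding multilinear_maps_def by blast

lemma multilinear_smult:
  "f \<in> multilinear_maps R n V \<Longrightarrow> v \<in> arg_tuples n V \<Longrightarrow> a \<in> {1..n} \<Longrightarrow> r \<in> carrier R \<Longrightarrow>
    x \<in> carrier (V a) \<Longrightarrow> f (v(a := r \<odot>\<^bsub>V a\<^esub> x)) = r \<odot>\<^bsub>V 0\<^esub> f (v(a := x))"
  unfolding multilinear_maps_def by blast

text \<open>The set \<open>D\<close> of rescaled axes serves as the induction parameter, so each
  step uses linearity in a single axis.\<close>

lemma multilinear_scale:
  assumes "\<forall>a\<in>{0..n}. module R (V a)" and f: "f \<in> multilinear_maps R n V"
    and w: "w \<in> arg_tuples n V" and c: "c \<in> {1..n} \<rightarrow> carrier R" and D: "D \<subseteq> {1..n}"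
  shows "f (\<lambda>a\<in>{1..n}. if a \<in> D then c a \<odot>\<^bsub>V a\<^esub> w a else w a) = (\<Otimes>\<^bsub>R\<^esub>a\<in>D. c a) \<odot>\<^bsub>V 0\<^esub> f w"
proof -
  have mods: "module R (V a)" if "a \<in> {0..n}" for a using assms(1) that by blast
  interpret V0: module R "V 0" by (rule mods) simp
  have "finite D" using D by (rule finite_subset) simp
  then show ?thesis using D
  proof (induction D rule: finite_induct)
    case empty
    have "(\<lambda>a\<in>{1..n}. w a) = w" using w by (auto simp: arg_tuples_def PiE_iff extensional_def)
    then show ?case using multilinear_closed[OF f w] by simp
  next
    case (insert b D)
    let ?u = "\<lambda>a\<in>{1..n}. if a \<in> D then c a \<odot>\<^bsub>V a\<^esub> w a else w a"
    have b: "b \<in> {1..n}" "b \<notin> D" "c b \<in> carrier R" "D \<subseteq> {1..n}" using insert c by auto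
    have cl: "c a \<odot>\<^bsub>V a\<^esub> w a \<in> carrier (V a)" if a: "a \<in> {1..n}" for a
    proof -
      interpret Va: module R "V a" by (rule mods) (use a in auto)
      show ?thesis using funcset_mem[OF c a] arg_tuples_component[OF w a] by simp
    qed
    have u: "?u \<in> arg_tuples n V"
      by (rule arg_tuples_restrict) (use cl arg_tuples_component[OF w] in auto)
    have "(\<lambda>a\<in>{1..n}. if a \<in> insert b D then c a \<odot>\<^bsub>V a\<^esub> w a else w a) = ?u(b := c b \<odot>\<^bsub>V b\<^esub> w b)"
      using b by (auto simp: fun_eq_iff)
    moreover have "?u(b := w b) = ?u" using b by (auto simp: fun_eq_iff)
    ultimately have "f (\<lambda>a\<in>{1..n}. if a \<in> insert b D then c a \<odot>\<^bsub>V a\<^esub> w a else w a) = c b \<odot>\<^bsub>V 0\<^esub> f ?u"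
      using multilinear_smult[OF f u b(1) b(3) arg_tuples_component[OF w b(1)]] by simp
    also have "\<dots> = c b \<odot>\<^bsub>V 0\<^esub> ((\<Otimes>\<^bsub>R\<^esub>a\<in>D. c a) \<odot>\<^bsub>V 0\<^esub> f w)" by (simp only: insert.IH[OF b(4)])
    also have "\<dots> = (\<Otimes>\<^bsub>R\<^esub>a\<in>insert b D. c a) \<odot>\<^bsub>V 0\<^esub> f w"
    proof -
      have cD: "c \<in> D \<rightarrow> carrier R" using c b by auto
      then show ?thesis using b insert.hyps V0.R.finprod_closed[OF cD] multilinear_closed[OF f w]
        by (simp add: V0.smult_assoc1)
    qed
    finally show ?case .
  qed
qed

context surjective_algebra
begin

context
  fixes V :: "nat \<Rightarrow> ('k, 'v) module" and n :: nat
  assumes V: "\<forall>a\<in>{0..n}. module K (V a)"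
begin

abbreviation "LV \<equiv> \<lambda>a. base_change K L (V a)"
abbreviation "tens a \<equiv> one_tensor K L (V a)"

lemma frame_modules: "a \<in> {1..n} \<Longrightarrow> module K (V a)" "module K (V 0)"
  using V by auto

lemma base_change_frame_modules: "\<forall>a\<in>{0..n}. module L (LV a)"
  using V base_change_is_module by blast

lemma one_tensor_update_cong:
  assumes f: "f \<in> multilinear_maps K n V" and v: "v \<in> arg_tuples n V" and a: "a \<in> {1..n}"
    and x: "x \<in> carrier (V a)" "y \<in> carrier (V a)" "tens a x = tens a y"
  shows "tens 0 (f (v(a := x))) = tens 0 (f (v(a := y)))"
proof (rule one_tensor_universal[OF frame_modules(1)[OF a] _ _ _ _ x, where N = "LV 0" and \<psi> = "\<lambda>x. tens 0 (f (v(a := x)))"])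
  interpret Va: module K "V a" by (rule frame_modules(1)[OF a])
  have cl: "f (v(a := x)) \<in> carrier (V 0)" if "x \<in> carrier (V a)" for x
    by (rule multilinear_closed[OF f arg_tuples_update[OF v a that]])
  show "module L (LV 0)" by (rule base_change_is_module[OF frame_modules(2)])
  show "(\<lambda>x. tens 0 (f (v(a := x)))) \<in> carrier (V a) \<rightarrow> carrier (LV 0)"
    by (intro funcsetI one_tensor_closed[OF frame_modules(2)] cl)
  show "tens 0 (f (v(a := x \<oplus>\<^bsub>V a\<^esub> y))) = tens 0 (f (v(a := x))) \<oplus>\<^bsub>LV 0\<^esub> tens 0 (f (v(a := y)))"
    if "x \<in> carrier (V a)" "y \<in> carrier (V a)" for x y
    unfolding multilinear_add[OF f v a that] by (rule one_tensor_add[OF frame_modules(2) cl[OF that(1)] cl[OF that(2)]])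
  show "tens 0 (f (v(a := k \<odot>\<^bsub>V a\<^esub> x))) = sc k \<odot>\<^bsub>LV 0\<^esub> tens 0 (f (v(a := x)))"
    if "k \<in> carrier K" "x \<in> carrier (V a)" for k x
    unfolding multilinear_smult[OF f v a that] by (rule one_tensor_smult[OF frame_modules(2) that(1) cl[OF that(2)]])
qed

text \<open>The tuples \<open>v\<close> and \<open>w\<close> are joined through hybrid tuples that
  change one axis at a time.\<close>

lemma one_tensor_multilinear_cong:
  assumes f: "f \<in> multilinear_maps K n V" and v: "v \<in> arg_tuples n V" and w: "w \<in> arg_tuples n V"
    and eq: "\<And>a. a \<in> {1..n} \<Longrightarrow> tens a (v a) = tens a (w a)"
  shows "tens 0 (f v) = tens 0 (f w)"
proof -
  have "tens 0 (f (\<lambda>a\<in>{1..n}. if a \<in> D then w a else v a)) = tens 0 (f v)" if "D \<subseteq> {1..n}" for D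
  proof -
    have "finite D" using that by (rule finite_subset) simp
    then show ?thesis using that
    proof (induction D rule: finite_induct)
      case empty
      have "(\<lambda>a\<in>{1..n}. v a) = v" using v by (auto simp: arg_tuples_def PiE_iff extensional_def)
      then show ?case by simp
    next
      case (insert b D)
      let ?u = "\<lambda>a\<in>{1..n}. if a \<in> D then w a else v a"
      have b: "b \<in> {1..n}" "b \<notin> D" "D \<subseteq> {1..n}" using insert by auto
      have u: "?u \<in> arg_tuples n V"
        by (rule arg_tuples_restrict) (use arg_tuples_component[OF w] arg_tuples_component[OF v] in auto)
      have "(\<lambda>a\<in>{1..n}. if a \<in> insert b D then w a else v a) = ?u(b := w b)"
        using b by (auto simp: fun_eq_iff)
      moreover have "?u(b := v b) = ?u" using b by (auto simp: fun_eq_iff)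
      moreover have "tens 0 (f (?u(b := w b))) = tens 0 (f (?u(b := v b)))"
        by (rule one_tensor_update_cong[OF f u b(1) arg_tuples_component[OF w b(1)] arg_tuples_component[OF v b(1)] eq[OF b(1), symmetric]])
      ultimately show ?case using insert.IH[OF b(3)] by (simp only:)
    qed
  qed
  from this[of "{1..n}"] have "tens 0 (f (\<lambda>a\<in>{1..n}. w a)) = tens 0 (f v)"
    by (simp cong: restrict_cong)
  moreover have "(\<lambda>a\<in>{1..n}. w a) = w" using w by (auto simp: arg_tuples_def PiE_iff extensional_def)
  ultimately show ?thesis by simp
qed

lemma arg_tuples_representative:
  assumes "w \<in> arg_tuples n LV"
  shows "\<exists>v\<in>arg_tuples n V. (\<lambda>a\<in>{1..n}. tens a (v a)) = w"
proof -
  have "\<exists>x. x \<in> carrier (V a) \<and> tens a x = w a" if a: "a \<in> {1..n}" for a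
    using one_tensor_surj[OF frame_modules(1)[OF a] arg_tuples_component[OF assms a]] by metis
  then obtain x where x: "\<And>a. a \<in> {1..n} \<Longrightarrow> x a \<in> carrier (V a) \<and> tens a (x a) = w a" by metis
  have "(\<lambda>a\<in>{1..n}. x a) \<in> arg_tuples n V" by (rule arg_tuples_restrict) (use x in blast)
  moreover have "(\<lambda>a\<in>{1..n}. tens a ((\<lambda>a\<in>{1..n}. x a) a)) = w"
    using x assms by (auto simp: fun_eq_iff arg_tuples_def PiE_iff extensional_def)
  ultimately show ?thesis by blast
qed

lemma multilinear_extension_exists:
  assumes f: "f \<in> multilinear_maps K n V"
  shows "\<exists>g. g \<in> multilinear_maps L n LV \<and>
    (\<forall>v\<in>arg_tuples n V. g (\<lambda>a\<in>{1..n}. tens a (v a)) = tens 0 (f v))"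
proof -
  define rep where "rep = (\<lambda>w. SOME v. v \<in> arg_tuples n V \<and> (\<lambda>a\<in>{1..n}. tens a (v a)) = w)"
  define g where "g = (\<lambda>w\<in>arg_tuples n LV. tens 0 (f (rep w)))"
  have rep: "rep w \<in> arg_tuples n V" "(\<lambda>a\<in>{1..n}. tens a (rep w a)) = w" if "w \<in> arg_tuples n LV" for w
  proof -
    have "\<exists>v. v \<in> arg_tuples n V \<and> (\<lambda>a\<in>{1..n}. tens a (v a)) = w" using arg_tuples_representative[OF that] by blast
    from someI_ex[OF this] show "rep w \<in> arg_tuples n V" "(\<lambda>a\<in>{1..n}. tens a (rep w a)) = w"
      unfolding rep_def by auto
  qed
  have tv: "(\<lambda>a\<in>{1..n}. tens a (v a)) \<in> arg_tuples n LV" if "v \<in> arg_tuples n V" for v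
    by (rule arg_tuples_restrict) (rule one_tensor_closed[OF frame_modules(1) arg_tuples_component[OF that]])
  have g: "g w = tens 0 (f v)" if v: "v \<in> arg_tuples n V" and w: "w = (\<lambda>a\<in>{1..n}. tens a (v a))" for v w
  proof -
    have wc: "w \<in> arg_tuples n LV" using tv[OF v] w by simp
    have "tens 0 (f (rep w)) = tens 0 (f v)"
    proof (rule one_tensor_multilinear_cong[OF f rep(1)[OF wc] v])
      fix a assume a: "a \<in> {1..n}"
      have "(\<lambda>a\<in>{1..n}. tens a (rep w a)) a = (\<lambda>a\<in>{1..n}. tens a (v a)) a" using rep(2)[OF wc] w by simp
      then show "tens a (rep w a) = tens a (v a)" using a by simp
    qed
    then show ?thesis using wc by (simp add: g_def)
  qed
  have upd: "w(a := tens a x) = (\<lambda>b\<in>{1..n}. tens b ((v(a := x)) b))"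
    if "w = (\<lambda>a\<in>{1..n}. tens a (v a))" "a \<in> {1..n}" for w v a x
    using that by (auto simp: fun_eq_iff)
  have "g \<in> multilinear_maps L n LV"
    unfolding multilinear_maps_def
  proof (intro CollectI conjI ballI)
    have "g w \<in> carrier (LV 0)" if w: "w \<in> arg_tuples n LV" for w
      using w one_tensor_closed[OF frame_modules(2) multilinear_closed[OF f rep(1)[OF w]]] by (simp add: g_def)
    then show "g \<in> arg_tuples n LV \<rightarrow>\<^sub>E carrier (LV 0)" by (simp add: PiE_iff g_def)
    fix w a assume w: "w \<in> arg_tuples n LV" and a: "a \<in> {1..n}"
    obtain v where v: "v \<in> arg_tuples n V" "w = (\<lambda>a\<in>{1..n}. tens a (v a))"
      using arg_tuples_representative[OF w] by metis
    interpret Va: module K "V a" by (rule frame_modules(1)[OF a])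
    have gv: "g (w(a := tens a x)) = tens 0 (f (v(a := x)))" if "x \<in> carrier (V a)" for x
      by (rule g[OF arg_tuples_update[OF v(1) a that] upd[OF v(2) a]])
    have cl: "f (v(a := x)) \<in> carrier (V 0)" if "x \<in> carrier (V a)" for x
      by (rule multilinear_closed[OF f arg_tuples_update[OF v(1) a that]])
    {
      fix x y assume x: "x \<in> carrier (LV a)" and y: "y \<in> carrier (LV a)"
      obtain x' where x': "x' \<in> carrier (V a)" "x = tens a x'" by (rule one_tensor_surj[OF frame_modules(1)[OF a] x])
      obtain y' where y': "y' \<in> carrier (V a)" "y = tens a y'" by (rule one_tensor_surj[OF frame_modules(1)[OF a] y])
      have "g (w(a := x \<oplus>\<^bsub>LV a\<^esub> y)) = g (w(a := tens a (x' \<oplus>\<^bsub>V a\<^esub> y')))"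
        using one_tensor_add[OF frame_modules(1)[OF a] x'(1) y'(1)] x' y' by simp
      also have "\<dots> = tens 0 (f (v(a := x')) \<oplus>\<^bsub>V 0\<^esub> f (v(a := y')))"
        using gv[OF Va.add.m_closed[OF x'(1) y'(1)]] multilinear_add[OF f v(1) a x'(1) y'(1)] by simp
      also have "\<dots> = g (w(a := x)) \<oplus>\<^bsub>LV 0\<^esub> g (w(a := y))"
        using one_tensor_add[OF frame_modules(2) cl[OF x'(1)] cl[OF y'(1)]] gv[OF x'(1)] gv[OF y'(1)] x' y' by simp
      finally show "g (w(a := x \<oplus>\<^bsub>LV a\<^esub> y)) = g (w(a := x)) \<oplus>\<^bsub>LV 0\<^esub> g (w(a := y))" .
    next
      fix l x assume l: "l \<in> carrier L" and x: "x \<in> carrier (LV a)"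
      obtain x' where x': "x' \<in> carrier (V a)" "x = tens a x'" by (rule one_tensor_surj[OF frame_modules(1)[OF a] x])
      obtain k where k: "k \<in> carrier K" "l = sc k" using surj[OF l] unfolding sc_def by (elim bexE)
      have "g (w(a := l \<odot>\<^bsub>LV a\<^esub> x)) = g (w(a := tens a (k \<odot>\<^bsub>V a\<^esub> x')))"
        using one_tensor_smult[OF frame_modules(1)[OF a] k(1) x'(1)] x' k by simp
      also have "\<dots> = tens 0 (k \<odot>\<^bsub>V 0\<^esub> f (v(a := x')))"
        using gv[OF Va.smult_closed[OF k(1) x'(1)]] multilinear_smult[OF f v(1) a k(1) x'(1)] by simp
      also have "\<dots> = l \<odot>\<^bsub>LV 0\<^esub> g (w(a := x))"
        using one_tensor_smult[OF frame_modules(2) k(1) cl[OF x'(1)]] gv[OF x'(1)] x' k by simp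
      finally show "g (w(a := l \<odot>\<^bsub>LV a\<^esub> x)) = l \<odot>\<^bsub>LV 0\<^esub> g (w(a := x))" .
    }
  qed
  moreover have "\<forall>v\<in>arg_tuples n V. g (\<lambda>a\<in>{1..n}. tens a (v a)) = tens 0 (f v)"
    by (intro ballI g refl)
  ultimately show ?thesis by (intro exI conjI)
qed

text \<open>Existence and uniqueness together release the definite description. Uniqueness holds
  because every tuple over \<open>L\<close> comes from a tuple over \<open>K\<close>, and
  extensionality fixes all other values.\<close>

lemma multilinear_extension:
  assumes f: "f \<in> multilinear_maps K n V"
  shows "multilinear_extension K L n V f \<in> multilinear_maps L n LV"
    and "v \<in> arg_tuples n V \<Longrightarrow>
      multilinear_extension K L n V f (\<lambda>a\<in>{1..n}. tens a (v a)) = tens 0 (f v)"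
proof -
  let ?Q = "\<lambda>g. g \<in> multilinear_maps L n LV \<and>
    (\<forall>v\<in>arg_tuples n V. g (\<lambda>a\<in>{1..n}. tens a (v a)) = tens 0 (f v))"
  have "\<exists>!g. ?Q g"
  proof (rule ex_ex1I[OF multilinear_extension_exists[OF f]])
    fix g h assume g: "?Q g" and h: "?Q h"
    have "g w = h w" for w
    proof (cases "w \<in> arg_tuples n LV")
      case True
      then obtain v where v: "v \<in> arg_tuples n V" "(\<lambda>a\<in>{1..n}. tens a (v a)) = w"
        using arg_tuples_representative by metis
      have "g (\<lambda>a\<in>{1..n}. tens a (v a)) = h (\<lambda>a\<in>{1..n}. tens a (v a))" using g h v(1) by simp
      then show ?thesis unfolding v(2) .
    next
      case False
      have "g \<in> extensional (arg_tuples n LV)" "h \<in> extensional (arg_tuples n LV)"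
        using g h by (simp_all add: multilinear_maps_def PiE_iff)
      with False show ?thesis by (simp add: extensional_def)
    qed
    then show "g = h" by (rule ext)
  qed
  then have "?Q (THE g. ?Q g)" by (rule theI')
  then show "multilinear_extension K L n V f \<in> multilinear_maps L n LV"
    and "v \<in> arg_tuples n V \<Longrightarrow>
      multilinear_extension K L n V f (\<lambda>a\<in>{1..n}. tens a (v a)) = tens 0 (f v)"
    unfolding multilinear_extension_def by auto
qed

end

end

section \<open>Scalar operators over quotient algebras\<close>

text \<open>The quotient \<open>K / J\<close> has to be carried by the type \<open>'l\<close>. A
  coset is encoded by applying \<open>f\<close> to the one-element list of a chosen representative;
  \<open>h\<close> decodes it up to an element of \<open>J\<close>, and the operations are
  transported along \<open>g\<close>.\<close>

lemma exists_quotient_algebra: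
  fixes K :: "('k, 'm) ring_scheme"
  assumes "cring K" "ideal J K" "large_type TYPE('l) K"
  shows "\<exists>L :: ('k, 'l) module. surjective_algebra K L \<and>
    (\<forall>k\<in>carrier K. k \<odot>\<^bsub>L\<^esub> \<one>\<^bsub>L\<^esub> = \<zero>\<^bsub>L\<^esub> \<longleftrightarrow> k \<in> J)"
proof -
  interpret K: cring K by fact
  interpret J: ideal J K by fact
  obtain f :: "'k list \<Rightarrow> 'l" where f: "inj_on f (lists (carrier K))"
    using assms(3) unfolding large_type_def by blast
  define g where "g = (\<lambda>x. f [SOME y. y \<in> J +>\<^bsub>K\<^esub> x])"
  define h where "h = (\<lambda>l. SOME x. x \<in> carrier K \<and> g x = l)"
  have some: "(SOME y. y \<in> J +>\<^bsub>K\<^esub> x) \<in> J +>\<^bsub>K\<^esub> x" if "x \<in> carrier K" for x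
    by (rule someI) (rule J.a_rcos_self[OF that])
  have someK: "(SOME y. y \<in> J +>\<^bsub>K\<^esub> x) \<in> carrier K" if "x \<in> carrier K" for x
    by (rule J.a_elemrcos_carrier[OF that some[OF that]])
  have g_eq: "g x = g y \<longleftrightarrow> x \<ominus>\<^bsub>K\<^esub> y \<in> J" if x: "x \<in> carrier K" and y: "y \<in> carrier K" for x y
  proof
    assume "g x = g y"
    then have "[SOME z. z \<in> J +>\<^bsub>K\<^esub> x] = [SOME z. z \<in> J +>\<^bsub>K\<^esub> y]"
      unfolding g_def by (rule inj_onD[OF f]) (simp_all add: someK x y)
    then have "J +>\<^bsub>K\<^esub> x = J +>\<^bsub>K\<^esub> y"
      using J.a_repr_independence'[OF some[OF x] x] J.a_repr_independence'[OF some[OF y] y] by simp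
    then show "x \<ominus>\<^bsub>K\<^esub> y \<in> J" using K.quotient_eq_iff_same_a_r_cos[OF assms(2) x y] by simp
  next
    assume "x \<ominus>\<^bsub>K\<^esub> y \<in> J"
    then have "J +>\<^bsub>K\<^esub> x = J +>\<^bsub>K\<^esub> y" using K.quotient_eq_iff_same_a_r_cos[OF assms(2) x y] by simp
    then show "g x = g y" by (simp add: g_def)
  qed
  have h: "h (g x) \<in> carrier K" "h (g x) \<ominus>\<^bsub>K\<^esub> x \<in> J" if x: "x \<in> carrier K" for x
  proof -
    have "h (g x) \<in> carrier K \<and> g (h (g x)) = g x" unfolding h_def by (rule someI[of _ x]) (simp add: x)
    then show "h (g x) \<in> carrier K" "h (g x) \<ominus>\<^bsub>K\<^esub> x \<in> J" using g_eq[OF _ x] by auto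
  qed
  define L :: "('k, 'l) module" where
    "L = \<lparr>carrier = g ` carrier K, monoid.mult = (\<lambda>a b. g (h a \<otimes>\<^bsub>K\<^esub> h b)), monoid.one = g \<one>\<^bsub>K\<^esub>,
      ring.zero = g \<zero>\<^bsub>K\<^esub>, ring.add = (\<lambda>a b. g (h a \<oplus>\<^bsub>K\<^esub> h b)), smult = (\<lambda>k a. g (k \<otimes>\<^bsub>K\<^esub> h a))\<rparr>"
  have add: "g x \<oplus>\<^bsub>L\<^esub> g y = g (x \<oplus>\<^bsub>K\<^esub> y)" if x: "x \<in> carrier K" and y: "y \<in> carrier K" for x y
  proof -
    have "(h (g x) \<oplus>\<^bsub>K\<^esub> h (g y)) \<ominus>\<^bsub>K\<^esub> (x \<oplus>\<^bsub>K\<^esub> y) = (h (g x) \<ominus>\<^bsub>K\<^esub> x) \<oplus>\<^bsub>K\<^esub> (h (g y) \<ominus>\<^bsub>K\<^esub> y)"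
      using x y h(1) by algebra
    also have "\<dots> \<in> J" using h(2)[OF x] h(2)[OF y] by simp
    finally show ?thesis using g_eq x y h(1) by (simp add: L_def)
  qed
  have smult: "k \<odot>\<^bsub>L\<^esub> g y = g (k \<otimes>\<^bsub>K\<^esub> y)" if k: "k \<in> carrier K" and y: "y \<in> carrier K" for k y
  proof -
    have "k \<otimes>\<^bsub>K\<^esub> h (g y) \<ominus>\<^bsub>K\<^esub> k \<otimes>\<^bsub>K\<^esub> y = k \<otimes>\<^bsub>K\<^esub> (h (g y) \<ominus>\<^bsub>K\<^esub> y)" using k y h(1) by algebra
    also have "\<dots> \<in> J" using h(2)[OF y] k by (simp add: J.I_l_closed)
    finally show ?thesis using g_eq k y h(1) by (simp add: L_def)
  qed
  have mult: "g x \<otimes>\<^bsub>L\<^esub> g y = g (x \<otimes>\<^bsub>K\<^esub> y)" if x: "x \<in> carrier K" and y: "y \<in> carrier K" for x y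
  proof -
    have "h (g x) \<otimes>\<^bsub>K\<^esub> h (g y) \<ominus>\<^bsub>K\<^esub> x \<otimes>\<^bsub>K\<^esub> y =
        h (g x) \<otimes>\<^bsub>K\<^esub> (h (g y) \<ominus>\<^bsub>K\<^esub> y) \<oplus>\<^bsub>K\<^esub> y \<otimes>\<^bsub>K\<^esub> (h (g x) \<ominus>\<^bsub>K\<^esub> x)"
      using x y h(1) by algebra
    also have "\<dots> \<in> J" using h(2)[OF x] h(2)[OF y] h(1)[OF x] y by (simp add: J.I_l_closed)
    finally show ?thesis using g_eq x y h(1) by (simp add: L_def)
  qed
  have Lc: "carrier L = g ` carrier K" and one: "\<one>\<^bsub>L\<^esub> = g \<one>\<^bsub>K\<^esub>" and zero: "\<zero>\<^bsub>L\<^esub> = g \<zero>\<^bsub>K\<^esub>"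
    by (simp_all add: L_def)
  have gL: "g x \<in> carrier L" if "x \<in> carrier K" for x using that by (simp add: Lc)
  have rep: "\<exists>x. x \<in> carrier K \<and> l = g x" if "l \<in> carrier L" for l using that by (auto simp: Lc)
  note simps = add smult mult one zero gL
  have "algebra K L"
  proof (rule algebraI[OF assms(1)])
    show "cring L"
    proof (rule cringI)
      show "abelian_group L"
      proof (rule abelian_groupI)
        fix a assume "a \<in> carrier L"
        then obtain x where x: "x \<in> carrier K" "a = g x" using rep by metis
        show "\<exists>b\<in>carrier L. b \<oplus>\<^bsub>L\<^esub> a = \<zero>\<^bsub>L\<^esub>"
          by (rule bexI[of _ "g (\<ominus>\<^bsub>K\<^esub> x)"]) (simp_all add: simps x K.l_neg)
      qed (auto simp: simps K.a_ac dest!: rep)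
      show "comm_monoid L"
        by (rule comm_monoidI) (auto simp: simps K.m_ac dest!: rep)
    qed (auto simp: simps K.l_distr dest!: rep)
  qed (auto simp: simps K.l_distr K.r_distr K.m_ac dest!: rep)
  moreover have "\<exists>k\<in>carrier K. l = k \<odot>\<^bsub>L\<^esub> \<one>\<^bsub>L\<^esub>" if l: "l \<in> carrier L" for l
    using rep[OF l] by (auto simp: simps)
  moreover have "k \<odot>\<^bsub>L\<^esub> \<one>\<^bsub>L\<^esub> = \<zero>\<^bsub>L\<^esub> \<longleftrightarrow> k \<in> J" if "k \<in> carrier K" for k
    using that by (simp add: simps g_eq a_minus_def)
  ultimately show ?thesis by (auto simp: surjective_algebra_def)
qed

lemma (in module) finsum_smult_rdistr:
  "\<lbrakk>finite A; x \<in> carrier M; f \<in> A \<rightarrow> carrier R\<rbrakk> \<Longrightarrow>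
    (\<Oplus>i\<in>A. f i) \<odot>\<^bsub>M\<^esub> x = (\<Oplus>\<^bsub>M\<^esub>i\<in>A. f i \<odot>\<^bsub>M\<^esub> x)"
proof (induction rule: finite_induct)
  case (insert a A)
  then have f: "f \<in> A \<rightarrow> carrier R" "f a \<in> carrier R" by auto
  then have "(\<lambda>i. f i \<odot>\<^bsub>M\<^esub> x) \<in> A \<rightarrow> carrier M" using insert.prems by (auto simp: Pi_iff)
  with f insert show ?case by (simp add: smult_l_distr)
qed simp

definition scalar_tuple ::
    "('k, 'm) ring_scheme \<Rightarrow> ('k, 'l) module \<Rightarrow> (nat \<Rightarrow> ('k, 'v) module) \<Rightarrow> nat set \<Rightarrow> (nat \<Rightarrow> 'k)
     \<Rightarrow> nat \<Rightarrow> ('v \<Rightarrow> 'l) set \<Rightarrow> ('v \<Rightarrow> 'l) set" where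
  "scalar_tuple K L V A s =
     (\<lambda>a\<in>A. \<lambda>x\<in>carrier (base_change K L (V a)). (s a \<odot>\<^bsub>L\<^esub> \<one>\<^bsub>L\<^esub>) \<odot>\<^bsub>base_change K L (V a)\<^esub> x)"

context surjective_algebra
begin

context
  fixes V :: "nat \<Rightarrow> ('k, 'v) module" and n :: nat and A :: "nat set"
  assumes V: "\<forall>a\<in>{0..n}. module K (V a)" and A: "A \<subseteq> {0..n}"
begin

lemma scalar_tuple_closed:
  assumes "s \<in> A \<rightarrow> carrier K"
  shows "scalar_tuple K L V A s \<in> operator_tuples K L V A"
  unfolding operator_tuples_def
proof (rule PiE_I)
  fix a assume a: "a \<in> A"
  interpret B: module L "base_change K L (V a)" by (rule base_change_is_module) (use a V A in blast)
  have s: "sc (s a) \<in> carrier L" by (rule sc_closed[OF funcset_mem[OF assms a]])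
  have "scalar_tuple K L V A s a = (\<lambda>x\<in>carrier (base_change K L (V a)). sc (s a) \<odot>\<^bsub>base_change K L (V a)\<^esub> x)"
    using a by (simp add: scalar_tuple_def sc_def)
  then show "scalar_tuple K L V A s a \<in> module_endos L (base_change K L (V a))"
    using s by (auto simp: module_endos_def linear_maps_def B.smult_r_distr B.smult_assoc1[symmetric] L.m_comm)
qed (simp add: scalar_tuple_def)

text \<open>Outside \<open>A\<close> the tuple is \<open>undefined\<close>; the premise on
  \<open>m\<close> leaves only its zeroth power there, which is the identity.\<close>

lemma scalar_tuple_power:
  assumes s: "s \<in> {0..n} \<rightarrow> carrier K" and a: "a \<in> {0..n}" and m: "a \<notin> A \<Longrightarrow> m = 0"
    and x: "x \<in> carrier (base_change K L (V a))"
  shows "(scalar_tuple K L V A s a ^^ m) x = sc (s a [^] m) \<odot>\<^bsub>base_change K L (V a)\<^esub> x"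
proof -
  interpret B: module L "base_change K L (V a)" by (rule base_change_is_module) (use a V in blast)
  interpret h: ring_hom_cring K L sc by (rule sc_hom)
  have sa: "s a \<in> carrier K" using funcset_mem[OF s a] .
  show ?thesis
  proof (cases "a \<in> A")
    case False
    then show ?thesis using m x by simp
  next
    case True
    have step: "scalar_tuple K L V A s a y = sc (s a) \<odot>\<^bsub>base_change K L (V a)\<^esub> y"
      if "y \<in> carrier (base_change K L (V a))" for y
      using True that by (simp add: scalar_tuple_def sc_def)
    show ?thesis
    proof (induction m)
      case 0
      then show ?case using x by simp
    next
      case (Suc m)
      have "(scalar_tuple K L V A s a ^^ Suc m) x = sc (s a) \<odot>\<^bsub>base_change K L (V a)\<^esub> (sc (s a [^] m) \<odot>\<^bsub>base_change K L (V a)\<^esub> x)"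
        using Suc step[OF B.smult_closed[OF sc_closed[OF K.nat_pow_closed[OF sa]] x]] by simp
      also have "\<dots> = (sc (s a) \<otimes>\<^bsub>L\<^esub> sc (s a [^] m)) \<odot>\<^bsub>base_change K L (V a)\<^esub> x"
        by (rule B.smult_assoc1[symmetric]) (use sa x in auto)
      also have "sc (s a) \<otimes>\<^bsub>L\<^esub> sc (s a [^] m) = sc (s a [^] Suc m)"
        using sa by (simp add: K.m_comm)
      finally show ?case .
    qed
  qed
qed

text \<open>Scalars pull out of every axis, the output axis \<open>0\<close> included, and multiply
  to the value of the monomial. Whether a scalar tuple is a zero is thus a question of which numbers
  \<open>p(s)\<close> annihilate the tensor values.\<close>

lemma tensor_eval_scalar_tuple:
  assumes s: "s \<in> {0..n} \<rightarrow> carrier K" and f: "f \<in> multilinear_maps K n V"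
    and p: "p \<in> K.indexed_pset A (carrier K)" and w: "w \<in> arg_tuples n (\<lambda>a. base_change K L (V a))"
  shows "tensor_eval K L n V f p (scalar_tuple K L V A s) w =
    sc (K.poly_value {0..n} s p) \<odot>\<^bsub>base_change K L (V 0)\<^esub> multilinear_extension K L n V f w"
proof -
  let ?B = "\<lambda>a. base_change K L (V a)" and ?g = "multilinear_extension K L n V f"
  interpret h: ring_hom_cring K L sc by (rule sc_hom)
  interpret B0: module L "?B 0" by (rule base_change_is_module) (use V in auto)
  have g: "?g \<in> multilinear_maps L n ?B" by (rule multilinear_extension(1)[OF V f])
  have gw: "?g w \<in> carrier (?B 0)" by (rule multilinear_closed[OF g w])
  have sc_s: "sc (s a [^] (m :: nat)) \<in> carrier L" if "a \<in> {0..n}" for a m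
    using funcset_mem[OF s that] by simp
  have pc: "p e \<in> carrier K" for e using K.carrier_coeff_pset[OF p] by (simp add: K.carrier_coeff_def)
  have mv: "K.monomial_value {0..n} s e \<in> carrier K" for e by (rule K.monomial_value_closed[OF s])
  have term_eq: "(p e \<odot>\<^bsub>L\<^esub> \<one>\<^bsub>L\<^esub>) \<odot>\<^bsub>?B 0\<^esub> (scalar_tuple K L V A s 0 ^^ count e 0)
        (?g (\<lambda>a\<in>{1..n}. (scalar_tuple K L V A s a ^^ count e a) (w a)))
      = sc (p e \<otimes> K.monomial_value {0..n} s e) \<odot>\<^bsub>?B 0\<^esub> ?g w" if e: "p e \<noteq> \<zero>" for e
  proof -
    have cnt: "count e a = 0" if "a \<notin> A" for a
      using K.indexed_pset_support(2)[OF p e] that by (auto simp: not_in_iff[symmetric])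
    let ?c = "\<lambda>a. sc (s a [^] count e a)"
    have arg: "(\<lambda>a\<in>{1..n}. (scalar_tuple K L V A s a ^^ count e a) (w a)) =
        (\<lambda>a\<in>{1..n}. if a \<in> {1..n} then ?c a \<odot>\<^bsub>?B a\<^esub> w a else w a)"
      by (rule restrict_ext) (use scalar_tuple_power[OF s _ cnt arg_tuples_component[OF w]] in auto)
    have cc: "?c \<in> {1..n} \<rightarrow> carrier L" by (rule funcsetI, rule sc_s) auto
    have gx: "?g (\<lambda>a\<in>{1..n}. (scalar_tuple K L V A s a ^^ count e a) (w a)) =
        (\<Otimes>\<^bsub>L\<^esub>a\<in>{1..n}. ?c a) \<odot>\<^bsub>?B 0\<^esub> ?g w"
      unfolding arg by (rule multilinear_scale[OF base_change_frame_modules[OF V] g w cc order.refl])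
    have prc: "(\<Otimes>\<^bsub>L\<^esub>a\<in>{1..n}. ?c a) \<in> carrier L" by (rule L.finprod_closed[OF cc])
    have "(scalar_tuple K L V A s 0 ^^ count e 0) ((\<Otimes>\<^bsub>L\<^esub>a\<in>{1..n}. ?c a) \<odot>\<^bsub>?B 0\<^esub> ?g w) =
        ?c 0 \<odot>\<^bsub>?B 0\<^esub> ((\<Otimes>\<^bsub>L\<^esub>a\<in>{1..n}. ?c a) \<odot>\<^bsub>?B 0\<^esub> ?g w)"
      by (rule scalar_tuple_power[OF s _ cnt B0.smult_closed[OF prc gw]]) auto
    also have "\<dots> = (?c 0 \<otimes>\<^bsub>L\<^esub> (\<Otimes>\<^bsub>L\<^esub>a\<in>{1..n}. ?c a)) \<odot>\<^bsub>?B 0\<^esub> ?g w"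
      by (rule B0.smult_assoc1[symmetric, OF sc_s prc gw]) simp
    also have "?c 0 \<otimes>\<^bsub>L\<^esub> (\<Otimes>\<^bsub>L\<^esub>a\<in>{1..n}. ?c a) = (\<Otimes>\<^bsub>L\<^esub>a\<in>insert 0 {1..n}. ?c a)"
      by (rule L.finprod_insert[symmetric]) (use cc sc_s in auto)
    also have "insert 0 {1..n} = {0..n}" by auto
    also have "(\<Otimes>\<^bsub>L\<^esub>a\<in>{0..n}. ?c a) = sc (K.monomial_value {0..n} s e)"
      unfolding K.monomial_value_def
      using h.hom_finprod[of "\<lambda>a. s a [^] count e a" "{0..n}"] s by (simp add: o_def Pi_iff)
    finally show ?thesis
      unfolding gx sc_def[symmetric] using B0.smult_assoc1[OF sc_closed[OF pc] sc_closed[OF mv] gw] pc mv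
      by simp
  qed
  have "tensor_eval K L n V f p (scalar_tuple K L V A s) w =
      (\<Oplus>\<^bsub>?B 0\<^esub>e\<in>{e. p e \<noteq> \<zero>}. sc (p e \<otimes> K.monomial_value {0..n} s e) \<odot>\<^bsub>?B 0\<^esub> ?g w)"
    unfolding tensor_eval_def
    by (rule B0.M.finsum_cong') (use term_eq B0.smult_closed[OF sc_closed[OF K.m_closed[OF pc mv]] gw] in auto)
  also have "\<dots> = (\<Oplus>\<^bsub>L\<^esub>e\<in>{e. p e \<noteq> \<zero>}. sc (p e \<otimes> K.monomial_value {0..n} s e)) \<odot>\<^bsub>?B 0\<^esub> ?g w"
    by (rule B0.finsum_smult_rdistr[symmetric])
      (use K.indexed_pset_support(1)[OF p] gw sc_closed[OF K.m_closed[OF pc mv]] in auto)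
  also have "(\<Oplus>\<^bsub>L\<^esub>e\<in>{e. p e \<noteq> \<zero>}. sc (p e \<otimes> K.monomial_value {0..n} s e)) = sc (K.poly_value {0..n} s p)"
    unfolding K.poly_value_def
    using h.hom_finsum[of "\<lambda>e. p e \<otimes> K.monomial_value {0..n} s e" "{e. p e \<noteq> \<zero>}"] K.m_closed[OF pc mv]
    by (simp add: o_def Pi_iff)
  finally show ?thesis .
qed

text \<open>Scalar operators commute, so both orders of composition agree and \<open>lam a\<close>,
  \<open>rho a\<close> enter only through their sum. This is the origin of \<open>d\<close>.\<close>

lemma bullet_scalar_tuple:
  assumes s: "s \<in> A \<rightarrow> carrier K" "t \<in> A \<rightarrow> carrier K"
    and lam: "\<forall>a\<in>A. lam a \<in> carrier K \<and> rho a \<in> carrier K"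
  shows "bullet K L V A lam rho (scalar_tuple K L V A s) (scalar_tuple K L V A t) =
    scalar_tuple K L V A (\<lambda>a. (lam a \<oplus> rho a) \<otimes> s a \<otimes> t a)"
proof -
  interpret h: ring_hom_cring K L sc by (rule sc_hom)
  have "axis_product (base_change K L (V a)) (sc (lam a)) (sc (rho a))
      (scalar_tuple K L V A s a) (scalar_tuple K L V A t a) =
      scalar_tuple K L V A (\<lambda>a. (lam a \<oplus> rho a) \<otimes> s a \<otimes> t a) a" if a: "a \<in> A" for a
  proof -
    interpret B: module L "base_change K L (V a)" by (rule base_change_is_module) (use a V A in blast)
    have c: "lam a \<in> carrier K" "rho a \<in> carrier K" "s a \<in> carrier K" "t a \<in> carrier K"
      using lam s a by auto
    show ?thesis
      unfolding axis_product_def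
    proof (rule ext)
      fix x
      show "(\<lambda>v\<in>carrier (base_change K L (V a)).
         sc (lam a) \<odot>\<^bsub>base_change K L (V a)\<^esub> scalar_tuple K L V A s a (scalar_tuple K L V A t a v) \<oplus>\<^bsub>base_change K L (V a)\<^esub>
         sc (rho a) \<odot>\<^bsub>base_change K L (V a)\<^esub> scalar_tuple K L V A t a (scalar_tuple K L V A s a v)) x =
         scalar_tuple K L V A (\<lambda>a. (lam a \<oplus> rho a) \<otimes> s a \<otimes> t a) a x"
      proof (cases "x \<in> carrier (base_change K L (V a))")
        case True
        have "sc (lam a) \<otimes>\<^bsub>L\<^esub> (sc (s a) \<otimes>\<^bsub>L\<^esub> sc (t a)) \<oplus>\<^bsub>L\<^esub> sc (rho a) \<otimes>\<^bsub>L\<^esub> (sc (t a) \<otimes>\<^bsub>L\<^esub> sc (s a)) =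
            sc ((lam a \<oplus> rho a) \<otimes> s a \<otimes> t a)"
          using c by (simp add: L.l_distr L.r_distr L.m_ac)
        then show ?thesis using True a c
          by (simp add: scalar_tuple_def sc_def[symmetric] B.smult_assoc1[symmetric] B.smult_l_distr[symmetric])
      next
        case False
        then show ?thesis using a by (simp add: scalar_tuple_def)
      qed
    qed
  qed
  then show ?thesis unfolding bullet_def sc_def[symmetric] by (auto simp: fun_eq_iff scalar_tuple_def)
qed

end

end

section \<open>Counting the axes\<close>

context cring
begin

lemma indexed_pset_mono:
  assumes "p \<in> indexed_pset A (carrier R)" "A \<subseteq> B"
  shows "p \<in> indexed_pset B (carrier R)"
  using assms by (induction) (auto intro: indexed_pset.intros)

lemma poly_value_linear_homogeneous:
  assumes I: "finite I" "A \<subseteq> I" and s: "s \<in> I \<rightarrow> carrier R"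
    and p: "p \<in> indexed_pset A (carrier R)" and lin: "linear_homogeneous R p"
  shows "poly_value I s p = (\<Oplus>a\<in>A. p {#a#} \<otimes> s a)"
proof -
  have c: "p e \<in> carrier R" for e using carrier_coeff_pset[OF p] by (simp add: carrier_coeff_def)
  have sc: "s a \<in> carrier R" if "a \<in> I" for a using funcset_mem[OF s that] .
  have "{e. p e \<noteq> \<zero>} \<subseteq> (\<lambda>a. {#a#}) ` A"
  proof
    fix e assume e: "e \<in> {e. p e \<noteq> \<zero>}"
    then obtain a where a: "e = {#a#}" using lin by (auto simp: linear_homogeneous_def)
    then have "a \<in> A" using indexed_pset_support(2)[OF p, of e] e by simp
    with a show "e \<in> (\<lambda>a. {#a#}) ` A" by blast
  qed
  then have "poly_value I s p = (\<Oplus>e\<in>(\<lambda>a. {#a#}) ` A. p e \<otimes> monomial_value I s e)"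
    using poly_value_superset[OF carrier_coeff_pset[OF p] s] I by (simp add: finite_subset)
  also have "\<dots> = (\<Oplus>a\<in>A. p {#a#} \<otimes> monomial_value I s {#a#})"
    by (rule finsum_reindex) (use c monomial_value_closed[OF s] in \<open>auto simp: inj_on_def\<close>)
  also have "\<dots> = (\<Oplus>a\<in>A. p {#a#} \<otimes> s a)"
  proof (rule finsum_cong')
    fix a assume "a \<in> A"
    then have a: "a \<in> I" using I by blast
    have "monomial_value I s {#} = \<one>" by (simp add: monomial_value_def)
    then have "monomial_value I s {#a#} = s a"
      using monomial_value_add_mset[OF I(1) s a, of "{#}"] sc[OF a] by simp
    then show "p {#a#} \<otimes> monomial_value I s {#a#} = p {#a#} \<otimes> s a" by simp
  qed (use c sc I in auto)
  finally show ?thesis .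
qed

text \<open>The scalars that multiply \<open>F\<close> into \<open>I\<close>, as an intersection of
  colon ideals; \<open>F \<noteq> {}\<close> keeps this intersection inside the carrier.\<close>

lemma ideal_common_colon:
  assumes "ideal I R" "F \<subseteq> carrier R" "F \<noteq> {}"
  shows "ideal {x \<in> carrier R. \<forall>f\<in>F. f \<otimes> x \<in> I} R"
proof -
  have "{x \<in> carrier R. \<forall>f\<in>F. f \<otimes> x \<in> I} = \<Inter>((\<lambda>f. {x \<in> carrier R. f \<otimes> x \<in> I}) ` F)"
    using assms(3) by auto
  moreover have "ideal (\<Inter>((\<lambda>f. {x \<in> carrier R. f \<otimes> x \<in> I}) ` F)) R"
    by (rule i_Intersect) (use assms ideal_colon in auto)
  ultimately show ?thesis by simp
qed

end

text \<open>Because \<open>x = q (i x)\<close>, an element with all coordinates in \<open>J\<close>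
  is a sum of multiples \<open>a \<odot> q e_b\<close> with \<open>a \<in> J\<close>, so it lies in
  \<open>J M\<close>. The form of an induction rule serves two purposes: vanishing in the base
  change, and control of the coordinates of \<open>u x\<close> for an endomorphism
  \<open>u\<close>.\<close>

lemma retract_coordinates_induct:
  assumes M: "module R M" and i: "i \<in> linear_maps R M (free_module R B)"
    and q: "q \<in> linear_maps R (free_module R B) M" and qi: "\<forall>x\<in>carrier M. q (i x) = x"
    and x: "x \<in> carrier M" and J: "\<And>b. i x b \<in> J" and J0: "\<zero>\<^bsub>R\<^esub> \<in> J"
    and Hzero: "\<zero>\<^bsub>M\<^esub> \<in> H"
    and Hadd: "\<And>a m h. a \<in> J \<Longrightarrow> a \<in> carrier R \<Longrightarrow> m \<in> carrier M \<Longrightarrow> h \<in> carrier M \<Longrightarrow> h \<in> H \<Longrightarrow>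
      a \<odot>\<^bsub>M\<^esub> m \<oplus>\<^bsub>M\<^esub> h \<in> H"
  shows "x \<in> H"
proof -
  interpret M: module R M by (rule M)
  interpret F: module R "free_module R B" by (rule M.R.free_module_is_module)
  have q': "q y \<in> carrier M" "q (y \<oplus>\<^bsub>free_module R B\<^esub> z) = q y \<oplus>\<^bsub>M\<^esub> q z"
    "r \<in> carrier R \<Longrightarrow> q (r \<odot>\<^bsub>free_module R B\<^esub> y) = r \<odot>\<^bsub>M\<^esub> q y"
    if "y \<in> carrier (free_module R B)" "z \<in> carrier (free_module R B)" for y z r
    using q that by (auto simp: linear_maps_def)
  have "(\<forall>b. y b \<in> J) \<longrightarrow> q y \<in> H" if "y \<in> carrier (free_module R B)" for y
    using that
  proof (induction rule: M.R.free_module_induct)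
    case zero
    then show ?case
      using linear_map_zero[OF F.module_axioms M q] Hzero by (simp add: M.R.free_module_simps(2))
  next
    case (add y b r)
    have bc: "basis_vector R b \<in> carrier (free_module R B)" by (rule M.R.basis_vector_closed[OF add.hyps(2)])
    show ?case
    proof
      assume *: "\<forall>c. r \<otimes>\<^bsub>R\<^esub> basis_vector R b c \<oplus>\<^bsub>R\<^esub> y c \<in> J"
      have yc: "y c \<in> carrier R" for c by (rule M.R.free_module_coeff[OF add.hyps(1)])
      have r: "r \<in> J" using *[rule_format, of b] add.hyps by (simp add: basis_vector_def)
      have "y c \<in> J" for c
      proof (cases "c = b")
        case True
        then show ?thesis using J0 add.hyps by simp
      next
        case False
        then show ?thesis using *[rule_format, of c] add.hyps(3) yc[of c] by (simp add: basis_vector_def)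
      qed
      then have qy: "q y \<in> H" using add.IH by blast
      have "q (r \<odot>\<^bsub>free_module R B\<^esub> basis_vector R b \<oplus>\<^bsub>free_module R B\<^esub> y)
          = r \<odot>\<^bsub>M\<^esub> q (basis_vector R b) \<oplus>\<^bsub>M\<^esub> q y"
        using q'(2)[OF F.smult_closed[OF add.hyps(3) bc] add.hyps(1)] q'(3)[OF bc bc add.hyps(3)] by simp
      also have "\<dots> \<in> H"
        by (rule Hadd[OF r add.hyps(3) q'(1)[OF bc bc] q'(1)[OF add.hyps(1,1)] qy])
      finally show "q (\<lambda>c. r \<otimes>\<^bsub>R\<^esub> basis_vector R b c \<oplus>\<^bsub>R\<^esub> y c) \<in> H"
        by (simp add: M.R.free_module_simps(3,4))
    qed
  qed
  moreover have "i x \<in> carrier (free_module R B)" using i x by (auto simp: linear_maps_def)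
  ultimately have "q (i x) \<in> H" using J by blast
  with qi x show ?thesis by simp
qed

lemma linear_mapD:
  assumes "f \<in> linear_maps R M N"
  shows "x \<in> carrier M \<Longrightarrow> f x \<in> carrier N"
    and "x \<in> carrier M \<Longrightarrow> y \<in> carrier M \<Longrightarrow> f (x \<oplus>\<^bsub>M\<^esub> y) = f x \<oplus>\<^bsub>N\<^esub> f y"
    and "r \<in> carrier R \<Longrightarrow> x \<in> carrier M \<Longrightarrow> f (r \<odot>\<^bsub>M\<^esub> x) = r \<odot>\<^bsub>N\<^esub> f x"
  using assms by (auto simp: linear_maps_def)

text \<open>The kernel of \<open>M \<rightarrow> (K / J) \<otimes> M\<close> is \<open>J M\<close>,
  and for a retract of a free module the coordinates detect \<open>J M\<close>. This turns equations
  in the base change into memberships in \<open>J\<close>.\<close>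

lemma (in surjective_algebra) one_tensor_eq_zero_iff:
  assumes M: "module K M" and i: "i \<in> linear_maps K M (free_module K B)"
    and q: "q \<in> linear_maps K (free_module K B) M" and qi: "\<forall>x\<in>carrier M. q (i x) = x"
    and J: "ideal J K" "\<And>k. k \<in> carrier K \<Longrightarrow> sc k = \<zero>\<^bsub>L\<^esub> \<longleftrightarrow> k \<in> J"
    and x: "x \<in> carrier M"
  shows "one_tensor K L M x = \<zero>\<^bsub>base_change K L M\<^esub> \<longleftrightarrow> (\<forall>b. i x b \<in> J)"
proof -
  interpret M: module K M by (rule M)
  interpret F: module K "free_module K B" by (rule K.free_module_is_module)
  interpret B: module L "base_change K L M" by (rule base_change_is_module[OF M])
  interpret J: ideal J K by (rule J)
  interpret h: ring_hom_cring K L sc by (rule sc_hom)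
  have t0: "one_tensor K L M \<zero>\<^bsub>M\<^esub> = \<zero>\<^bsub>base_change K L M\<^esub>"
    using one_tensor_smult[OF M K.zero_closed M.M.zero_closed] one_tensor_closed[OF M M.M.zero_closed] by simp
  have ic: "i y b \<in> carrier K" if "y \<in> carrier M" for y b
    by (rule K.free_module_coeff[OF linear_mapD(1)[OF i that]])
  show ?thesis
  proof
    assume "\<forall>b. i x b \<in> J"
    then have "x \<in> {y. one_tensor K L M y = \<zero>\<^bsub>base_change K L M\<^esub>}"
    proof (intro retract_coordinates_induct[OF M i q qi x, where J = J])
      fix a m y assume a: "a \<in> J" "a \<in> carrier K" and m: "m \<in> carrier M" and y: "y \<in> carrier M"
        and ty: "y \<in> {y. one_tensor K L M y = \<zero>\<^bsub>base_change K L M\<^esub>}"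
      have "one_tensor K L M (a \<odot>\<^bsub>M\<^esub> m \<oplus>\<^bsub>M\<^esub> y) =
          sc a \<odot>\<^bsub>base_change K L M\<^esub> one_tensor K L M m \<oplus>\<^bsub>base_change K L M\<^esub> one_tensor K L M y"
        using one_tensor_add[OF M M.smult_closed[OF a(2) m] y] one_tensor_smult[OF M a(2) m] by simp
      also have "\<dots> = \<zero>\<^bsub>base_change K L M\<^esub>"
        using J(2)[OF a(2)] a(1) ty one_tensor_closed[OF M m] by simp
      finally show "a \<odot>\<^bsub>M\<^esub> m \<oplus>\<^bsub>M\<^esub> y \<in> {y. one_tensor K L M y = \<zero>\<^bsub>base_change K L M\<^esub>}" by simp
    qed (simp_all add: t0)
    then show "one_tensor K L M x = \<zero>\<^bsub>base_change K L M\<^esub>" by simp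
  next
    assume tx: "one_tensor K L M x = \<zero>\<^bsub>base_change K L M\<^esub>"
    \<comment> \<open>The coordinates reduced modulo \<open>J\<close>: a \<open>K\<close>-linear map
      into a free \<open>L\<close>-module, hence constant on elements with equal tensors.\<close>
    let ?\<psi> = "\<lambda>y b. sc (i y b)"
    have "?\<psi> x = ?\<psi> \<zero>\<^bsub>M\<^esub>"
    proof (rule one_tensor_universal[OF M L.free_module_is_module[of B], where \<psi> = ?\<psi>])
      show "?\<psi> \<in> carrier M \<rightarrow> carrier (free_module L B)"
      proof
        fix y assume y: "y \<in> carrier M"
        have iy: "i y \<in> carrier (free_module K B)" by (rule linear_mapD(1)[OF i y])
        have "{b. sc (i y b) \<noteq> \<zero>\<^bsub>L\<^esub>} \<subseteq> {b. i y b \<noteq> \<zero>}" by auto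
        then show "?\<psi> y \<in> carrier (free_module L B)"
          using iy unfolding K.free_module_simps L.free_module_simps by (auto intro: finite_subset)
      qed
      show "?\<psi> (y \<oplus>\<^bsub>M\<^esub> z) = ?\<psi> y \<oplus>\<^bsub>free_module L B\<^esub> ?\<psi> z" if "y \<in> carrier M" "z \<in> carrier M" for y z
        using linear_mapD(2)[OF i that] ic[OF that(1)] ic[OF that(2)]
        by (simp add: K.free_module_simps(3) L.free_module_simps(3))
      show "?\<psi> (k \<odot>\<^bsub>M\<^esub> y) = sc k \<odot>\<^bsub>free_module L B\<^esub> ?\<psi> y" if "k \<in> carrier K" "y \<in> carrier M" for k y
        using linear_mapD(3)[OF i that] ic[OF that(2)] that(1)
        by (simp add: K.free_module_simps(4) L.free_module_simps(4))
    qed (use x tx t0 in simp_all)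
    also have "i \<zero>\<^bsub>M\<^esub> = (\<lambda>_. \<zero>)"
      using linear_map_zero[OF M F.module_axioms i] by (simp add: K.free_module_simps(2))
    finally have "sc (i x b) = \<zero>\<^bsub>L\<^esub>" for b by (simp add: fun_eq_iff)
    then show "\<forall>b. i x b \<in> J" using J(2)[OF ic[OF x]] by simp
  qed
qed

text \<open>The product of the unit \<open>u\<close> with the identity endomorphism collapses to
  \<open>(l + r) u\<close>, so \<open>u\<close> divides by \<open>l + r\<close> on the
  module.\<close>

lemma unital_axis_inverse:
  assumes M: "module K M" and lr: "l \<in> carrier K" "r \<in> carrier K" and "unital_axis K M l r"
  obtains u where "u \<in> linear_maps K M M" "\<And>x. x \<in> carrier M \<Longrightarrow> (l \<oplus>\<^bsub>K\<^esub> r) \<odot>\<^bsub>M\<^esub> u x = x"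
proof -
  interpret M: module K M by (rule M)
  let ?id = "\<lambda>x\<in>carrier M. x"
  obtain u where u: "u \<in> module_endos K M"
    and eq: "\<And>x. x \<in> module_endos K M \<Longrightarrow> axis_product M l r u x = x"
    using assms(4) unfolding unital_axis_def by blast
  have "?id \<in> module_endos K M" by (auto simp: module_endos_def linear_maps_def)
  then have id: "axis_product M l r u ?id = ?id" by (rule eq)
  have u': "u \<in> linear_maps K M M" using u by (simp add: module_endos_def)
  have "(l \<oplus>\<^bsub>K\<^esub> r) \<odot>\<^bsub>M\<^esub> u x = x" if x: "x \<in> carrier M" for x
    using fun_cong[OF id, of x] x linear_mapD(1)[OF u' x] lr by (simp add: axis_product_def M.smult_l_distr)
  with u' that show thesis by blast
qed

theorem theorem4:
  fixes K :: "('k, 'm) ring_scheme"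
    and n r :: nat
    and V :: "nat \<Rightarrow> ('k, 'v) module"
    and T :: "('k, 't) module"
    and br :: "'t \<Rightarrow> (nat \<Rightarrow> 'v) \<Rightarrow> 'v"
    and S :: "'t set"
    and A :: "nat set"
    and p :: "nat \<Rightarrow> nat multiset \<Rightarrow> 'k"
    and P :: "(nat multiset \<Rightarrow> 'k) set"
    and lam rho :: "nat \<Rightarrow> 'k"
  assumes "cring K"
    and "tensor_space K n V T br"
    and "\<forall>a\<in>{0..n}. finitely_generated_module K (V a) \<and> projective_module K (V a)"
    and "\<forall>a\<in>{0..n}. carrier (V a) \<noteq> {\<zero>\<^bsub>V a\<^esub>}"
    and "S \<subseteq> carrier T"
    and "A \<subseteq> {0..n}"
    and "\<forall>i\<in>{1..r}. p i \<in> carrier (indexed_poly_ring K A) \<and> linear_homogeneous K (p i)"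
    and "P = Idl\<^bsub>indexed_poly_ring K {0..n}\<^esub> (p ` {1..r})"
    and "poly_support K n P = A"
    and "full K n V br S \<or> (\<exists>a\<in>{0..n}. nondegenerate_in_axis K n V br S a)"
    and "\<forall>a\<in>A. lam a \<in> carrier K \<and> rho a \<in> carrier K"
    and "large_type TYPE('l) K"
    and "closed_under_bullet TYPE('l) K n V br S P A lam rho"
  shows "card {a \<in> A. unital_axis K (V a) (lam a) (rho a)} \<le> 2 * r \<and>
    (field K \<longrightarrow>
       int (card A) - 2 * int r \<le> int (card {a \<in> A. lie_axis K (lam a) (rho a)}))"
proof -
  interpret K: cring K by fact
  interpret Q: cring "indexed_poly_ring K {0..n}" by (rule K.indexed_poly_ring_is_cring)
  have V: "\<forall>a\<in>{0..n}. module K (V a)" and br: "br \<in> linear_maps K T (multilinear_module K n V)"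
    using assms(2) by (auto simp: tensor_space_def)
  have V0: "module K (V 0)" using V by simp
  interpret V0: module K "V 0" by (rule V0)
  obtain B :: "'v set" and i q where i: "i \<in> linear_maps K (V 0) (free_module K B)"
    and q: "q \<in> linear_maps K (free_module K B) (V 0)" and qi: "\<forall>x\<in>carrier (V 0). q (i x) = x"
  proof -
    have "projective_module K (V 0)" using assms(3) by simp
    then show thesis unfolding projective_module_def by (elim exE bexE) (rule that)
  qed
  interpret F: module K "free_module K B" by (rule K.free_module_is_module)
  have ic: "i y b \<in> carrier K" if "y \<in> carrier (V 0)" for y b
    by (rule K.free_module_coeff[OF linear_mapD(1)[OF i that]])
  have i_smult: "i (k \<odot>\<^bsub>V 0\<^esub> y) b = k \<otimes>\<^bsub>K\<^esub> i y b" if "k \<in> carrier K" "y \<in> carrier (V 0)" for k y b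
    using linear_mapD(3)[OF i that] by (simp add: K.free_module_simps(4))
  have i_add: "i (x \<oplus>\<^bsub>V 0\<^esub> y) b = i x b \<oplus>\<^bsub>K\<^esub> i y b" if "x \<in> carrier (V 0)" "y \<in> carrier (V 0)" for x y b
    using linear_mapD(2)[OF i that] by (simp add: K.free_module_simps(3))
  have brm: "br t \<in> multilinear_maps K n V" if "t \<in> S" for t
    using linear_mapD(1)[OF br subsetD[OF assms(5) that]] by (simp add: multilinear_module_def)
  have brc: "br t v \<in> carrier (V 0)" if "t \<in> S" "v \<in> arg_tuples n V" for t v
    by (rule multilinear_closed[OF brm[OF that(1)] that(2)])
  define F where "F = {i (br t v) b | t v b. t \<in> S \<and> v \<in> arg_tuples n V}"
  have FK: "F \<subseteq> carrier K" unfolding F_def using ic brc by blast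
  have FI: "i (br t v) b \<in> F" if "t \<in> S" "v \<in> arg_tuples n V" for t v b unfolding F_def using that by blast

  obtain f\<^sub>0 where f0: "f\<^sub>0 \<in> F" "f\<^sub>0 \<noteq> \<zero>\<^bsub>K\<^esub>"
  proof -
    \<comment> \<open>The nonzero frame modules matter here: if all of them were zero, every axis
      product would be unital and every \<open>S\<close> full, whatever the size of
      \<open>A\<close>.\<close>
    have "\<exists>t\<in>S. \<exists>v\<in>arg_tuples n V. br t v \<noteq> \<zero>\<^bsub>V 0\<^esub>"
    proof (cases "full K n V br S")
      case True
      show ?thesis
      proof (rule ccontr)
        assume "\<not> ?thesis"
        then have gens: "{br t v | t v. t \<in> S \<and> v \<in> arg_tuples n V} \<subseteq> {\<zero>\<^bsub>V 0\<^esub>}" by blast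
        have "submodule {\<zero>\<^bsub>V 0\<^esub>} K (V 0)" by (rule V0.submoduleI) auto
        from V0.submodule_span_minimal[OF this gens] True
        have "carrier (V 0) \<subseteq> {\<zero>\<^bsub>V 0\<^esub>}" unfolding full_def by simp
        then show False using assms(4) V0.M.zero_closed by auto
      qed
    next
      case False
      then obtain a where a: "a \<in> {0..n}" "a \<noteq> 0" "nondegenerate_in_axis K n V br S a"
        using assms(10) by (metis nondegenerate_in_axis_def)
      interpret Va: module K "V a" using V a(1) by blast
      obtain x where "x \<in> carrier (V a) - {\<zero>\<^bsub>V a\<^esub>}" using assms(4) a(1) Va.M.zero_closed by blast
      then show ?thesis using a(2,3) unfolding nondegenerate_in_axis_def by (metis (no_types, lifting))
    qed
    then obtain t v where tv: "t \<in> S" "v \<in> arg_tuples n V" "br t v \<noteq> \<zero>\<^bsub>V 0\<^esub>" by blast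
    have "i (br t v) \<noteq> (\<lambda>_. \<zero>\<^bsub>K\<^esub>)"
    proof
      assume "i (br t v) = (\<lambda>_. \<zero>\<^bsub>K\<^esub>)"
      then have "q (i (br t v)) = \<zero>\<^bsub>V 0\<^esub>"
        using linear_map_zero[OF F.module_axioms V0 q] by (simp add: K.free_module_simps(2))
      then show False using qi brc tv by simp
    qed
    then obtain b where "i (br t v) b \<noteq> \<zero>\<^bsub>K\<^esub>" by auto
    then show thesis using that FI[OF tv(1,2)] by blast
  qed
  have finA: "finite A" using assms(6) finite_subset by blast
  define C where "C = (\<lambda>j a. p j {#a#})"
  define d where "d = (\<lambda>a. lam a \<oplus>\<^bsub>K\<^esub> rho a)"
  have pA: "p j \<in> K.indexed_pset A (carrier K)" and plin: "linear_homogeneous K (p j)" if "j \<in> {1..r}" for j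
    using assms(7) that by (auto simp: K.indexed_poly_ring_simps)
  have plin': "linear_homogeneous K g" if "g \<in> p ` {1..r}" for g using that plin by blast
  have pN: "p j \<in> K.indexed_pset {0..n} (carrier K)" if "j \<in> {1..r}" for j
    by (rule K.indexed_pset_mono[OF pA[OF that] assms(6)])
  have G: "p ` {1..r} \<subseteq> K.indexed_pset {0..n} (carrier K)" using pN by blast
  have pP: "p j \<in> P" if "j \<in> {1..r}" for j
    using Q.genideal_self[of "p ` {1..r}"] G that unfolding assms(8) by (auto simp: K.indexed_poly_ring_simps)
  have Cc: "C j a \<in> carrier K" if "j \<in> {1..r}" for j a
    using K.carrier_coeff_pset[OF pA[OF that]] by (simp add: C_def K.carrier_coeff_def)
  have dc: "d a \<in> carrier K" if "a \<in> A" for a using assms(11) that by (simp add: d_def)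

  have bound: "card {a \<in> A. F \<subseteq> K.product_ideal {d a} F} \<le> 2 * card {1..r}"
  proof (rule K.columns_absorbing_bound[OF _ finA, where C = C and f\<^sub>0 = f\<^sub>0])
    show "Idl\<^bsub>K\<^esub> ((\<lambda>j. C j a) ` {1..r}) = carrier K" if a: "a \<in> A" for a
    proof -
      let ?I = "Idl\<^bsub>K\<^esub> ((\<lambda>j. C j a) ` {1..r})"
      have idI: "ideal ?I K" by (rule K.genideal_ideal) (use Cc in auto)
      have "Idl\<^bsub>K\<^esub> {p {#a#} | p. p \<in> P \<and> linear_homogeneous K p} = carrier K"
        using a assms(9) unfolding poly_support_def by auto
      moreover have "Idl\<^bsub>K\<^esub> {p {#a#} | p. p \<in> P \<and> linear_homogeneous K p} \<subseteq> ?I"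
      proof (rule K.genideal_minimal[OF idI], rule subsetI)
        fix x assume "x \<in> {p {#a#} | p. p \<in> P \<and> linear_homogeneous K p}"
        then obtain p' where "p' \<in> P" "x = p' {#a#}" by blast
        moreover have "(\<lambda>g. g {#a#}) ` p ` {1..r} = (\<lambda>j. C j a) ` {1..r}" by (auto simp: C_def)
        ultimately show "x \<in> ?I"
          using K.linear_coefficients_of_generated_ideal[OF G plin', of p' a] unfolding assms(8) by simp
      qed
      ultimately show ?thesis using ideal.axioms(1)[OF idI] additive_subgroup.a_subset by blast
    qed
  next
    \<comment> \<open>Memberships in \<open>I\<close> are read as zeros over an algebra
      \<open>L\<close> isomorphic to \<open>K / I\<close>, closure is applied to two scalar tuples
      there, and the outcome is read back in \<open>I\<close>.\<close>
    fix I u v j f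
    assume I: "ideal I K" and u: "u \<in> A \<rightarrow> carrier K" and v: "v \<in> A \<rightarrow> carrier K"
      and uI: "\<forall>j\<in>{1..r}. \<forall>f\<in>F. (\<Oplus>\<^bsub>K\<^esub>a\<in>A. C j a \<otimes>\<^bsub>K\<^esub> u a) \<otimes>\<^bsub>K\<^esub> f \<in> I"
      and vI: "\<forall>j\<in>{1..r}. \<forall>f\<in>F. (\<Oplus>\<^bsub>K\<^esub>a\<in>A. C j a \<otimes>\<^bsub>K\<^esub> v a) \<otimes>\<^bsub>K\<^esub> f \<in> I"
      and j: "j \<in> {1..r}" and f: "f \<in> F"
    obtain L :: "('k, 'l) module" where L: "surjective_algebra K L"
      and LI: "\<forall>k\<in>carrier K. k \<odot>\<^bsub>L\<^esub> \<one>\<^bsub>L\<^esub> = \<zero>\<^bsub>L\<^esub> \<longleftrightarrow> k \<in> I"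
      using exists_quotient_algebra[OF assms(1) I assms(12)] by blast
    interpret L: surjective_algebra K L by (rule L)
    have scI: "L.sc k = \<zero>\<^bsub>L\<^esub> \<longleftrightarrow> k \<in> I" if "k \<in> carrier K" for k
      using LI that by (simp add: L.sc_def)
    let ?LV = "\<lambda>a. base_change K L (V a)"
    have zero_iff: "L.sc x \<odot>\<^bsub>?LV 0\<^esub> one_tensor K L (V 0) y = \<zero>\<^bsub>?LV 0\<^esub> \<longleftrightarrow> (\<forall>b. x \<otimes>\<^bsub>K\<^esub> i y b \<in> I)"
      if "x \<in> carrier K" "y \<in> carrier (V 0)" for x y
      using L.one_tensor_eq_zero_iff[OF V0 i q qi I scI V0.smult_closed[OF that]]
        L.one_tensor_smult[OF V0 that] i_smult[OF that] by simp
    \<comment> \<open>\<open>P\<close> is generated in \<open>K[x_0, ..., x_n]\<close>, so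
      evaluation asks for a scalar on every axis. Extension by zero leaves the operator tuple on
      \<open>A\<close> unchanged.\<close>
    define ext where "ext = (\<lambda>s a. if a \<in> A then s a else \<zero>\<^bsub>K\<^esub>)"
    have extc: "ext s \<in> {0..n} \<rightarrow> carrier K" if "s \<in> A \<rightarrow> carrier K" for s
      using that by (auto simp: ext_def)
    have ext_scalar: "scalar_tuple K L V A (ext s) = scalar_tuple K L V A s" for s
      by (auto simp: scalar_tuple_def ext_def fun_eq_iff)
    have value_p: "K.poly_value {0..n} (ext s) (p k) = (\<Oplus>\<^bsub>K\<^esub>a\<in>A. C k a \<otimes>\<^bsub>K\<^esub> s a)"
      if s: "s \<in> A \<rightarrow> carrier K" and k: "k \<in> {1..r}" for s k
    proof -
      have "K.poly_value {0..n} (ext s) (p k) = (\<Oplus>\<^bsub>K\<^esub>a\<in>A. p k {#a#} \<otimes>\<^bsub>K\<^esub> ext s a)"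
        by (rule K.poly_value_linear_homogeneous[OF _ assms(6) extc[OF s] pA[OF k] plin[OF k]]) simp
      also have "\<dots> = (\<Oplus>\<^bsub>K\<^esub>a\<in>A. C k a \<otimes>\<^bsub>K\<^esub> s a)"
        by (rule K.finsum_cong') (use s Cc[OF k] in \<open>auto simp: ext_def C_def\<close>)
      finally show ?thesis .
    qed
    have zeros: "scalar_tuple K L V A s \<in> operator_zeros K L n V br S P A"
      if s: "s \<in> A \<rightarrow> carrier K"
        and sI: "\<forall>j\<in>{1..r}. \<forall>f\<in>F. (\<Oplus>\<^bsub>K\<^esub>a\<in>A. C j a \<otimes>\<^bsub>K\<^esub> s a) \<otimes>\<^bsub>K\<^esub> f \<in> I" for s
      unfolding operator_zeros_def
    proof (intro CollectI conjI ballI)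
      show "scalar_tuple K L V A s \<in> operator_tuples K L V A"
        by (rule L.scalar_tuple_closed[OF V assms(6) s])
      fix t p' w assume t: "t \<in> S" and p': "p' \<in> P \<inter> carrier (indexed_poly_ring K A)"
        and w: "w \<in> arg_tuples n ?LV"
      \<comment> \<open>A zero must annihilate all tensor values at once, so the values of
        \<open>P\<close> are tested for membership in this colon ideal, where checking the
        generators is enough.\<close>
      let ?J = "{x \<in> carrier K. \<forall>f\<in>F. f \<otimes>\<^bsub>K\<^esub> x \<in> I}"
      have sumc: "(\<Oplus>\<^bsub>K\<^esub>a\<in>A. C k a \<otimes>\<^bsub>K\<^esub> s a) \<in> carrier K" if "k \<in> {1..r}" for k
        by (rule K.finsum_closed) (use Cc[OF that] s in auto)
      have "p' \<in> K.indexed_pset {0..n} (carrier K) \<and> K.poly_value {0..n} (ext s) p' \<in> ?J"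
      proof (rule K.poly_value_of_generated_ideal[OF _ extc[OF s] _ G])
        show "ideal ?J K" by (rule K.ideal_common_colon[OF I FK]) (use f in blast)
        fix g assume "g \<in> p ` {1..r}"
        then obtain k where k: "k \<in> {1..r}" "g = p k" by blast
        have "f \<otimes>\<^bsub>K\<^esub> (\<Oplus>\<^bsub>K\<^esub>a\<in>A. C k a \<otimes>\<^bsub>K\<^esub> s a) \<in> I" if "f \<in> F" for f
          using sI k(1) that K.m_comm[OF subsetD[OF FK that] sumc[OF k(1)]] by simp
        then show "K.poly_value {0..n} (ext s) g \<in> ?J"
          unfolding k(2) value_p[OF s k(1)] using sumc[OF k(1)] by simp
      qed (use p' assms(8) in auto)
      then have val: "K.poly_value {0..n} (ext s) p' \<in> carrier K"
        "\<And>f. f \<in> F \<Longrightarrow> f \<otimes>\<^bsub>K\<^esub> K.poly_value {0..n} (ext s) p' \<in> I" by auto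
      obtain x where x: "x \<in> arg_tuples n V" "(\<lambda>a\<in>{1..n}. one_tensor K L (V a) (x a)) = w"
        using L.arg_tuples_representative[OF V w] by blast
      have "tensor_eval K L n V (br t) p' (scalar_tuple K L V A s) w =
          L.sc (K.poly_value {0..n} (ext s) p') \<odot>\<^bsub>?LV 0\<^esub> one_tensor K L (V 0) (br t x)"
        using L.tensor_eval_scalar_tuple[OF V assms(6) extc[OF s] brm[OF t] _ w, of p'] p'
          L.multilinear_extension(2)[OF V brm[OF t] x(1)] x(2)
        by (simp add: ext_scalar K.indexed_poly_ring_simps)
      also have "\<dots> = \<zero>\<^bsub>?LV 0\<^esub>"
        unfolding zero_iff[OF val(1) brc[OF t x(1)]]
        using val(2)[OF FI[OF t x(1)]] K.m_comm[OF val(1) ic[OF brc[OF t x(1)]]] by simp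
      finally show "tensor_eval K L n V (br t) p' (scalar_tuple K L V A s) w = \<zero>\<^bsub>?LV 0\<^esub>" .
    qed
    let ?s = "\<lambda>a. d a \<otimes>\<^bsub>K\<^esub> u a \<otimes>\<^bsub>K\<^esub> v a"
    have s: "?s \<in> A \<rightarrow> carrier K" using dc u v by (simp add: Pi_iff)
    have "bullet K L V A lam rho (scalar_tuple K L V A u) (scalar_tuple K L V A v)
        \<in> operator_zeros K L n V br S P A"
      using assms(13) L.alg zeros[OF u uI] zeros[OF v vI] unfolding closed_under_bullet_def by blast
    then have zs: "scalar_tuple K L V A ?s \<in> operator_zeros K L n V br S P A"
      using L.bullet_scalar_tuple[OF V assms(6) u v assms(11)] by (simp add: d_def)
    obtain t x b where tx: "t \<in> S" "x \<in> arg_tuples n V" "f = i (br t x) b" using f unfolding F_def by blast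
    \<comment> \<open>Since \<open>f\<close> is a coordinate of
      \<open>\<langle>t|x\<rangle>\<close>, evaluation at the tensors \<open>1 \<otimes> x_a\<close>
      brings the membership for \<open>f\<close> back.\<close>
    let ?w = "\<lambda>a\<in>{1..n}. one_tensor K L (V a) (x a)"
    have w: "?w \<in> arg_tuples n ?LV"
    proof (rule arg_tuples_restrict)
      fix a assume a: "a \<in> {1..n}"
      then have "module K (V a)" using V by simp
      then show "one_tensor K L (V a) (x a) \<in> carrier (?LV a)"
        by (rule L.one_tensor_closed[OF _ arg_tuples_component[OF tx(2) a]])
    qed
    have pjA: "p j \<in> P \<inter> carrier (indexed_poly_ring K A)" using pP[OF j] assms(7) j by blast
    have "tensor_eval K L n V (br t) (p j) (scalar_tuple K L V A ?s) ?w = \<zero>\<^bsub>?LV 0\<^esub>"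
      using zs tx(1) pjA w unfolding operator_zeros_def by blast
    then have "L.sc (\<Oplus>\<^bsub>K\<^esub>a\<in>A. C j a \<otimes>\<^bsub>K\<^esub> ?s a) \<odot>\<^bsub>?LV 0\<^esub> one_tensor K L (V 0) (br t x) = \<zero>\<^bsub>?LV 0\<^esub>"
      using L.tensor_eval_scalar_tuple[OF V assms(6) extc[OF s] brm[OF tx(1)] pA[OF j] w]
        L.multilinear_extension(2)[OF V brm[OF tx(1)] tx(2)] value_p[OF s j] by (simp only: ext_scalar)
    moreover have "(\<Oplus>\<^bsub>K\<^esub>a\<in>A. C j a \<otimes>\<^bsub>K\<^esub> ?s a) \<in> carrier K"
      by (rule K.finsum_closed) (use Cc[OF j] s in \<open>simp add: Pi_iff\<close>)
    ultimately show "(\<Oplus>\<^bsub>K\<^esub>a\<in>A. C j a \<otimes>\<^bsub>K\<^esub> ?s a) \<otimes>\<^bsub>K\<^esub> f \<in> I"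
      using zero_iff brc[OF tx(1,2)] tx(3) by blast
  qed (use FK f0 Cc dc in auto)

  have unital: "F \<subseteq> K.product_ideal {d a} F" if a: "a \<in> A" and un: "unital_axis K (V a) (lam a) (rho a)" for a
  proof -
    have aN: "a \<in> {0..n}" using a assms(6) by blast
    have Va: "module K (V a)" using V aN by blast
    obtain u where u: "u \<in> linear_maps K (V a) (V a)" "\<And>x. x \<in> carrier (V a) \<Longrightarrow> d a \<odot>\<^bsub>V a\<^esub> u x = x"
      using unital_axis_inverse[OF Va _ _ un] assms(11) a unfolding d_def by metis
    note uc = linear_mapD(1)[OF u(1)]
    have sub: "{d a} \<subseteq> carrier K" using dc[OF a] by simp
    have "i (br t v) b \<in> K.product_ideal {d a} F" if t: "t \<in> S" and v: "v \<in> arg_tuples n V" for t v b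
    proof (cases "a = 0")
      case False
      \<comment> \<open>On an input axis, \<open>v a\<close> is \<open>d a\<close> times
        \<open>u (v a)\<close>. The factor moves out by multilinearity and leaves another tensor
        value.\<close>
      then have a1: "a \<in> {1..n}" using aN by auto
      have va: "v a \<in> carrier (V a)" by (rule arg_tuples_component[OF v a1])
      have v': "v(a := u (v a)) \<in> arg_tuples n V" by (rule arg_tuples_update[OF v a1 uc[OF va]])
      have "br t v = br t (v(a := d a \<odot>\<^bsub>V a\<^esub> u (v a)))" using u(2)[OF va] by simp
      also have "\<dots> = d a \<odot>\<^bsub>V 0\<^esub> br t (v(a := u (v a)))"
        by (rule multilinear_smult[OF brm[OF t] v a1 dc[OF a] uc[OF va]])
      finally have "i (br t v) b = d a \<otimes>\<^bsub>K\<^esub> i (br t (v(a := u (v a)))) b"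
        using i_smult[OF dc[OF a] brc[OF t v']] by simp
      then show ?thesis using K.product_idealI[OF sub FK _ FI[OF t v']] by simp
    next
      case True
      note u0 = u[unfolded True] and uc0 = uc[unfolded True]
      \<comment> \<open>On the output axis, \<open>y = d a \<odot> u y\<close>, but
        \<open>u y\<close> need not be a tensor value, so its coordinates may lie outside
        \<open>F\<close>. By linearity of \<open>u\<close> they lie in the ideal generated by the
        coordinates of \<open>y\<close>, and this ideal is contained in \<open>J\<close>.\<close>
      define J where "J = {g \<in> carrier K. d a \<otimes>\<^bsub>K\<^esub> g \<in> K.product_ideal {d a} F}"
      have idJ: "ideal J K"
        unfolding J_def by (rule K.ideal_colon[OF K.product_ideal_is_ideal[OF sub FK] dc[OF a]])
      interpret J: ideal J K by (rule idJ)
      let ?y = "br t v" and ?H = "{h. \<forall>b. i (u h) b \<in> J}"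
      have y: "?y \<in> carrier (V 0)" by (rule brc[OF t v])
      have "?y \<in> ?H"
      proof (rule retract_coordinates_induct[OF V0 i q qi y, where J = J])
        show "i ?y b \<in> J" for b
          unfolding J_def
        proof (rule CollectI, rule conjI[OF ic[OF y]])
          show "d a \<otimes>\<^bsub>K\<^esub> i ?y b \<in> K.product_ideal {d a} F"
            by (rule K.product_idealI[OF sub FK _ FI[OF t v]]) simp
        qed
        have "u \<zero>\<^bsub>V 0\<^esub> = \<zero>\<^bsub>V 0\<^esub>" by (rule linear_map_zero[OF V0 V0 u0(1)])
        moreover have "i \<zero>\<^bsub>V 0\<^esub> = (\<lambda>_. \<zero>\<^bsub>K\<^esub>)"
          using linear_map_zero[OF V0 F.module_axioms i] by (simp add: K.free_module_simps(2))
        ultimately have "i (u \<zero>\<^bsub>V 0\<^esub>) b \<in> J" for b by (simp only:) (rule J.zero_closed)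
        then show "\<zero>\<^bsub>V 0\<^esub> \<in> ?H" by (intro CollectI allI)
        fix k m h assume k: "k \<in> J" "k \<in> carrier K" and m: "m \<in> carrier (V 0)" and h: "h \<in> carrier (V 0)"
          and hJ: "h \<in> ?H"
        have "i (u (k \<odot>\<^bsub>V 0\<^esub> m \<oplus>\<^bsub>V 0\<^esub> h)) b \<in> J" for b
        proof -
          have "i (u (k \<odot>\<^bsub>V 0\<^esub> m \<oplus>\<^bsub>V 0\<^esub> h)) b = k \<otimes>\<^bsub>K\<^esub> i (u m) b \<oplus>\<^bsub>K\<^esub> i (u h) b"
            using linear_mapD(2)[OF u0(1) V0.smult_closed[OF k(2) m] h] linear_mapD(3)[OF u0(1) k(2) m]
              i_add[OF V0.smult_closed[OF k(2) uc0[OF m]] uc0[OF h]] i_smult[OF k(2) uc0[OF m]] by simp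
          also have "\<dots> \<in> J"
          proof (rule J.a_closed)
            show "k \<otimes>\<^bsub>K\<^esub> i (u m) b \<in> J" by (rule J.I_r_closed[OF k(1) ic[OF uc0[OF m]]])
            show "i (u h) b \<in> J" using hJ by simp
          qed
          finally show ?thesis .
        qed
        then show "k \<odot>\<^bsub>V 0\<^esub> m \<oplus>\<^bsub>V 0\<^esub> h \<in> ?H" by (intro CollectI allI)
      qed (rule J.zero_closed)
      then have "i (u ?y) b \<in> J" by simp
      then have "d a \<otimes>\<^bsub>K\<^esub> i (u ?y) b \<in> K.product_ideal {d a} F" unfolding J_def by simp
      moreover have "i ?y b = d a \<otimes>\<^bsub>K\<^esub> i (u ?y) b"
        using i_smult[OF dc[OF a] uc0[OF y]] u0(2)[OF y] True by simp
      ultimately show ?thesis by simp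
    qed
    then show ?thesis unfolding F_def by blast
  qed
  have "card {a \<in> A. unital_axis K (V a) (lam a) (rho a)} \<le> card {a \<in> A. F \<subseteq> K.product_ideal {d a} F}"
    by (rule card_mono) (use finA unital in auto)
  moreover have "int (card A) - 2 * int r \<le> int (card {a \<in> A. lie_axis K (lam a) (rho a)})" if "field K"
  proof -
    interpret field K by (rule that)
    \<comment> \<open>Over a field, \<open>d a\<close> is a unit unless the axis product is Lie, and
      multiplication by a unit absorbs any \<open>F\<close>.\<close>
    have "F \<subseteq> K.product_ideal {d a} F" if a: "a \<in> A" and nl: "\<not> lie_axis K (lam a) (rho a)" for a
    proof
      fix f assume f: "f \<in> F"
      have sub: "{d a} \<subseteq> carrier K" using dc[OF a] by simp
      interpret J: ideal "K.product_ideal {d a} F" K by (rule K.product_ideal_is_ideal[OF sub FK])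
      have un: "d a \<in> Units K" using nl dc[OF a] field_Units by (simp add: lie_axis_def d_def)
      have fc: "f \<in> carrier K" using f FK by blast
      have "inv\<^bsub>K\<^esub> d a \<otimes>\<^bsub>K\<^esub> (d a \<otimes>\<^bsub>K\<^esub> f) \<in> K.product_ideal {d a} F"
        by (rule J.I_l_closed[OF K.product_idealI[OF sub FK _ f]]) (use un in auto)
      moreover have "inv\<^bsub>K\<^esub> d a \<otimes>\<^bsub>K\<^esub> (d a \<otimes>\<^bsub>K\<^esub> f) = f"
        using un fc dc[OF a] K.m_assoc[of "inv\<^bsub>K\<^esub> d a" "d a" f] by simp
      ultimately show "f \<in> K.product_ideal {d a} F" by simp
    qed
    then have "card (A - {a \<in> A. lie_axis K (lam a) (rho a)}) \<le> card {a \<in> A. F \<subseteq> K.product_ideal {d a} F}"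
      by (intro card_mono) (use finA in auto)
    moreover have "card (A - {a \<in> A. lie_axis K (lam a) (rho a)}) = card A - card {a \<in> A. lie_axis K (lam a) (rho a)}"
      by (rule card_Diff_subset) (use finA in auto)
    ultimately show ?thesis using bound by simp
  qed
  ultimately show ?thesis using bound by simp
qed

end
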